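(* Let $d\ge2$, let ${\mathcal P}={\mathcal P}({\mathcal W},{\mathcal L})$ be a regular cut-and-project set, and let $F_{\mathcal P}$ be the function from the free path limit theorem (defined below). Then there is a subset ${\mathfrak S}\subset\mathbb{R}^d$ of Lebesgue measure zero such that for every ${\boldsymbol q}\in\mathbb{R}^d\setminus{\mathfrak S}$, every $\xi>0$ and every Borel probability measure $\lambda$ on $\operatorname{S}_1^{d-1}$ absolutely continuous with respect to Lebesgue measure, $$\lim_{\rho\to0}\lambda\bigl(\{{\boldsymbol v}\in\operatorname{S}_1^{d-1}:\rho^{d-1}\tau_1({\boldsymbol q},{\boldsymbol v};\rho)\ge\xi\}\bigr)=F_{\mathcal P}(\xi).$$
   Context: Notation: $n=d+m$, $\mathbb{R}^n=\mathbb{R}^d\times\mathbb{R}^m$; $\pi,\pi_{\rm int}$ the projections onto the first $d$ and last $m$ coordinates. For a full-rank lattice ${\mathcal L}\subset\mathbb{R}^n$, ${\mathcal A}=\overline{\pi_{\rm int}({\mathcal L})}$, ${\mathcal A}^\circ$ its identity component (linear subspace of dimension $m_1$), $\mu_{\mathcal A}$ Haar measure on ${\mathcal A}$ whose restriction to ${\mathcal A}^\circ$ is $m_1$-dimensional Lebesgue measure. For bounded ${\mathcal W}\subset{\mathcal A}$ with nonempty interior, ${\mathcal P}({\mathcal W},{\mathcal L})=\{\pi({\boldsymbol y}):{\boldsymbol y}\in{\mathcal L},\pi_{\rm int}({\boldsymbol y})\in{\mathcal W}\}$, regular if $\mu_{\mathcal A}(\partial{\mathcal W})=0$; standing assumption: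 ${\boldsymbol y}\mapsto\pi({\boldsymbol y})$ is a bijection from $\{{\boldsymbol y}\in{\mathcal L}:\pi_{\rm int}({\boldsymbol y})\in{\mathcal W}\}$ onto ${\mathcal P}$. ${\mathcal K}_\rho=\mathbb{R}^d\setminus({\mathcal B}^d_\rho+{\mathcal P})$ with ${\mathcal B}^d_\rho$ the open ball of radius $\rho$ about ${\bf 0}$; $\tau_1({\boldsymbol q},{\boldsymbol v};\rho)=\inf\{t>0:{\boldsymbol q}+t{\boldsymbol v}\notin{\mathcal K}_\rho\}$. $F_{\mathcal P}:[0,\infty]\to[0,1]$ is the (non-increasing, continuous) function such that for every Borel probability measure $\Lambda$ on $\mathbb{R}^d\times\operatorname{S}_1^{d-1}$ absolutely continuous w.r.t. Lebesgue measure and every $\xi>0$, $\Lambda(\{({\boldsymbol q},{\boldsymbol v})\in\operatorname{T}^1({\mathcal K}_\rho):\rho^{d-1}\tau_1(s{\boldsymbol q},{\boldsymbol v};\rho)\ge\xi\})$-type averages (more precisely $\Lambda^{(s)}(\{({\boldsymbol q},{\boldsymbol v})\in\operatorname{T}^1({\mathcal K}_\rho):\rho^{d-1}\tau_1({\boldsymbol q},{\boldsymbol v};\rho)\ge\xi\})$, where $\Lambda^{(s)}(E)=\Lambda(\{(s^{-1}{\boldsymbol q},{\boldsymbol v}):({\boldsymbol q},{\boldsymbol v})\in E\})$) converge to $F_{\mathcal P}(\xi)$ as $\rho\to0$. *)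

theory Defs
  imports "HOL-Probability.Probability"
begin

text \<open>Ambient space R^n = R^d x R^m is modelled as the product type
  (real^'d) \<times> (real^'m); \<pi> = fst, \<pi>_int = snd.\<close>

definition full_rank_lattice :: "'a::euclidean_space set \<Rightarrow> bool" where
  "full_rank_lattice L \<longleftrightarrow>
     (\<exists>B. independent B \<and> span B = UNIV \<and>
          L = {(\<Sum>b\<in>B. of_int (c b) *\<^sub>R b) | c. True})"

definition cps_A :: "((real^'d) \<times> (real^'m)) set \<Rightarrow> (real^'m) set" where
  "cps_A L = closure (snd ` L)"

definition cps_A0 :: "((real^'d) \<times> (real^'m)) set \<Rightarrow> (real^'m) set" where
  "cps_A0 L = connected_component_set (cps_A L) 0"

text \<open>Null sets of the Haar measure \<mu>_\<A> (normalised so that on \<A>\<degree> it is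
  m1-dimensional Lebesgue measure).  Since \<A> is a countable union of translates
  of \<A>\<degree> and \<mu>_\<A> restricted to each translate c + \<A>\<degree> is m1-dimensional
  Lebesgue measure, a set E \<subseteq> \<A> is \<mu>_\<A>-null iff the "cylinder"
  E + orth(\<A>\<degree>) is null for m-dimensional Lebesgue measure.\<close>
definition haar_A_null :: "((real^'d) \<times> (real^'m)) set \<Rightarrow> (real^'m) set \<Rightarrow> bool" where
  "haar_A_null L E \<longleftrightarrow>
     {a + b | a b. a \<in> E \<and> b \<in> orthogonal_comp (cps_A0 L)} \<in> null_sets lebesgue"

definition cps :: "(real^'m) set \<Rightarrow> ((real^'d) \<times> (real^'m)) set \<Rightarrow> (real^'d) set" where
  "cps W L = fst ` {y \<in> L. snd y \<in> W}"

definition regular_cps :: "(real^'m) set \<Rightarrow> ((real^'d) \<times> (real^'m)) set \<Rightarrow> bool" where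
  "regular_cps W L \<longleftrightarrow>
     full_rank_lattice L \<and>
     W \<subseteq> cps_A L \<and> bounded W \<and>
     (top_of_set (cps_A L)) interior_of W \<noteq> {} \<and>
     haar_A_null L ((top_of_set (cps_A L)) frontier_of W) \<and>
     inj_on fst {y \<in> L. snd y \<in> W}"

definition K_rho :: "(real^'d) set \<Rightarrow> real \<Rightarrow> (real^'d) set" where
  "K_rho P \<rho> = UNIV - {b + p | b p. b \<in> ball 0 \<rho> \<and> p \<in> P}"

text \<open>First free path length (extended real; Inf {} = \<infinity>).\<close>
definition tau1 :: "(real^'d) set \<Rightarrow> real^'d \<Rightarrow> real^'d \<Rightarrow> real \<Rightarrow> ereal" where
  "tau1 P q v \<rho> = Inf {ereal t | t. t > 0 \<and> q + t *\<^sub>R v \<notin> K_rho P \<rho>}"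

text \<open>Lebesgue (surface) measure on the unit sphere S_1^{d-1}, defined as the
  cone measure: \<sigma>(A) = d \<cdot> vol {r u : 0 < r \<le> 1, u \<in> A}.\<close>
definition sphere_measure :: "(real^'d) measure" where
  "sphere_measure =
     density (distr (restrict_space lborel {x. 0 < norm x \<and> norm x \<le> 1}) borel
                    (\<lambda>x. x /\<^sub>R norm x))
             (\<lambda>_. ennreal (real CARD('d)))"

definition ac_sphere_prob :: "(real^'d) measure \<Rightarrow> bool" where
  "ac_sphere_prob lam \<longleftrightarrow> sets lam = sets borel \<and> prob_space lam \<and>
     emeasure lam (sphere 0 1) = 1 \<and> absolutely_continuous sphere_measure lam"

definition ac_T1_prob :: "((real^'d) \<times> (real^'d)) measure \<Rightarrow> bool" where
  "ac_T1_prob \<Lambda> \<longleftrightarrow> sets \<Lambda> = sets (lborel \<Otimes>\<^sub>M sphere_measure) \<and> prob_space \<Lambda> \<and>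
     emeasure \<Lambda> (UNIV \<times> sphere 0 1) = 1 \<and>
     absolutely_continuous (lborel \<Otimes>\<^sub>M sphere_measure) \<Lambda>"

text \<open>F is the limit function of the free path limit theorem for P (macroscopic
  initial data: q = \<rho>^{1-d} q0 with (q0,v) distributed by \<Lambda>, i.e. \<Lambda>^{(s)} with
  s = \<rho>^{1-d}), for all \<xi> > 0.\<close>
definition free_path_limit :: "(real^'d) set \<Rightarrow> (real \<Rightarrow> real) \<Rightarrow> bool" where
  "free_path_limit P F \<longleftrightarrow>
     (\<forall>\<Lambda> \<xi>. ac_T1_prob \<Lambda> \<and> \<xi> > 0 \<longrightarrow>
        ((\<lambda>\<rho>. measure \<Lambda>
            {(q, v). v \<in> sphere 0 1 \<and>
                     (1 / \<rho> ^ (CARD('d) - 1)) *\<^sub>R q \<in> K_rho P \<rho> \<and>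
                     ereal (\<rho> ^ (CARD('d) - 1)) *
                       tau1 P ((1 / \<rho> ^ (CARD('d) - 1)) *\<^sub>R q) v \<rho> \<ge> ereal \<xi>})
         \<longlongrightarrow> F \<xi>) (at_right 0))"

end

theory Submission
  imports Defs
begin

text \<open>
  Fix a velocity weight \<open>b\<close> and let \<open>G q\<close> be the \<open>b\<close>-average over directions of the indicator that the
  tube of radius \<open>\<rho>\<close> and length \<open>\<xi> / \<rho> ^ (d - 1)\<close> issuing from \<open>q\<close> contains no point of the point
  set \<open>P\<close>.  The argument is elementary and rests on two facts, with constants uniform in \<open>\<rho>\<close>.

  (1) Almost periodicity.  If \<open>y\<close> is the physical part of a lattice vector with small internal part in
  the identity component, then by regularity of the window \<open>P\<close> and \<open>P - y\<close> differ in a set of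
  uniformly small density, and summing the angular sizes of these points over dyadic shells shows that
  \<open>G (q + y)\<close> is close to \<open>G q\<close> for every \<open>q\<close> not too close to \<open>P\<close>.

  (2) Decorrelation.  The indicator is nearly invariant under moving \<open>q\<close> along the velocity, so a
  velocity-averaging (\<open>T T*\<close>) argument bounds the mean square of \<open>G q - G (q + h)\<close> over a large ball by
  a power of \<open>\<rho>\<close>.

  By (1), some almost-period translate of a fixed ball inherits the bound (2), and along
  \<open>\<rho> = (k + 1) ^ (-10)\<close> the bounds are summable; Borel--Cantelli and (1) again give \<open>G q - G (q + h) \<longlongrightarrow> 0\<close>
  for almost all \<open>q\<close> and every \<open>h\<close>.  Hence \<open>G q\<close> is asymptotically its mean over a ball of fixed
  radius about \<open>q\<close>, which by (1) is close to the mean over a ball of radius \<open>1 / \<rho> ^ (d - 1)\<close>, and this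
  is what the hypothesis on \<open>F\<close> controls.  Density of countably many weights, the
  monotonicity of the free path length in \<open>\<rho>\<close> and the continuity of \<open>F\<close> do the rest.
\<close>

section \<open>Velocity averaging\<close>

text \<open>The value of the limit is never computed; only the agreement of the pointwise and the
  macroscopic average is proved. Velocity averaging compensates a shift \<open>h\<close> of the
  starting point by a shift \<open>h / t\<close> of the velocity, where \<open>t\<close> is a
  difference of travel times. The sphere admits no such shifts, so velocities range over the whole
  space, the indicator depends on them through \<open>sgn\<close> alone, and the weights are
  Lipschitz functions of the velocity. The travel times grow with \<open>k\<close>, so the mean
  square is controlled only on a growing ball, and hence on some ball of given radius at an unknown
  place that varies with \<open>k\<close>, while Borel--Cantelli needs one fixed ball. This is why
  every almost-period estimate is uniform in the centre and in the period. Those estimates break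
  down where a scatterer is so close that it covers a large angle; such places are treated as a
  separate set of small density. With \<open>s = k + 1\<close> the exponents in
  \<open>rho k = s ^ (-10)\<close>, \<open>n = s ^ 4\<close> and \<open>N = s ^ 8\<close> make every
  error of order \<open>s ^ (-2)\<close> already in dimension two.\<close>

lemma integrable_indicator_cball [simp]:
  "integrable lborel (indicator (cball (c::'a::euclidean_space) r) :: 'a \<Rightarrow> real)"
  using emeasure_lborel_cball_finite[of c r] by (intro integrable_real_indicator) auto

text \<open>This is the price of an off-diagonal term in the velocity averaging: \<open>b\<close>
  and its translate differ by at most \<open>K * norm e\<close>, and only on the ball of radius
  \<open>M + 1\<close>, which holds both supports because \<open>norm e \<le> 1\<close>.\<close>

lemma Lipschitz_translate_L1:
  fixes b :: "'a::euclidean_space \<Rightarrow> real"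
  assumes lip: "\<And>x y. \<bar>b x - b y\<bar> \<le> K * norm (x - y)"
    and supp: "\<And>x. M < norm x \<Longrightarrow> b x = 0"
    and bm: "b \<in> borel_measurable borel"
    and e: "norm e \<le> 1"
  shows "integrable lborel (\<lambda>x. \<bar>b x - b (x + e)\<bar>)"
    and "(\<integral>x. \<bar>b x - b (x + e)\<bar> \<partial>lborel) \<le> K * norm e * measure lborel (cball (0::'a) (M + 1))"
proof -
  have K: "0 \<le> K * norm e" using lip[of 0 e] abs_ge_zero[of "b 0 - b e"] by (simp del: abs_ge_zero)
  have pt: "\<bar>b x - b (x + e)\<bar> \<le> K * norm e * indicator (cball 0 (M + 1)) x" for x
  proof (cases "x \<in> cball 0 (M + 1)")
    case True then show ?thesis using lip[of x "x + e"] by simp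
  next
    case False
    then have "M + 1 < norm x" by simp
    moreover have "norm x \<le> norm (x + e) + norm e" using norm_triangle_ineq4[of "x + e" e] by simp
    ultimately have "M < norm x" "M < norm (x + e)" using e by auto
    then show ?thesis using supp False by simp
  qed
  have i: "integrable lborel (\<lambda>x. K * norm e * indicator (cball (0::'a) (M + 1)) x)"
    by (intro integrable_mult_right integrable_indicator_cball)
  show I: "integrable lborel (\<lambda>x. \<bar>b x - b (x + e)\<bar>)"
    by (rule Bochner_Integration.integrable_bound[OF i]) (use bm pt K in \<open>auto intro!: order_trans[OF pt] abs_ge_self\<close>)
  have "(\<integral>x. \<bar>b x - b (x + e)\<bar> \<partial>lborel) \<le> (\<integral>x. K * norm e * indicator (cball (0::'a) (M + 1)) x \<partial>lborel)"
    by (rule integral_mono[OF I i pt])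
  also have "\<dots> = K * norm e * measure lborel (cball (0::'a) (M + 1))" by simp
  finally show "(\<integral>x. \<bar>b x - b (x + e)\<bar> \<partial>lborel) \<le> K * norm e * measure lborel (cball (0::'a) (M + 1))" .
qed

lemma integrable_bounded_support:
  fixes f :: "'a::euclidean_space \<Rightarrow> real"
  assumes "f \<in> borel_measurable borel" "\<And>x. \<bar>f x\<bar> \<le> B" "\<And>x. x \<notin> cball c r \<Longrightarrow> f x = 0"
  shows "integrable lborel f" and "\<bar>\<integral>x. f x \<partial>lborel\<bar> \<le> B * measure lborel (cball c r)"
proof -
  have pt: "\<bar>f x\<bar> \<le> B * indicator (cball c r) x" for x
    using assms(2)[of x] assms(3)[of x] by (cases "x \<in> cball c r") auto
  have B: "0 \<le> B" using assms(2)[of undefined] by linarith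
  have i: "integrable lborel (\<lambda>x. B * indicator (cball c r) x)"
    by (intro integrable_mult_right integrable_indicator_cball)
  show I: "integrable lborel f"
    by (rule Bochner_Integration.integrable_bound[OF i]) (use assms(1) pt B in auto)
  have "\<bar>\<integral>x. f x \<partial>lborel\<bar> \<le> (\<integral>x. \<bar>f x\<bar> \<partial>lborel)" by (rule integral_abs_bound)
  also have "\<dots> \<le> (\<integral>x. B * indicator (cball c r) x \<partial>lborel)"
    using I i pt by (intro integral_mono) auto
  finally show "\<bar>\<integral>x. f x \<partial>lborel\<bar> \<le> B * measure lborel (cball c r)" by simp
qed

lemma integrable_pair_bounded_support:
  fixes f :: "'a::euclidean_space \<times> 'a \<Rightarrow> real"
  assumes "f \<in> borel_measurable (borel \<Otimes>\<^sub>M borel)" "\<And>z. \<bar>f z\<bar> \<le> B"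
    "\<And>z. z \<notin> cball c r \<times> cball c' r' \<Longrightarrow> f z = 0"
  shows "integrable (lborel \<Otimes>\<^sub>M lborel) f"
proof -
  have pt: "\<bar>f z\<bar> \<le> B * indicator (cball c r \<times> cball c' r') z" for z
    using assms(2)[of z] assms(3)[of z] by (cases "z \<in> cball c r \<times> cball c' r'") auto
  have B: "0 \<le> B" using assms(2)[of undefined] by linarith
  have s: "cball c r \<times> cball c' r' \<in> sets (lborel \<Otimes>\<^sub>M lborel)" by measurable
  have "emeasure (lborel \<Otimes>\<^sub>M lborel) (cball c r \<times> cball c' r') = emeasure lborel (cball c r) * emeasure lborel (cball c' r')"
    by (rule lborel.emeasure_pair_measure_Times) auto
  also have "\<dots> < \<infinity>"
    using emeasure_lborel_cball_finite[of c r] emeasure_lborel_cball_finite[of c' r'] by (simp add: ennreal_mult_less_top)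
  finally have i: "integrable (lborel \<Otimes>\<^sub>M lborel) (\<lambda>z. B * indicator (cball c r \<times> cball c' r') z)"
    using s by (intro integrable_mult_right) simp
  show I: "integrable (lborel \<Otimes>\<^sub>M lborel) f"
    by (rule Bochner_Integration.integrable_bound[OF i]) (use assms(1) pt B in \<open>auto simp: measurable_lborel1 cong: measurable_cong_sets\<close>)
qed

lemma lborel_Fubini_bounded_support:
  fixes f :: "'a::euclidean_space \<Rightarrow> 'a \<Rightarrow> real"
  assumes "(\<lambda>(x, y). f x y) \<in> borel_measurable (borel \<Otimes>\<^sub>M borel)" "\<And>x y. \<bar>f x y\<bar> \<le> B"
    "\<And>x y. x \<notin> cball c r \<Longrightarrow> f x y = 0" "\<And>x y. y \<notin> cball c' r' \<Longrightarrow> f x y = 0"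
  shows "(\<integral>x. (\<integral>y. f x y \<partial>lborel) \<partial>lborel) = (\<integral>y. (\<integral>x. f x y \<partial>lborel) \<partial>lborel)"
proof -
  have "integrable (lborel \<Otimes>\<^sub>M lborel) (\<lambda>(x, y). f x y)"
    by (rule integrable_pair_bounded_support[of _ B c r c' r']) (use assms in \<open>force+\<close>)
  then show ?thesis by (rule lborel_pair.Fubini_integral[symmetric])
qed

lemma lborel_integral_translate:
  fixes f :: "'a::euclidean_space \<Rightarrow> real"
  assumes "f \<in> borel_measurable borel"
  shows "(\<integral>x. f (x + a) \<partial>lborel) = (\<integral>x. f x \<partial>lborel)"
proof -
  have "(\<integral>x. f x \<partial>lborel) = (\<integral>x. f x \<partial>distr lborel borel ((+) a))" by (simp add: lborel_distr_plus)
  also have "\<dots> = (\<integral>x. f (a + x) \<partial>lborel)" using assms by (intro integral_distr) auto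
  finally show ?thesis by (simp add: add.commute)
qed

text \<open>With \<open>w\<close> the difference of the truncated increment of \<open>G\<close> and its translate, the left-hand side is
  \<open>\<integral>b(x) \<integral>w(q) f(q, x)\<close>; replacing \<open>f(q, x)\<close> by \<open>f(q + i n x, x)\<close> for \<open>i = 1, ..., n\<close> moves the
  translations to \<open>w\<close>, and in the square of the resulting average the off-diagonal terms are
  small because translating the Lipschitz weight \<open>b\<close> absorbs \<open>h\<close>.\<close>

lemma decorrelation:
  fixes f :: "'a::euclidean_space \<Rightarrow> 'a \<Rightarrow> real" and b :: "'a \<Rightarrow> real"
  assumes fm: "(\<lambda>(q, x). f q x) \<in> borel_measurable (borel \<Otimes>\<^sub>M borel)"
    and f0: "\<And>q x. 0 \<le> f q x" and f1: "\<And>q x. f q x \<le> 1"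
    and bm [measurable]: "b \<in> borel_measurable borel" and b0: "\<And>x. 0 \<le> b x" and b1: "\<And>x. b x \<le> 1"
    and lip: "\<And>x y. \<bar>b x - b y\<bar> \<le> K * norm (x - y)" and supp: "\<And>x. M < norm x \<Longrightarrow> b x = 0"
    and n: "1 \<le> n" and h: "norm h \<le> real n" and eta: "0 < \<eta>" and M0: "0 \<le> M"
    and near: "\<And>x i. norm x \<le> M \<Longrightarrow> i \<in> {1..n} \<Longrightarrow>
       (\<integral>q. indicator (cball 0 (N + norm h)) q * \<bar>f q x - f (q + (real i * real n) *\<^sub>R x) x\<bar> \<partial>lborel) \<le> e"
  defines "\<kappa> \<equiv> measure lborel (cball (0::'a) (M + 1))"
    and "G \<equiv> \<lambda>q. \<integral>x. b x * f q x \<partial>lborel"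
  shows "(\<integral>q. indicator (cball 0 N) q * (G q - G (q + h))\<^sup>2 \<partial>lborel)
    \<le> \<kappa> * (2 * \<kappa> * e + \<eta> / 2 * measure lborel (cball (0::'a) (N + norm h + real n * real n * M)))
      + (4 * \<kappa> + 2 * \<kappa> * K * norm h) * \<kappa>\<^sup>2 * measure lborel (cball (0::'a) (N + norm h)) / (2 * \<eta> * n)"
proof -
  have fm' [measurable (raw)]: "(\<lambda>z. f (g z) (k z)) \<in> borel_measurable M'"
    if "g \<in> borel_measurable M'" "k \<in> borel_measurable M'" for g k and M' :: "'z measure"
    using measurable_compose[OF measurable_Pair[OF that] fm] by simp
  have kap: "0 \<le> \<kappa>" by (simp add: \<kappa>_def)
  have bsupp: "x \<notin> cball 0 (M + 1) \<Longrightarrow> b x = 0" for x using supp[of x] by auto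
  have bint: "integrable lborel b" and bI: "(\<integral>x. b x \<partial>lborel) \<le> \<kappa>"
    using integrable_bounded_support[of b 1 0 "M + 1"] b0 b1 bsupp by (auto simp: \<kappa>_def abs_le_iff)
  have bI0: "0 \<le> (\<integral>x. b x \<partial>lborel)" using b0 by (simp add: integral_nonneg)
  have Gm [measurable]: "G \<in> borel_measurable borel" unfolding G_def by measurable
  have G0: "0 \<le> G q" and G1: "G q \<le> \<kappa>" for q
  proof -
    show "0 \<le> G q" unfolding G_def using b0 f0 by (simp add: integral_nonneg)
    have "\<bar>b x * f q x\<bar> \<le> 1" for x using b0 b1 f0 f1 by (simp add: abs_mult mult_le_one)
    then show "G q \<le> \<kappa>"
      using integrable_bounded_support(2)[of "\<lambda>x. b x * f q x" 1 0 "M + 1"] bsupp by (auto simp: G_def \<kappa>_def)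
  qed
  \<comment> \<open>Discrete integration by parts: the square of the increment is \<open>u\<close>
    times the increment of \<open>G\<close>, and translating the second half by \<open>h\<close>
    moves the increment onto \<open>u\<close>. Only \<open>G\<close>, which is linear in
    \<open>f\<close>, is left next to \<open>w\<close>.\<close>
  define u where "u q = indicator (cball 0 N) q * (G q - G (q + h))" for q
  define w where "w q = u q - u (q - h)" for q
  have Gh: "(\<lambda>q. G (q + h)) \<in> borel_measurable borel" by (rule measurable_compose[OF _ Gm]) simp
  have um [measurable]: "u \<in> borel_measurable borel"
    unfolding u_def by (intro borel_measurable_times borel_measurable_diff Gm Gh borel_measurable_indicator) simp
  have wm [measurable]: "w \<in> borel_measurable borel" unfolding w_def by measurable
  have ub: "\<bar>u q\<bar> \<le> \<kappa>" for q
    using G0[of q] G1[of q] G0[of "q+h"] G1[of "q+h"] kap by (auto simp: u_def indicator_def)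
  have wb: "\<bar>w q\<bar> \<le> 2 * \<kappa>" for q using ub[of q] ub[of "q - h"] by (simp add: w_def)
  have usupp: "q \<notin> cball 0 N \<Longrightarrow> u q = 0" for q by (simp add: u_def)
  have wsupp: "q \<notin> cball 0 (N + norm h) \<Longrightarrow> w q = 0" for q
  proof -
    assume "q \<notin> cball 0 (N + norm h)"
    then have "N + norm h < norm q" by simp
    moreover have "norm q \<le> norm (q - h) + norm h" using norm_triangle_ineq[of "q - h" h] by simp
    ultimately have "q \<notin> cball 0 N" "q - h \<notin> cball 0 N"
      using norm_ge_zero[of h] unfolding mem_cball_0 by linarith+
    then show "w q = 0" by (simp add: w_def usupp)
  qed
  define B1 where "B1 = measure lborel (cball (0::'a) (N + norm h))"
  define B2 where "B2 = measure lborel (cball (0::'a) (N + norm h + real n * real n * M))"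
  have B10: "0 \<le> B1" by (simp add: B1_def)
  have Gb: "\<bar>G q\<bar> \<le> \<kappa>" for q using G0[of q] G1[of q] by simp
  have mulb: "\<bar>x * y\<bar> \<le> c * d" if "\<bar>x\<bar> \<le> c" "\<bar>y\<bar> \<le> d" for x y c d :: real
    using mult_mono[OF that] by (simp add: abs_mult) (metis abs_ge_zero order_trans that(1))
  have "(\<integral>q. indicator (cball 0 N) q * (G q - G (q + h))\<^sup>2 \<partial>lborel) = (\<integral>q. u q * G q - u q * G (q + h) \<partial>lborel)"
    by (intro Bochner_Integration.integral_cong) (auto simp: u_def power2_eq_square algebra_simps)
  also have "\<dots> = (\<integral>q. u q * G q \<partial>lborel) - (\<integral>q. u q * G (q + h) \<partial>lborel)"
    by (intro Bochner_Integration.integral_diff integrable_bounded_support(1)[of _ "\<kappa> * \<kappa>" 0 N] mulb ub Gb)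
      (auto simp: usupp)
  also have "(\<integral>q. u q * G (q + h) \<partial>lborel) = (\<integral>q. u (q - h) * G q \<partial>lborel)"
    using lborel_integral_translate[of "\<lambda>q. u (q - h) * G q" h] by simp
  also have "(\<integral>q. u q * G q \<partial>lborel) - (\<integral>q. u (q - h) * G q \<partial>lborel) = (\<integral>q. u q * G q - u (q - h) * G q \<partial>lborel)"
  proof (intro Bochner_Integration.integral_diff[symmetric])
    show "integrable lborel (\<lambda>q. u q * G q)"
      by (intro integrable_bounded_support(1)[of _ "\<kappa> * \<kappa>" 0 N] mulb ub Gb) (auto simp: usupp)
    show "integrable lborel (\<lambda>q. u (q - h) * G q)"
      by (intro integrable_bounded_support(1)[of _ "\<kappa> * \<kappa>" h N] mulb ub Gb)
        (auto simp: usupp dist_norm norm_minus_commute)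
  qed
  also have "\<dots> = (\<integral>q. (\<integral>x. w q * (b x * f q x) \<partial>lborel) \<partial>lborel)"
  proof (rule Bochner_Integration.integral_cong)
    fix q
    have "u q * G q - u (q - h) * G q = w q * G q" by (simp add: w_def left_diff_distrib)
    also have "\<dots> = (\<integral>x. w q * (b x * f q x) \<partial>lborel)" by (simp add: G_def)
    finally show "u q * G q - u (q - h) * G q = (\<integral>x. w q * (b x * f q x) \<partial>lborel)" .
  qed simp
  also have "\<dots> = (\<integral>x. (\<integral>q. w q * (b x * f q x) \<partial>lborel) \<partial>lborel)"
  proof (rule lborel_Fubini_bounded_support[of _ "2 * \<kappa> * 1" 0 "N + norm h" 0 "M + 1"])
    show "\<bar>w q * (b x * f q x)\<bar> \<le> 2 * \<kappa> * 1" for q x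
      by (intro mulb wb) (use b0 b1 f0 f1 in \<open>simp add: abs_mult mult_le_one\<close>)
  qed (simp_all add: wsupp bsupp del: mem_cball)
  also have "\<dots> = (\<integral>x. b x * (\<integral>q. w q * f q x \<partial>lborel) \<partial>lborel)"
    by (simp add: mult.left_commute)
  finally have start: "(\<integral>q. indicator (cball 0 N) q * (G q - G (q + h))\<^sup>2 \<partial>lborel) = (\<integral>x. b x * (\<integral>q. w q * f q x \<partial>lborel) \<partial>lborel)" .
  \<comment> \<open>Spacing \<open>n\<close> between the displacements makes
    \<open>\<bar>t i - t j\<bar> \<ge> n\<close> for \<open>i \<noteq> j\<close>, so that the shift
    \<open>h / (t i - t j)\<close> of the velocity has norm at most 1.\<close>
  define t where "t i = real i * real n" for i :: nat
  define A where "A x q = (\<Sum>i\<in>{1..n}. w (q - t i *\<^sub>R x)) / n" for x q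
  have A2: "\<bar>A x q\<bar> \<le> 2 * \<kappa>" for x q
  proof -
    have "\<bar>\<Sum>i\<in>{1..n}. w (q - t i *\<^sub>R x)\<bar> \<le> (\<Sum>i\<in>{1..n}. 2 * \<kappa>)"
      by (rule order_trans[OF sum_abs sum_mono]) (rule wb)
    then show ?thesis using n by (simp add: A_def divide_le_eq mult.commute)
  qed
  have shsupp: "w (q - t i *\<^sub>R x) = 0"
    if "norm x \<le> M" "i \<in> {1..n}" "q \<notin> cball 0 (N + norm h + real n * real n * M)" for i q x
  proof (rule wsupp)
    have "norm (t i *\<^sub>R x) \<le> real n * real n * M"
      using that(1,2) M0 by (auto simp: t_def intro!: mult_mono)
    then show "q - t i *\<^sub>R x \<notin> cball 0 (N + norm h)"
      using that(3) norm_triangle_ineq[of "q - t i *\<^sub>R x" "t i *\<^sub>R x"] by (simp)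
  qed
  have Am [measurable (raw)]: "(\<lambda>z. A (g z) (k z)) \<in> borel_measurable M'"
    if [measurable]: "g \<in> borel_measurable M'" "k \<in> borel_measurable M'" for g k and M' :: "'z measure"
    unfolding A_def by measurable
  have Asupp: "A x q = 0" if "norm x \<le> M" "q \<notin> cball 0 (N + norm h + real n * real n * M)" for q x
    unfolding A_def using shsupp[OF that(1) _ that(2)] by simp
  have inner: "(\<integral>q. w q * f q x \<partial>lborel) \<le> 2 * \<kappa> * e + \<eta> / 2 * B2 + (\<integral>q. (A x q)\<^sup>2 \<partial>lborel) / (2 * \<eta>)"
    if x: "norm x \<le> M" for x
  proof -
    let ?N2 = "N + norm h + real n * real n * M"
    have fb: "\<bar>f q y\<bar> \<le> 1" for q y using f0 f1 by simp
    have step: "(\<integral>q. w q * f q x \<partial>lborel) \<le> 2 * \<kappa> * e + (\<integral>q. w (q - t i *\<^sub>R x) * f q x \<partial>lborel)"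
      if i: "i \<in> {1..n}" for i
    proof -
      have i1: "integrable lborel (\<lambda>q. w q * f q x)"
        by (intro integrable_bounded_support(1)[of _ "2 * \<kappa> * 1" 0 "N + norm h"] mulb wb fb)
          (simp_all add: wsupp del: mem_cball)
      have i2: "integrable lborel (\<lambda>q. w q * f (q + t i *\<^sub>R x) x)"
        by (intro integrable_bounded_support(1)[of _ "2 * \<kappa> * 1" 0 "N + norm h"] mulb wb fb)
          (simp_all add: wsupp del: mem_cball)
      have i3: "integrable lborel (\<lambda>q. indicator (cball 0 (N + norm h)) q * \<bar>f q x - f (q + t i *\<^sub>R x) x\<bar>)"
      proof (intro integrable_bounded_support(1)[of _ "1 * 1" 0 "N + norm h"] mulb)
        show "\<bar>\<bar>f q x - f (q + t i *\<^sub>R x) x\<bar>\<bar> \<le> 1" for q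
          using f0[of q x] f1[of q x] f0[of "q + t i *\<^sub>R x" x] f1[of "q + t i *\<^sub>R x" x] by simp
      qed (auto simp: indicator_def)
      have "(\<integral>q. w q * f q x \<partial>lborel) - (\<integral>q. w q * f (q + t i *\<^sub>R x) x \<partial>lborel)
        = (\<integral>q. w q * f q x - w q * f (q + t i *\<^sub>R x) x \<partial>lborel)" using i1 i2 by simp
      also have "\<dots> \<le> (\<integral>q. 2 * \<kappa> * (indicator (cball 0 (N + norm h)) q * \<bar>f q x - f (q + t i *\<^sub>R x) x\<bar>) \<partial>lborel)"
      proof (intro integral_mono integrable_mult_right i3 Bochner_Integration.integrable_diff i1 i2)
        fix q
        have "w q * (f q x - f (q + t i *\<^sub>R x) x) \<le> 2 * \<kappa> * \<bar>f q x - f (q + t i *\<^sub>R x) x\<bar>"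
          using mulb[OF wb[of q], of "f q x - f (q + t i *\<^sub>R x) x" "\<bar>f q x - f (q + t i *\<^sub>R x) x\<bar>"] by simp
        then show "w q * f q x - w q * f (q + t i *\<^sub>R x) x
          \<le> 2 * \<kappa> * (indicator (cball 0 (N + norm h)) q * \<bar>f q x - f (q + t i *\<^sub>R x) x\<bar>)"
          using wsupp[of q] by (cases "q \<in> cball 0 (N + norm h)") (simp_all add: algebra_simps del: mem_cball)
      qed
      also have "\<dots> \<le> 2 * \<kappa> * e"
        using near[OF x i] kap by (simp add: t_def mult_left_mono)
      finally have "(\<integral>q. w q * f q x \<partial>lborel) \<le> 2 * \<kappa> * e + (\<integral>q. w q * f (q + t i *\<^sub>R x) x \<partial>lborel)" by simp
      also have "(\<integral>q. w q * f (q + t i *\<^sub>R x) x \<partial>lborel) = (\<integral>q. w (q - t i *\<^sub>R x) * f q x \<partial>lborel)"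
        using lborel_integral_translate[of "\<lambda>q. w (q - t i *\<^sub>R x) * f q x" "t i *\<^sub>R x"] by simp
      finally show ?thesis .
    qed
    have si: "integrable lborel (\<lambda>q. w (q - t i *\<^sub>R x) * f q x)" if "i \<in> {1..n}" for i
      by (intro integrable_bounded_support(1)[of _ "2 * \<kappa> * 1" 0 ?N2] mulb wb fb)
        (simp_all add: shsupp[OF x that] del: mem_cball)
    have "real n * (\<integral>q. w q * f q x \<partial>lborel) = (\<Sum>i\<in>{1..n}. (\<integral>q. w q * f q x \<partial>lborel))" by simp
    also have "\<dots> \<le> (\<Sum>i\<in>{1..n}. 2 * \<kappa> * e + (\<integral>q. w (q - t i *\<^sub>R x) * f q x \<partial>lborel))"
      by (intro sum_mono step)
    also have "\<dots> = real n * (2 * \<kappa> * e) + (\<Sum>i\<in>{1..n}. (\<integral>q. w (q - t i *\<^sub>R x) * f q x \<partial>lborel))"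
      by (simp add: sum.distrib)
    also have "(\<Sum>i\<in>{1..n}. (\<integral>q. w (q - t i *\<^sub>R x) * f q x \<partial>lborel)) = (\<integral>q. (\<Sum>i\<in>{1..n}. w (q - t i *\<^sub>R x) * f q x) \<partial>lborel)"
      by (intro Bochner_Integration.integral_sum[symmetric] si)
    also have "\<dots> = (\<integral>q. real n * (A x q * f q x) \<partial>lborel)"
      using n by (simp add: A_def sum_distrib_right)
    also have "\<dots> = real n * (\<integral>q. A x q * f q x \<partial>lborel)" by simp
    finally have "(\<integral>q. w q * f q x \<partial>lborel) \<le> 2 * \<kappa> * e + (\<integral>q. A x q * f q x \<partial>lborel)"
      using n by (simp flip: distrib_left)
    \<comment> \<open>Young's inequality with parameter \<open>\<eta>\<close> in place of
      Cauchy--Schwarz: the factor \<open>f\<close> is bounded by 1 and disappears, so only the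
      square of \<open>A\<close> has to be averaged over \<open>x\<close>.\<close>
    also have "(\<integral>q. A x q * f q x \<partial>lborel) \<le> (\<integral>q. \<eta> / 2 * indicator (cball 0 ?N2) q + (A x q)\<^sup>2 / (2 * \<eta>) \<partial>lborel)"
    proof (intro integral_mono Bochner_Integration.integrable_add integrable_mult_right integrable_indicator_cball)
      show "integrable lborel (\<lambda>q. A x q * f q x)"
        by (intro integrable_bounded_support(1)[of _ "2 * \<kappa> * 1" 0 ?N2] mulb A2 fb)
          (simp_all add: Asupp[OF x] del: mem_cball)
      have "integrable lborel (\<lambda>q. A x q * A x q)"
        by (intro integrable_bounded_support(1)[of _ "(2 * \<kappa>) * (2 * \<kappa>)" 0 ?N2] mulb A2)
          (simp_all add: Asupp[OF x] del: mem_cball)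
      then show "integrable lborel (\<lambda>q. (A x q)\<^sup>2 / (2 * \<eta>))" by (simp add: power2_eq_square)
      fix q
      show "A x q * f q x \<le> \<eta> / 2 * indicator (cball 0 ?N2) q + (A x q)\<^sup>2 / (2 * \<eta>)"
      proof (cases "q \<in> cball 0 ?N2")
        case True
        have "A x q * f q x \<le> \<bar>A x q\<bar>" using mulb[of "A x q" "\<bar>A x q\<bar>" "f q x" 1] fb[of q x] by simp
        also have "\<dots> \<le> \<eta> / 2 + (A x q)\<^sup>2 / (2 * \<eta>)"
        proof -
          have "0 \<le> (\<eta> - \<bar>A x q\<bar>)\<^sup>2" by simp
          then have "2 * \<eta> * \<bar>A x q\<bar> \<le> \<eta>\<^sup>2 + (A x q)\<^sup>2" by (simp add: power2_diff)
          then show ?thesis using eta by (simp add: field_simps power2_eq_square)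
        qed
        finally show ?thesis using True by simp
      next
        case False then show ?thesis using Asupp[OF x False] by simp
      qed
    qed
    also have "\<dots> = \<eta> / 2 * B2 + (\<integral>q. (A x q)\<^sup>2 \<partial>lborel) / (2 * \<eta>)"
    proof (subst Bochner_Integration.integral_add)
      have "integrable lborel (\<lambda>q. A x q * A x q)"
        by (intro integrable_bounded_support(1)[of _ "(2 * \<kappa>) * (2 * \<kappa>)" 0 ?N2] mulb A2)
          (simp_all add: Asupp[OF x] del: mem_cball)
      then show "integrable lborel (\<lambda>q. (A x q)\<^sup>2 / (2 * \<eta>))" by (simp add: power2_eq_square)
      show "integrable lborel (\<lambda>q. \<eta> / 2 * indicator (cball 0 ?N2) q)"
        by (intro integrable_mult_right integrable_indicator_cball)
    qed (simp add: B2_def)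
    finally show ?thesis by simp
  qed
  have integrand: "\<bar>b x * (\<integral>q. w q * f q x \<partial>lborel)\<bar> \<le> 1 * (2 * \<kappa> * 1 * B1)" for x
    unfolding B1_def
    by (intro mulb integrable_bounded_support(2) wb) (use b0 b1 f0 f1 wsupp in \<open>auto simp del: mem_cball\<close>)
  have Asq: "\<bar>\<integral>q. (A x q)\<^sup>2 \<partial>lborel\<bar> \<le> (2 * \<kappa>)\<^sup>2 * B2" if "norm x \<le> M" for x
    unfolding B2_def power2_eq_square
    by (intro mulb integrable_bounded_support(2) A2) (simp_all add: Asupp[OF that] del: mem_cball)
  have int1: "integrable lborel (\<lambda>x. b x * (\<integral>q. (A x q)\<^sup>2 \<partial>lborel))"
  proof (intro integrable_bounded_support(1)[of _ "1 * ((2 * \<kappa>)\<^sup>2 * B2)" 0 M])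
    show "\<bar>b x * (\<integral>q. (A x q)\<^sup>2 \<partial>lborel)\<bar> \<le> 1 * ((2 * \<kappa>)\<^sup>2 * B2)" for x
    proof (cases "norm x \<le> M")
      case True then show ?thesis using b0 b1 by (intro mulb Asq) auto
    next
      case False then show ?thesis using supp[of x] by (simp add: B2_def)
    qed
  qed (use supp in auto)
  have "(\<integral>x. b x * (\<integral>q. w q * f q x \<partial>lborel) \<partial>lborel)
    \<le> (\<integral>x. (2 * \<kappa> * e + \<eta> / 2 * B2) * b x + b x * (\<integral>q. (A x q)\<^sup>2 \<partial>lborel) / (2 * \<eta>) \<partial>lborel)"
  proof (intro integral_mono Bochner_Integration.integrable_add integrable_mult_right bint integrable_divide int1)
    show "integrable lborel (\<lambda>x. b x * (\<integral>q. w q * f q x \<partial>lborel))"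
      by (intro integrable_bounded_support(1)[of _ "1 * (2 * \<kappa> * 1 * B1)" 0 M] integrand) (use supp in auto)
    fix x
    show "b x * (\<integral>q. w q * f q x \<partial>lborel)
      \<le> (2 * \<kappa> * e + \<eta> / 2 * B2) * b x + b x * (\<integral>q. (A x q)\<^sup>2 \<partial>lborel) / (2 * \<eta>)"
    proof (cases "norm x \<le> M")
      case True
      show ?thesis using mult_left_mono[OF inner[OF True] b0[of x]] by (simp add: algebra_simps)
    next
      case False then show ?thesis using supp[of x] by simp
    qed
  qed
  also have "\<dots> = (2 * \<kappa> * e + \<eta> / 2 * B2) * (\<integral>x. b x \<partial>lborel)
      + (\<integral>x. b x * (\<integral>q. (A x q)\<^sup>2 \<partial>lborel) \<partial>lborel) / (2 * \<eta>)"
    by (subst Bochner_Integration.integral_add) (simp_all add: bint int1)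
  finally have main: "(\<integral>q. indicator (cball 0 N) q * (G q - G (q + h))\<^sup>2 \<partial>lborel)
    \<le> (2 * \<kappa> * e + \<eta> / 2 * B2) * (\<integral>x. b x \<partial>lborel)
      + (\<integral>x. b x * (\<integral>q. (A x q)\<^sup>2 \<partial>lborel) \<partial>lborel) / (2 * \<eta>)"
    unfolding start .
  have e0: "0 \<le> e"
    by (rule order_trans[OF _ near[of 0 1]]) (use M0 n in \<open>auto intro!: integral_nonneg\<close>)
  have K0: "0 \<le> K"
  proof -
    obtain i :: 'a where "i \<in> Basis" using nonempty_Basis by blast
    then have "\<bar>b i - b 0\<bar> \<le> K" using lip[of i 0] by simp
    then show ?thesis using abs_ge_zero[of "b i - b 0"] by linarith
  qed
  \<comment> \<open>The square of the average \<open>A\<close> expands into correlations of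
    translates of \<open>w\<close>, weighted by \<open>b\<close>. Integrating over \<open>x\<close>
    first, for fixed \<open>q\<close>, is what makes the off-diagonal ones small.\<close>
  define V where "V i j = (\<integral>x. b x * (\<integral>q. w (q - t i *\<^sub>R x) * w (q - t j *\<^sub>R x) \<partial>lborel) \<partial>lborel)" for i j
  have wwint: "integrable lborel (\<lambda>q. w (q - t i *\<^sub>R x) * w (q - t j *\<^sub>R x))" if "norm x \<le> M" "i \<in> {1..n}" for i j x
    by (intro integrable_bounded_support(1)[of _ "(2 * \<kappa>) * (2 * \<kappa>)" 0 "N + norm h + real n * real n * M"] mulb wb)
      (simp_all add: shsupp[OF that] del: mem_cball)
  have wwtr: "(\<integral>q. w (q - t i *\<^sub>R x) * w (q - t j *\<^sub>R x) \<partial>lborel) = (\<integral>q. w q * w (q + (t i - t j) *\<^sub>R x) \<partial>lborel)" for i j x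
    using lborel_integral_translate[of "\<lambda>q. w (q - t i *\<^sub>R x) * w (q - t j *\<^sub>R x)" "t i *\<^sub>R x"]
    by (simp add: algebra_simps)
  have wwb: "\<bar>\<integral>q. w q * w (q + s *\<^sub>R x) \<partial>lborel\<bar> \<le> 2 * \<kappa> * (2 * \<kappa>) * B1" for s x
    unfolding B1_def by (intro integrable_bounded_support(2) mulb wb) (simp_all add: wsupp del: mem_cball)
  have Vint: "integrable lborel (\<lambda>x. b x * (\<integral>q. w (q - t i *\<^sub>R x) * w (q - t j *\<^sub>R x) \<partial>lborel))" for i j
  proof (intro integrable_bounded_support(1)[of _ "1 * (2 * \<kappa> * (2 * \<kappa>) * B1)" 0 M] mulb)
    show "\<bar>\<integral>q. w (q - t i *\<^sub>R x) * w (q - t j *\<^sub>R x) \<partial>lborel\<bar> \<le> 2 * \<kappa> * (2 * \<kappa>) * B1" for x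
      unfolding wwtr by (rule wwb)
  qed (use b0 b1 supp in auto)
  have Veq: "V i j = (\<integral>q. w q * (\<integral>x. b x * w (q + (t i - t j) *\<^sub>R x) \<partial>lborel) \<partial>lborel)" for i j
  proof -
    have "V i j = (\<integral>x. (\<integral>q. b x * (w q * w (q + (t i - t j) *\<^sub>R x)) \<partial>lborel) \<partial>lborel)"
      by (simp add: V_def wwtr)
    also have "\<dots> = (\<integral>q. (\<integral>x. b x * (w q * w (q + (t i - t j) *\<^sub>R x)) \<partial>lborel) \<partial>lborel)"
    proof (rule lborel_Fubini_bounded_support[of _ "1 * (2 * \<kappa> * (2 * \<kappa>))" 0 "M + 1" 0 "N + norm h"])
      show "\<bar>b x * (w q * w (q + (t i - t j) *\<^sub>R x))\<bar> \<le> 1 * (2 * \<kappa> * (2 * \<kappa>))" for x q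
        by (intro mulb wb) (use b0 b1 in auto)
    qed (simp_all add: wsupp bsupp del: mem_cball)
    also have "\<dots> = (\<integral>q. w q * (\<integral>x. b x * w (q + (t i - t j) *\<^sub>R x) \<partial>lborel) \<partial>lborel)"
    proof (rule Bochner_Integration.integral_cong)
      fix q
      have "(\<integral>x. b x * (w q * w (q + (t i - t j) *\<^sub>R x)) \<partial>lborel) = (\<integral>x. w q * (b x * w (q + (t i - t j) *\<^sub>R x)) \<partial>lborel)"
        by (rule Bochner_Integration.integral_cong) simp_all
      then show "(\<integral>x. b x * (w q * w (q + (t i - t j) *\<^sub>R x)) \<partial>lborel) = w q * (\<integral>x. b x * w (q + (t i - t j) *\<^sub>R x) \<partial>lborel)"
        by simp
    qed simp
    finally show ?thesis .
  qed
  have Vbound: "V i j \<le> 2 * \<kappa> * c * B1" if c: "\<And>q. \<bar>\<integral>x. b x * w (q + (t i - t j) *\<^sub>R x) \<partial>lborel\<bar> \<le> c" for i j c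
    unfolding Veq B1_def
    by (rule order_trans[OF abs_ge_self], intro integrable_bounded_support(2) mulb wb c) (simp_all add: wsupp del: mem_cball)
  have diag: "V i j \<le> 2 * \<kappa> * (1 * (2 * \<kappa>) * \<kappa>) * B1" for i j
  proof (rule Vbound)
    show "\<bar>\<integral>x. b x * w (q + (t i - t j) *\<^sub>R x) \<partial>lborel\<bar> \<le> 1 * (2 * \<kappa>) * \<kappa>" for q
      unfolding \<kappa>_def[of] by (fold \<kappa>_def, subst (2) \<kappa>_def, intro integrable_bounded_support(2) mulb wb) (use b0 b1 bsupp in auto)
  qed
  have off: "V i j \<le> 2 * \<kappa> * (\<kappa> * (K * (norm h / n) * \<kappa>)) * B1" if ij: "i \<noteq> j" for i j
  proof (rule Vbound)
    fix q
    define s where "s = t i - t j"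
    have "\<bar>real i - real j\<bar> \<ge> 1" using ij by linarith
    then have s: "real n \<le> \<bar>s\<bar>"
      by (simp add: s_def t_def flip: left_diff_distrib) (simp add: abs_mult mult_le_cancel_right1)
    then have s0: "s \<noteq> 0" using n by auto
    \<comment> \<open>Moving \<open>x\<close> by \<open>a\<close> moves \<open>q + s x\<close> by
      \<open>h\<close>. The two halves of \<open>w\<close> thus become the same function of
      \<open>x\<close>, weighted by \<open>b x\<close> and by \<open>b (x + a)\<close>.\<close>
    define a where "a = (1 / s) *\<^sub>R h"
    have sa: "s *\<^sub>R a = h" using s0 by (simp add: a_def)
    have na: "norm a \<le> norm h / n"
    proof -
      have "norm h / \<bar>s\<bar> \<le> norm h / real n" using s n by (intro divide_left_mono) auto
      then show ?thesis by (simp add: a_def)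
    qed
    also have "\<dots> \<le> 1" using h n by (simp add: divide_le_eq)
    finally have na1: "norm a \<le> 1" .
    have i1: "integrable lborel (\<lambda>x. b x * u (q + s *\<^sub>R x))"
      by (intro integrable_bounded_support(1)[of _ "1 * \<kappa>" 0 "M + 1"] mulb ub) (use b0 b1 bsupp in auto)
    have i2: "integrable lborel (\<lambda>x. b x * u (q - h + s *\<^sub>R x))"
      by (intro integrable_bounded_support(1)[of _ "1 * \<kappa>" 0 "M + 1"] mulb ub) (use b0 b1 bsupp in auto)
    have bs: "b (x + a) = 0" if "x \<notin> cball (- a) (M + 1)" for x
      using that bsupp[of "x + a"] by (simp add: dist_norm norm_minus_commute add.commute)
    have i3: "integrable lborel (\<lambda>x. b (x + a) * u (q + s *\<^sub>R x))"
      by (intro integrable_bounded_support(1)[of _ "1 * \<kappa>" "- a" "M + 1"] mulb ub) (use b0 b1 bs in auto)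
    have "(\<integral>x. b x * w (q + s *\<^sub>R x) \<partial>lborel) = (\<integral>x. b x * u (q + s *\<^sub>R x) - b x * u (q - h + s *\<^sub>R x) \<partial>lborel)"
      by (simp add: w_def algebra_simps)
    also have "\<dots> = (\<integral>x. b x * u (q + s *\<^sub>R x) \<partial>lborel) - (\<integral>x. b x * u (q - h + s *\<^sub>R x) \<partial>lborel)"
      using i1 i2 by simp
    also have "(\<integral>x. b x * u (q - h + s *\<^sub>R x) \<partial>lborel) = (\<integral>x. b (x + a) * u (q + s *\<^sub>R x) \<partial>lborel)"
      using lborel_integral_translate[of "\<lambda>x. b x * u (q - h + s *\<^sub>R x)" a] by (simp add: scaleR_add_right sa)
    also have "(\<integral>x. b x * u (q + s *\<^sub>R x) \<partial>lborel) - \<dots> = (\<integral>x. (b x - b (x + a)) * u (q + s *\<^sub>R x) \<partial>lborel)"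
      using i1 i3 by (simp add: left_diff_distrib)
    also have "\<bar>\<dots>\<bar> \<le> (\<integral>x. \<bar>(b x - b (x + a)) * u (q + s *\<^sub>R x)\<bar> \<partial>lborel)" by (rule integral_abs_bound)
    also have "\<dots> \<le> (\<integral>x. \<kappa> * \<bar>b x - b (x + a)\<bar> \<partial>lborel)"
    proof (rule integral_mono)
      show "integrable lborel (\<lambda>x. \<bar>(b x - b (x + a)) * u (q + s *\<^sub>R x)\<bar>)"
        using i1 i3 by (simp add: left_diff_distrib)
      show "integrable lborel (\<lambda>x. \<kappa> * \<bar>b x - b (x + a)\<bar>)"
        by (intro integrable_mult_right Lipschitz_translate_L1(1)[OF lip supp bm na1])
      show "\<bar>(b x - b (x + a)) * u (q + s *\<^sub>R x)\<bar> \<le> \<kappa> * \<bar>b x - b (x + a)\<bar>" for x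
        using mult_left_mono[OF ub[of "q + s *\<^sub>R x"], of "\<bar>b x - b (x + a)\<bar>"] by (simp add: abs_mult mult.commute)
    qed
    also have "\<dots> \<le> \<kappa> * (K * norm a * \<kappa>)"
      using Lipschitz_translate_L1(2)[OF lip supp bm na1] kap by (simp add: \<kappa>_def mult_left_mono)
    also have "\<dots> \<le> \<kappa> * (K * (norm h / n) * \<kappa>)" using na K0 kap by (intro mult_left_mono mult_right_mono) auto
    finally show "\<bar>\<integral>x. b x * w (q + (t i - t j) *\<^sub>R x) \<partial>lborel\<bar> \<le> \<kappa> * (K * (norm h / n) * \<kappa>)" by (simp add: s_def)
  qed
  have "(\<integral>x. b x * (\<integral>q. (A x q)\<^sup>2 \<partial>lborel) \<partial>lborel) = (\<Sum>i\<in>{1..n}. \<Sum>j\<in>{1..n}. V i j) / (real n)\<^sup>2"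
  proof -
    have "b x * (\<integral>q. (A x q)\<^sup>2 \<partial>lborel) = (\<Sum>i\<in>{1..n}. \<Sum>j\<in>{1..n}.
        b x * (\<integral>q. w (q - t i *\<^sub>R x) * w (q - t j *\<^sub>R x) \<partial>lborel)) / (real n)\<^sup>2" for x
    proof (cases "norm x \<le> M")
      case True
      have "(\<integral>q. (A x q)\<^sup>2 \<partial>lborel) = (\<integral>q. (\<Sum>i\<in>{1..n}. \<Sum>j\<in>{1..n}. w (q - t i *\<^sub>R x) * w (q - t j *\<^sub>R x)) / (real n)\<^sup>2 \<partial>lborel)"
        by (simp add: A_def power_divide power2_eq_square sum_product)
      also have "\<dots> = (\<Sum>i\<in>{1..n}. \<Sum>j\<in>{1..n}. (\<integral>q. w (q - t i *\<^sub>R x) * w (q - t j *\<^sub>R x) \<partial>lborel)) / (real n)\<^sup>2"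
        using wwint[OF True] by (simp add: Bochner_Integration.integral_sum Bochner_Integration.integrable_sum)
      finally show ?thesis by (simp add: sum_distrib_left)
    next
      case False then show ?thesis using supp[of x] by simp
    qed
    then show ?thesis unfolding V_def
      using Vint by (simp add: Bochner_Integration.integral_sum Bochner_Integration.integrable_sum)
  qed
  also have "\<dots> \<le> (4 * \<kappa> + 2 * \<kappa> * K * norm h) * \<kappa>\<^sup>2 * B1 / n"
  proof -
    \<comment> \<open>Among the \<open>n * n\<close> terms the \<open>n\<close> diagonal ones cost
      \<open>?c\<close> each and the others \<open>?o\<close>, which carries a factor
      \<open>1 / n\<close>; divided by \<open>n * n\<close>, both groups are of order
      \<open>1 / n\<close>.\<close>
    let ?c = "2 * \<kappa> * (1 * (2 * \<kappa>) * \<kappa>) * B1" and ?o = "2 * \<kappa> * (\<kappa> * (K * (norm h / n) * \<kappa>)) * B1"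
    have o0: "0 \<le> ?o" using kap K0 B10 by simp
    have row: "(\<Sum>j\<in>{1..n}. V i j) \<le> ?c + real n * ?o" if "i \<in> {1..n}" for i
    proof -
      have "(\<Sum>j\<in>{1..n}. V i j) = V i i + (\<Sum>j\<in>{1..n} - {i}. V i j)" using that by (simp add: sum.remove)
      also have "\<dots> \<le> ?c + (\<Sum>j\<in>{1..n} - {i}. ?o)" by (intro add_mono diag sum_mono off) auto
      also have "\<dots> \<le> ?c + (\<Sum>j\<in>{1..n}. ?o)" using o0 by (intro add_left_mono sum_mono2) auto
      finally show ?thesis by simp
    qed
    have "(\<Sum>i\<in>{1..n}. \<Sum>j\<in>{1..n}. V i j) \<le> (\<Sum>i\<in>{1..n}. ?c + real n * ?o)" by (intro sum_mono row)
    also have "\<dots> = real n * (?c + real n * ?o)" by (simp only: sum_constant) simp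
    finally have "(\<Sum>i\<in>{1..n}. \<Sum>j\<in>{1..n}. V i j) / (real n)\<^sup>2 \<le> (real n * (?c + real n * ?o)) / (real n)\<^sup>2"
      by (rule divide_right_mono) (rule zero_le_power2)
    also have "\<dots> = (4 * \<kappa> + 2 * \<kappa> * K * norm h) * \<kappa>\<^sup>2 * B1 / n"
      using n by (simp add: field_simps power2_eq_square)
    finally show ?thesis .
  qed
  finally have "(\<integral>x. b x * (\<integral>q. (A x q)\<^sup>2 \<partial>lborel) \<partial>lborel) / (2 * \<eta>)
    \<le> (4 * \<kappa> + 2 * \<kappa> * K * norm h) * \<kappa>\<^sup>2 * B1 / n / (2 * \<eta>)"
    using eta by (intro divide_right_mono) auto
  moreover have "(2 * \<kappa> * e + \<eta> / 2 * B2) * (\<integral>x. b x \<partial>lborel) \<le> \<kappa> * (2 * \<kappa> * e + \<eta> / 2 * B2)"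
    using mult_left_mono[OF bI, of "2 * \<kappa> * e + \<eta> / 2 * B2"] kap e0 eta by (simp add: mult.commute B2_def)
  ultimately show ?thesis using main eta n unfolding B1_def B2_def by (simp add: mult.commute mult.left_commute)
qed

section \<open>Tubes and cones\<close>

text \<open>Both ends of the parameter interval are left out, and a hit means distance strictly
  below \<open>\<rho>\<close>. This makes the condition equivalent to a free path of length at least
  \<open>l\<close>, and closed in \<open>(q, v)\<close>, hence measurable.\<close>

definition tube_free :: "'a::euclidean_space set \<Rightarrow> real \<Rightarrow> real \<Rightarrow> 'a \<Rightarrow> 'a \<Rightarrow> bool" where
  "tube_free P \<rho> l q v \<longleftrightarrow> (\<forall>t p. 0 < t \<longrightarrow> t < l \<longrightarrow> p \<in> P \<longrightarrow> \<rho> \<le> dist (q + t *\<^sub>R v) p)"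

text \<open>The direction is extended to all vectors as a function homogeneous of degree 0, so that
  a weight on velocities can be translated in every direction. At \<open>x = 0\<close>, where
  \<open>sgn x = 0\<close>, the value concerns only a null set.\<close>

definition free_ind :: "'a::euclidean_space set \<Rightarrow> real \<Rightarrow> real \<Rightarrow> 'a \<Rightarrow> 'a \<Rightarrow> real" where
  "free_ind P \<rho> l q x = of_bool (tube_free P \<rho> l q (sgn x))"

text \<open>The symmetric difference of \<open>P\<close> and \<open>P - y\<close>.\<close>

definition shift_diff :: "'a::euclidean_space set \<Rightarrow> 'a \<Rightarrow> 'a set" where
  "shift_diff P y = {p. (p \<in> P) \<noteq> (p + y \<in> P)}"

lemma free_ind_bounds: "0 \<le> free_ind P \<rho> l q x" "free_ind P \<rho> l q x \<le> 1"
  by (auto simp: free_ind_def)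

lemma closed_tube_free: "closed {z. tube_free P \<rho> l (fst z) (snd z)}"
proof -
  have "- {z. tube_free P \<rho> l (fst z) (snd z)} = (\<Union>p\<in>P. \<Union>t\<in>{0<..<l}. {z. dist (fst z + t *\<^sub>R snd z) p < \<rho>})"
    by (force simp: tube_free_def not_le)
  moreover have "open \<dots>"
    by (intro open_UN ballI open_Collect_less continuous_intros)
  ultimately show ?thesis by (simp add: closed_def)
qed

lemma free_ind_measurable:
  "(\<lambda>(q, x). free_ind P \<rho> l q x) \<in> borel_measurable (borel \<Otimes>\<^sub>M (borel :: 'a::euclidean_space measure))"
proof -
  have 1: "Measurable.pred (borel \<Otimes>\<^sub>M borel) (\<lambda>z. tube_free P \<rho> l (fst z) (snd z :: 'a))"
    using borel_closed[OF closed_tube_free[of P \<rho> l]] by (simp add: borel_prod pred_def)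
  have sg: "(sgn :: 'a \<Rightarrow> 'a) \<in> borel_measurable borel"
    unfolding sgn_div_norm[abs_def] by measurable
  have 2: "(\<lambda>z. (fst z, sgn (snd z))) \<in> borel \<Otimes>\<^sub>M (borel :: 'a measure) \<rightarrow>\<^sub>M borel \<Otimes>\<^sub>M borel"
    using measurable_compose[OF measurable_snd sg, of borel] by measurable
  have 3: "Measurable.pred (borel \<Otimes>\<^sub>M borel) (\<lambda>z. tube_free P \<rho> l (fst z) (sgn (snd z :: 'a)))"
    using measurable_compose[OF 2 1] by simp
  show ?thesis unfolding free_ind_def case_prod_beta using 3 by measurable
qed

lemma free_ind_measurable' [measurable (raw)]:
  assumes "g \<in> borel_measurable N" "k \<in> borel_measurable N"
  shows "(\<lambda>z. free_ind P \<rho> l (g z) (k z)) \<in> borel_measurable N"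
  using measurable_compose[OF measurable_Pair[OF assms] free_ind_measurable] by simp

lemma measure_le_cover_balls:
  fixes S :: "'a::euclidean_space set"
  assumes "finite I" "S \<subseteq> (\<Union>i\<in>I. ball (c i) r)" "0 \<le> r"
  shows "measure lborel S \<le> real (card I) * (unit_ball_vol (real DIM('a)) * r ^ DIM('a))"
proof (cases "S \<in> sets lborel")
  case True
  have fm: "ball x r \<in> fmeasurable lborel" for x :: 'a by (simp add: fmeasurable_def emeasure_lborel_ball_finite[simplified])
  have "measure lborel S \<le> measure lborel (\<Union>i\<in>I. ball (c i) r)"
    using assms True fm by (intro measure_mono_fmeasurable fmeasurable.finite_UN) auto
  also have "\<dots> \<le> (\<Sum>i\<in>I. measure lborel (ball (c i) r))" using assms(1) fm by (intro measure_UNION_le) auto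
  also have "\<dots> = real (card I) * (unit_ball_vol (real DIM('a)) * r ^ DIM('a))" using assms(3) by (simp add: content_ball)
  finally show ?thesis .
next
  \<comment> \<open>\<open>measure\<close> is 0 outside the sigma-algebra, so \<open>S\<close> may
    be arbitrary.\<close>
  case False then show ?thesis using assms(3) by (simp add: measure_notin_sets)
qed

text \<open>For one \<open>p\<close> the starting points lie in the
  \<open>\<rho>\<close>-neighbourhood of the segment from \<open>p - a v\<close> to
  \<open>p - (a + s) v\<close>, which balls of radius \<open>2 * \<rho>\<close> at parameter steps
  \<open>\<rho>\<close> cover. A norm of at most 1 admits \<open>v = sgn 0 = 0\<close>.\<close>

lemma measure_tube_le:
  fixes Z :: "'a::euclidean_space set"
  assumes fin: "finite (Z \<inter> ball (c + a *\<^sub>R v) (R + s + \<rho>))" and v: "norm v \<le> 1" and rho: "0 < \<rho>" and s: "0 \<le> s"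
  shows "measure lborel {q \<in> ball c R. \<exists>p\<in>Z. \<exists>t\<in>{a..a + s}. dist (q + t *\<^sub>R v) p < \<rho>}
    \<le> real (card (Z \<inter> ball (c + a *\<^sub>R v) (R + s + \<rho>))) * (s / \<rho> + 1) * (unit_ball_vol (real DIM('a)) * (2 * \<rho>) ^ DIM('a))"
proof -
  let ?Z = "Z \<inter> ball (c + a *\<^sub>R v) (R + s + \<rho>)" and ?n = "nat \<lfloor>s / \<rho>\<rfloor>"
  have "measure lborel {q \<in> ball c R. \<exists>p\<in>Z. \<exists>t\<in>{a..a + s}. dist (q + t *\<^sub>R v) p < \<rho>}
    \<le> real (card (?Z \<times> {..?n})) * (unit_ball_vol (real DIM('a)) * (2 * \<rho>) ^ DIM('a))"
  proof (rule measure_le_cover_balls)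
    show "{q \<in> ball c R. \<exists>p\<in>Z. \<exists>t\<in>{a..a + s}. dist (q + t *\<^sub>R v) p < \<rho>}
      \<subseteq> (\<Union>i\<in>?Z \<times> {..?n}. ball (fst i - (a + real (snd i) * \<rho>) *\<^sub>R v) (2 * \<rho>))"
    proof
      fix q assume "q \<in> {q \<in> ball c R. \<exists>p\<in>Z. \<exists>t\<in>{a..a + s}. dist (q + t *\<^sub>R v) p < \<rho>}"
      then obtain p t where q: "dist c q < R" "p \<in> Z" "a \<le> t" "t \<le> a + s" and d: "norm (q + t *\<^sub>R v - p) < \<rho>"
        by (auto simp: dist_norm)
      define i where "i = nat \<lfloor>(t - a) / \<rho>\<rfloor>"
      have i1: "real i \<le> (t - a) / \<rho>" "(t - a) / \<rho> < real i + 1"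
        using q(3) rho by (simp_all add: i_def of_nat_nat)
      have "i \<le> ?n" unfolding i_def using q(4) rho by (intro nat_mono floor_mono divide_right_mono) auto
      have "\<bar>t - (a + real i * \<rho>)\<bar> < \<rho>" using i1 rho by (simp add: field_simps abs_less_iff)
      then have b1: "norm ((t - (a + real i * \<rho>)) *\<^sub>R v) < \<rho>"
        using v mult_left_le[of "norm v" "\<bar>t - (a + real i * \<rho>)\<bar>"] by simp
      have "norm (q - (p - (a + real i * \<rho>) *\<^sub>R v)) = norm ((q + t *\<^sub>R v - p) - (t - (a + real i * \<rho>)) *\<^sub>R v)"
        by (simp add: algebra_simps)
      also have "\<dots> < 2 * \<rho>" using norm_triangle_ineq4[of "q + t *\<^sub>R v - p" "(t - (a + real i * \<rho>)) *\<^sub>R v"] b1 d by linarith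
      finally have "q \<in> ball (p - (a + real i * \<rho>) *\<^sub>R v) (2 * \<rho>)" by (simp add: dist_norm norm_minus_commute)
      moreover have "p \<in> ?Z"
      proof -
        have n1: "norm ((t - a) *\<^sub>R v) \<le> s" using q v mult_left_le[of "norm v" "t - a"] by simp
        have "norm (c + a *\<^sub>R v - p) = norm ((q + t *\<^sub>R v - p) + (c - q) - (t - a) *\<^sub>R v)" by (simp add: algebra_simps)
        also have "\<dots> \<le> norm (q + t *\<^sub>R v - p) + norm (c - q) + norm ((t - a) *\<^sub>R v)"
          by (rule order_trans[OF norm_triangle_ineq4 add_right_mono[OF norm_triangle_ineq]])
        also have "\<dots> < R + s + \<rho>" using n1 d q(1) by (simp add: dist_norm)
        finally show ?thesis using q(2) by (simp add: dist_norm)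
      qed
      ultimately show "q \<in> (\<Union>i\<in>?Z \<times> {..?n}. ball (fst i - (a + real (snd i) * \<rho>) *\<^sub>R v) (2 * \<rho>))"
        using \<open>i \<le> ?n\<close> by (intro UN_I[of "(p, i)"]) auto
    qed
  qed (use fin rho in auto)
  also have "\<dots> \<le> real (card ?Z) * (s / \<rho> + 1) * (unit_ball_vol (real DIM('a)) * (2 * \<rho>) ^ DIM('a))"
  proof (rule mult_right_mono)
    have "real (?n + 1) \<le> s / \<rho> + 1" using s rho by simp
    then show "real (card (?Z \<times> {..?n})) \<le> real (card ?Z) * (s / \<rho> + 1)"
      using mult_left_mono[of "real (?n + 1)" "s / \<rho> + 1" "real (card ?Z)"] by (simp add: card_cartesian_product distrib_left)
  qed (use rho in auto)
  finally show ?thesis .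
qed

text \<open>The angular size of a scatterer. With \<open>s = dist p q\<close>, the velocities
  hitting it lie in a cone of opening of order \<open>\<rho> / s\<close> about the direction of
  \<open>p\<close>. Inside the ball of radius \<open>M\<close> a chain of at most
  \<open>s / \<rho>\<close> balls along the axis covers this cone, each of volume of order
  \<open>(\<rho> / s) ^ d\<close>, which leaves the power \<open>d - 1\<close>.\<close>

lemma measure_cone_le:
  fixes p q :: "'a::euclidean_space"
  assumes rho: "0 < \<rho>" and s: "2 * \<rho> \<le> dist p q" and M: "0 < M" and d: "1 \<le> DIM('a)"
  shows "measure lborel {x \<in> cball 0 M. \<exists>t>0. dist (q + t *\<^sub>R sgn x) p < \<rho>}
    \<le> unit_ball_vol (real DIM('a)) * (4 * M) ^ DIM('a) * (\<rho> / dist p q) ^ (DIM('a) - 1)"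
proof -
  define s where "s = dist p q"
  define u where "u = (1 / s) *\<^sub>R (p - q)"
  \<comment> \<open>An error \<open>2 * \<rho> / s\<close> in the unit direction becomes at most
    \<open>k\<close> at distance \<open>M\<close>.\<close>
  define k where "k = 2 * M * \<rho> / s"
  have s0: "0 < s" "2 * \<rho> \<le> s" using s rho by (auto simp: s_def)
  have k0: "0 < k" using s0 rho M by (simp add: k_def)
  have su: "s *\<^sub>R u = p - q" using s0 by (simp add: u_def)
  have nu: "norm u = 1" using s0 by (simp add: u_def s_def dist_norm)
  let ?n = "nat \<lfloor>M / k\<rfloor>"
  have "measure lborel {x \<in> cball 0 M. \<exists>t>0. dist (q + t *\<^sub>R sgn x) p < \<rho>}
    \<le> real (card {..?n}) * (unit_ball_vol (real DIM('a)) * (2 * k) ^ DIM('a))"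
  proof (rule measure_le_cover_balls)
    show "{x \<in> cball 0 M. \<exists>t>0. dist (q + t *\<^sub>R sgn x) p < \<rho>} \<subseteq> (\<Union>i\<in>{..?n}. ball ((real i * k) *\<^sub>R u) (2 * k))"
    proof
      fix x assume "x \<in> {x \<in> cball 0 M. \<exists>t>0. dist (q + t *\<^sub>R sgn x) p < \<rho>}"
      then obtain t where x: "norm x \<le> M" and t: "0 < t" and dt: "norm (t *\<^sub>R sgn x - s *\<^sub>R u) < \<rho>"
        by (auto simp: dist_norm su algebra_simps)
      have x0: "x \<noteq> 0" using dt s0 nu rho by auto
      then have ns: "norm (sgn x) = 1" by (simp add: norm_sgn)
      have "\<bar>t - s\<bar> < \<rho>"
        using norm_triangle_ineq3[of "t *\<^sub>R sgn x" "s *\<^sub>R u"] dt ns nu t s0 by simp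
      moreover have "norm (s *\<^sub>R sgn x - s *\<^sub>R u) \<le> norm (t *\<^sub>R sgn x - s *\<^sub>R u) + norm ((s - t) *\<^sub>R sgn x)"
        by (rule order_trans[OF _ norm_triangle_ineq]) (simp add: algebra_simps)
      ultimately have "s * norm (sgn x - u) < 2 * \<rho>"
        using dt ns s0 by (simp flip: scaleR_diff_right)
      then have su2: "norm (sgn x - u) < 2 * \<rho> / s" using s0 by (simp add: field_simps)
      have "norm (x - norm x *\<^sub>R u) = norm (norm x *\<^sub>R (sgn x - u))"
        using x0 by (simp add: sgn_div_norm algebra_simps)
      also have "\<dots> = norm x * norm (sgn x - u)" by simp
      also have "\<dots> \<le> M * norm (sgn x - u)" using x by (simp add: mult_right_mono)
      also have "\<dots> < M * (2 * \<rho> / s)" using M su2 by (rule mult_strict_left_mono[rotated])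
      finally have b1: "norm (x - norm x *\<^sub>R u) < k" by (simp add: k_def mult.assoc mult.left_commute)
      define i where "i = nat \<lfloor>norm x / k\<rfloor>"
      have i1: "real i \<le> norm x / k" "norm x / k < real i + 1"
        using k0 by (simp_all add: i_def of_nat_nat)
      have "i \<le> ?n" unfolding i_def using x k0 by (intro nat_mono floor_mono divide_right_mono) auto
      have "\<bar>norm x - real i * k\<bar> < k" using i1 k0 by (simp add: field_simps abs_less_iff)
      then have b2: "norm ((norm x - real i * k) *\<^sub>R u) < k" using nu by simp
      have "norm (x - (real i * k) *\<^sub>R u) \<le> norm (x - norm x *\<^sub>R u) + norm ((norm x - real i * k) *\<^sub>R u)"
        by (rule order_trans[OF _ norm_triangle_ineq]) (simp add: algebra_simps)
      then have "x \<in> ball ((real i * k) *\<^sub>R u) (2 * k)" using b1 b2 by (simp add: dist_norm norm_minus_commute)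
      then show "x \<in> (\<Union>i\<in>{..?n}. ball ((real i * k) *\<^sub>R u) (2 * k))" using \<open>i \<le> ?n\<close> by auto
    qed
  qed (use k0 in auto)
  also have "\<dots> \<le> (s / \<rho>) * (unit_ball_vol (real DIM('a)) * (2 * k) ^ DIM('a))"
  proof (rule mult_right_mono)
    have "real (?n + 1) \<le> M / k + 1" using k0 M by simp
    also have "M / k + 1 = s / (2 * \<rho>) + 1" using M rho s0 by (simp add: k_def)
    also have "\<dots> \<le> s / \<rho>" using s0 rho by (simp add: field_simps)
    finally show "real (card {..?n}) \<le> s / \<rho>" by simp
  qed (use k0 in auto)
  also have "\<dots> = unit_ball_vol (real DIM('a)) * (4 * M) ^ DIM('a) * (\<rho> / s) ^ (DIM('a) - 1)"
  proof -
    obtain m where m: "DIM('a) = Suc m" using d by (metis DIM_positive gr0_conv_Suc)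
    have "2 * k = 4 * M * (\<rho> / s)" by (simp add: k_def)
    then have "(2 * k) ^ Suc m = (4 * M) ^ Suc m * ((\<rho> / s) ^ m * (\<rho> / s))"
      by (simp only: power_mult_distrib power_Suc mult_ac)
    then have "(s / \<rho>) * (unit_ball_vol (real (Suc m)) * (2 * k) ^ Suc m)
      = unit_ball_vol (real (Suc m)) * (4 * M) ^ Suc m * (\<rho> / s) ^ m * ((s / \<rho>) * (\<rho> / s))"
      by (simp only: mult_ac)
    also have "(s / \<rho>) * (\<rho> / s) = 1" using s0 rho by simp
    finally show ?thesis unfolding m by simp
  qed
  finally show ?thesis by (simp add: s_def)
qed

text \<open>The shell from \<open>2 ^ J * R0\<close> to twice that radius holds at most
  \<open>\<epsilon> * (2 ^ (J + 1) * R0) ^ d\<close> points, of weight at most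
  \<open>(2 ^ J * R0) ^ (1 - d)\<close> each, and so contributes at most
  \<open>\<epsilon> * 2 ^ d * (2 ^ J * R0)\<close>. These bounds form a geometric series: the total
  is linear in the outer radius and keeps the small factor \<open>\<epsilon>\<close>.\<close>

lemma dyadic_shell_sum:
  fixes q :: "'a::euclidean_space"
  assumes "finite Z" and d: "1 \<le> DIM('a)" and R0: "0 < R0" and eps: "0 \<le> \<epsilon>"
    and count: "\<And>R. R0 \<le> R \<Longrightarrow> real (card {p \<in> Z. dist p q < R}) \<le> \<epsilon> * R ^ DIM('a)"
    and "\<And>p. p \<in> Z \<Longrightarrow> R0 \<le> dist p q" "\<And>p. p \<in> Z \<Longrightarrow> dist p q < 2 ^ J * R0"
  shows "(\<Sum>p\<in>Z. (1 / dist p q) ^ (DIM('a) - 1)) \<le> \<epsilon> * 2 ^ DIM('a) * (2 ^ J * R0)"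
  using assms(1,6,7) count
proof (induction J arbitrary: Z)
  case 0
  then have "Z = {}" by force
  then show ?case using R0 eps by simp
next
  case (Suc J)
  let ?A = "{p \<in> Z. dist p q < 2 ^ J * R0}" and ?B = "{p \<in> Z. 2 ^ J * R0 \<le> dist p q}"
  let ?f = "\<lambda>p. (1 / dist p q) ^ (DIM('a) - 1)"
  have "(\<Sum>p\<in>Z. ?f p) = sum ?f ?A + sum ?f ?B"
    using Suc.prems(1) by (subst sum.union_disjoint[symmetric]) (auto intro!: sum.cong)
  also have "sum ?f ?A \<le> \<epsilon> * 2 ^ DIM('a) * (2 ^ J * R0)"
  proof (rule Suc.IH)
    fix R assume R: "R0 \<le> R"
    have "card {p \<in> ?A. dist p q < R} \<le> card {p \<in> Z. dist p q < R}" using Suc.prems(1) by (intro card_mono) auto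
    then show "real (card {p \<in> ?A. dist p q < R}) \<le> \<epsilon> * R ^ DIM('a)" using Suc.prems(4)[OF R] by linarith
  qed (use Suc.prems in auto)
  also have "sum ?f ?B \<le> \<epsilon> * 2 ^ DIM('a) * (2 ^ J * R0)"
  proof -
    have pos: "0 < 2 ^ J * R0" using R0 by simp
    have "sum ?f ?B \<le> (\<Sum>p\<in>?B. (1 / (2 ^ J * R0)) ^ (DIM('a) - 1))"
    proof (intro sum_mono power_mono divide_left_mono)
      show "0 < dist p q * (2 ^ J * R0)" if "p \<in> ?B" for p
      proof (rule mult_pos_pos[OF less_le_trans[OF pos] pos])
        show "2 ^ J * R0 \<le> dist p q" using that by simp
      qed
    qed (use R0 in auto)
    also have "\<dots> = real (card ?B) * (1 / (2 ^ J * R0)) ^ (DIM('a) - 1)" by simp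
    also have "\<dots> \<le> (\<epsilon> * (2 ^ Suc J * R0) ^ DIM('a)) * (1 / (2 ^ J * R0)) ^ (DIM('a) - 1)"
    proof (rule mult_right_mono)
      have "card ?B \<le> card {p \<in> Z. dist p q < 2 ^ Suc J * R0}"
        using Suc.prems(1,3) by (intro card_mono) auto
      also have "real \<dots> \<le> \<epsilon> * (2 ^ Suc J * R0) ^ DIM('a)"
      proof (rule Suc.prems(4))
        have "1 * R0 \<le> 2 ^ Suc J * R0" using R0 one_le_power[of "2::real" "Suc J"] by (intro mult_right_mono) auto
        then show "R0 \<le> 2 ^ Suc J * R0" by simp
      qed
      finally show "real (card ?B) \<le> \<epsilon> * (2 ^ Suc J * R0) ^ DIM('a)" by simp
    qed (use R0 in auto)
    also have "\<dots> = \<epsilon> * 2 ^ DIM('a) * (2 ^ J * R0)"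
    proof -
      obtain m where m: "DIM('a) = Suc m" using d by (metis DIM_positive gr0_conv_Suc)
      have "2 ^ Suc J * R0 = 2 * (2 ^ J * R0)" by simp
      then show ?thesis unfolding m power_mult_distrib[of 2] using pos by (simp add: power_one_over field_simps)
    qed
    finally show ?thesis .
  qed
  finally show ?case by (simp add: mult_ac)
qed

lemma ex_power_two_between:
  fixes x :: real
  shows "\<exists>J. x \<le> 2 ^ J \<and> 2 ^ J \<le> 2 * max 1 x"
proof -
  have "(1::real) < 2" by simp
  from real_arch_pow[OF this] obtain n where n: "x < 2 ^ n" by blast
  define J where "J = (LEAST n. x \<le> 2 ^ n)"
  have J: "x \<le> 2 ^ J" unfolding J_def by (rule LeastI[of _ n]) (use n in simp)
  have "2 ^ J \<le> 2 * max 1 x"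
  proof (cases J)
    case 0 then show ?thesis by simp
  next
    case (Suc j)
    then have "j < (LEAST n. x \<le> 2 ^ n)" unfolding J_def[symmetric] by simp
    then have "\<not> x \<le> 2 ^ j" by (rule not_less_Least)
    then show ?thesis unfolding Suc by simp
  qed
  with J show ?thesis by blast
qed

section \<open>Lattices and closed subgroups\<close>

lemma full_rank_lattice_subgroup:
  assumes "full_rank_lattice L"
  shows "0 \<in> L" and "x \<in> L \<Longrightarrow> y \<in> L \<Longrightarrow> x + y \<in> L" and "x \<in> L \<Longrightarrow> - x \<in> L"
    and "x \<in> L \<Longrightarrow> y \<in> L \<Longrightarrow> x - y \<in> L"
proof -
  obtain B where L: "L = {(\<Sum>b\<in>B. of_int (c b) *\<^sub>R b) | c. True}"
    using assms unfolding full_rank_lattice_def by blast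
  have I: "(\<Sum>b\<in>B. of_int (c b) *\<^sub>R b) \<in> L" for c unfolding L by blast
  show "0 \<in> L" using I[of "\<lambda>_. 0"] by simp
  show add: "x + y \<in> L" if xy: "x \<in> L" "y \<in> L" for x y
  proof -
    obtain c d where "x = (\<Sum>b\<in>B. of_int (c b) *\<^sub>R b)" "y = (\<Sum>b\<in>B. of_int (d b) *\<^sub>R b)"
      using xy unfolding L by blast
    then show ?thesis using I[of "\<lambda>b. c b + d b"] by (simp add: scaleR_add_left sum.distrib)
  qed
  show min: "- x \<in> L" if x: "x \<in> L" for x
  proof -
    obtain c where "x = (\<Sum>b\<in>B. of_int (c b) *\<^sub>R b)" using x unfolding L by blast
    then show ?thesis using I[of "\<lambda>b. - c b"] by (simp add: sum_negf)
  qed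
  show "x - y \<in> L" if "x \<in> L" "y \<in> L" using add[OF that(1) min[OF that(2)]] by simp
qed

text \<open>Coordinates with respect to the basis are integers on \<open>L\<close> and bounded by a
  multiple of the norm, so a short lattice vector has all coordinates smaller than 1 in absolute
  value.\<close>

lemma full_rank_lattice_discrete:
  assumes "full_rank_lattice L"
  obtains r where "0 < r" "\<And>y. y \<in> L \<Longrightarrow> norm y < r \<Longrightarrow> y = 0"
proof -
  obtain B where B: "independent B" "L = {(\<Sum>b\<in>B. of_int (c b) *\<^sub>R b) | c. True}"
    using assms unfolding full_rank_lattice_def by blast
  have fin: "finite B" using B(1) by (rule finiteI_independent)
  have "\<forall>b. \<exists>g. linear g \<and> (\<forall>x\<in>B. g x = (if x = b then 1 else 0 :: real))"
    by (intro allI linear_independent_extend[OF B(1)])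
  from choice[OF this] obtain g where g: "\<And>b. linear (g b)" "\<And>b x. x \<in> B \<Longrightarrow> g b x = (if x = b then 1 else 0 :: real)"
    by blast
  have "\<exists>K>0. \<forall>x. norm (g b x) \<le> K * norm x" for b using linear_bounded_pos[OF g(1)] by blast
  then obtain K where K: "\<And>b. 0 < K b" "\<And>b x. norm (g b x) \<le> K b * norm x" by metis
  define r where "r = 1 / (1 + (\<Sum>b\<in>B. K b))"
  have S0: "0 \<le> (\<Sum>b\<in>B. K b)" using K(1) by (simp add: sum_nonneg less_imp_le)
  then have r: "0 < r" by (simp add: r_def)
  moreover have "y = 0" if y: "y \<in> L" "norm y < r" for y
  proof -
    obtain c where c: "y = (\<Sum>b\<in>B. of_int (c b) *\<^sub>R b)" using y(1) unfolding B(2) by blast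
    have "c b = 0" if b: "b \<in> B" for b
    proof -
      have "g b y = (\<Sum>x\<in>B. of_int (c x) * g b x)"
        unfolding c using g(1)[of b] by (simp add: linear_sum linear_scale)
      also have "\<dots> = (\<Sum>x\<in>B. if x = b then of_int (c x) else 0)" by (intro sum.cong) (auto simp: g(2))
      also have "\<dots> = of_int (c b)" using b fin by simp
      finally have "\<bar>of_int (c b)\<bar> \<le> K b * norm y" using K(2)[of b y] by simp
      also have "\<dots> \<le> (\<Sum>b\<in>B. K b) * norm y"
        using b fin K(1) by (intro mult_right_mono member_le_sum) (auto intro: less_imp_le)
      also have "\<dots> \<le> (1 + (\<Sum>b\<in>B. K b)) * norm y" by (simp add: distrib_right)
      also have "\<dots> < 1" using y(2) S0 by (simp add: r_def field_simps)
      finally show ?thesis by linarith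
    qed
    then show ?thesis unfolding c by simp
  qed
  ultimately show ?thesis using that by blast
qed

lemma full_rank_lattice_cocompact:
  assumes "full_rank_lattice L"
  obtains r where "0 < r" "\<And>x. \<exists>y\<in>L. norm (x - y) \<le> r"
proof -
  obtain B where B: "independent B" "span B = UNIV" "L = {(\<Sum>b\<in>B. of_int (c b) *\<^sub>R b) | c. True}"
    using assms unfolding full_rank_lattice_def by blast
  have fin: "finite B" using B(1) by (rule finiteI_independent)
  have "\<exists>y\<in>L. norm (x - y) \<le> 1 + (\<Sum>b\<in>B. norm b)" for x
  proof -
    have "x \<in> span B" using B(2) by simp
    then obtain a where a: "x = (\<Sum>b\<in>B. a b *\<^sub>R b)" unfolding span_finite[OF fin] by auto
    let ?y = "\<Sum>b\<in>B. of_int \<lfloor>a b\<rfloor> *\<^sub>R b"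
    have "norm (x - ?y) = norm (\<Sum>b\<in>B. (a b - of_int \<lfloor>a b\<rfloor>) *\<^sub>R b)"
      unfolding a by (simp add: sum_subtractf scaleR_diff_left)
    also have "\<dots> \<le> (\<Sum>b\<in>B. norm ((a b - of_int \<lfloor>a b\<rfloor>) *\<^sub>R b))" by (rule norm_sum)
    also have "\<dots> \<le> (\<Sum>b\<in>B. norm b)"
    proof (rule sum_mono)
      fix b
      have "\<bar>a b - of_int \<lfloor>a b\<rfloor>\<bar> \<le> 1" by linarith
      then show "norm ((a b - of_int \<lfloor>a b\<rfloor>) *\<^sub>R b) \<le> norm b" by (simp add: mult_left_le_one_le)
    qed
    finally have "norm (x - ?y) \<le> 1 + (\<Sum>b\<in>B. norm b)" by simp
    moreover have "?y \<in> L" unfolding B(3) by (rule CollectI, rule exI[of _ "\<lambda>b. \<lfloor>a b\<rfloor>"]) simp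
    ultimately show ?thesis by blast
  qed
  moreover have "0 < 1 + (\<Sum>b\<in>B. norm b)" by (simp add: add_pos_nonneg sum_nonneg)
  ultimately show ?thesis using that by blast
qed

text \<open>For a closed subgroup this is the largest linear subspace that it contains.\<close>

definition line_space :: "'b::real_normed_vector set \<Rightarrow> 'b set" where
  "line_space A = {x. \<forall>t::real. t *\<^sub>R x \<in> A}"

section \<open>Linear part of a closed subgroup of a Euclidean space\<close>

locale closed_subgroup =
  fixes A :: "'b::euclidean_space set"
  assumes closed: "closed A" and zero: "0 \<in> A" and diff: "\<And>x y. x \<in> A \<Longrightarrow> y \<in> A \<Longrightarrow> x - y \<in> A"
begin

lemma minus: "x \<in> A \<Longrightarrow> - x \<in> A" using diff[of 0 x] zero by simp
lemma add: "x \<in> A \<Longrightarrow> y \<in> A \<Longrightarrow> x + y \<in> A" using diff[of x "- y"] minus[of y] by simp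

lemma of_nat_scale: "x \<in> A \<Longrightarrow> real n *\<^sub>R x \<in> A"
  by (induction n) (auto simp: zero add scaleR_add_left)

lemma of_int_scale: "x \<in> A \<Longrightarrow> of_int k *\<^sub>R x \<in> A"
  using of_nat_scale[of x "nat k"] minus[OF of_nat_scale[of x "nat (- k)"]] by (cases "0 \<le> k") auto

lemma subspace_line_space: "subspace (line_space A)"
  unfolding subspace_def line_space_def using zero add by (auto simp: scaleR_add_right)

lemma line_space_subset: "line_space A \<subseteq> A"
proof
  fix x assume "x \<in> line_space A"
  then have "1 *\<^sub>R x \<in> A" unfolding line_space_def by blast
  then show "x \<in> A" by simp
qed

text \<open>Otherwise there are nonzero elements \<open>b n\<close> tending to 0 and orthogonal to
  the linear part. Their integer multiples fill the lines through them with smaller and smaller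
  mesh, so the whole line in a limiting direction \<open>l\<close> lies in the closed set
  \<open>A\<close>. Then \<open>l\<close> belongs to the linear part and is orthogonal to it, yet
  has norm 1.\<close>

lemma gap:
  obtains g where "0 < g" "\<And>a. a \<in> A \<Longrightarrow> norm a < g \<Longrightarrow> a \<in> line_space A"
proof -
  let ?V = "line_space A"
  have spanV: "span ?V = ?V" using subspace_line_space by (simp add: span_eq_iff)
  have "\<exists>g>0. \<forall>a\<in>A. norm a < g \<longrightarrow> a \<in> ?V"
  proof (rule ccontr)
    assume neg: "\<not> ?thesis"
    have "\<exists>b. b \<in> A \<and> b \<noteq> 0 \<and> norm b < 1 / real (Suc n) \<and> (\<forall>v\<in>?V. orthogonal b v)" for n
    proof -
      have "0 < 1 / real (Suc n)" by simp
      with neg obtain a where a: "a \<in> A" "norm a < 1 / real (Suc n)" "a \<notin> ?V" by blast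
      obtain y z where yz: "y \<in> span ?V" "\<And>w. w \<in> span ?V \<Longrightarrow> orthogonal z w" "a = y + z"
        using orthogonal_subspace_decomp_exists[of ?V a] by metis
      have "z = a - y" using yz(3) by simp
      then have "z \<in> A" using diff[OF a(1)] yz(1) line_space_subset spanV by auto
      moreover have "z \<noteq> 0" using a(3) yz(1,3) spanV by auto
      moreover have "norm z \<le> norm a"
      proof -
        have "(norm a)\<^sup>2 = (norm y)\<^sup>2 + (norm z)\<^sup>2"
          unfolding yz(3) using yz(2)[OF yz(1)] by (intro norm_add_Pythagorean) (simp add: orthogonal_commute)
        then have "(norm z)\<^sup>2 \<le> (norm a)\<^sup>2" by simp
        then show ?thesis by (rule power2_le_imp_le) simp
      qed
      ultimately show ?thesis using a(2) yz(2) spanV by (intro exI[of _ z]) auto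
    qed
    then obtain b where b: "\<And>n. b n \<in> A" "\<And>n. b n \<noteq> 0" "\<And>n. norm (b n) < 1 / real (Suc n)"
      "\<And>n v. v \<in> ?V \<Longrightarrow> orthogonal (b n) v" by metis
    define u where "u n = sgn (b n)" for n
    have "\<forall>n. u n \<in> sphere 0 1" using b(2) by (simp add: u_def norm_sgn)
    then obtain l s where l: "l \<in> sphere 0 1" "strict_mono s" "(u \<circ> s) \<longlonglongrightarrow> l"
      using compact_sphere[of "0::'b" 1] unfolding compact_def by metis
    have b0: "(\<lambda>n. norm (b (s n))) \<longlonglongrightarrow> 0"
    proof (rule tendsto_sandwich[of "\<lambda>_. 0" _ _ "\<lambda>n. 1 / real (Suc n)"])
      show "\<forall>\<^sub>F n in sequentially. norm (b (s n)) \<le> 1 / real (Suc n)"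
      proof (rule always_eventually, rule allI)
        fix n
        have "norm (b (s n)) \<le> 1 / real (Suc (s n))" using b(3) by (rule less_imp_le)
        also have "\<dots> \<le> 1 / real (Suc n)" using seq_suble[OF l(2), of n] by (simp add: frac_le)
        finally show "norm (b (s n)) \<le> 1 / real (Suc n)" .
      qed
      show "(\<lambda>n. 1 / real (Suc n)) \<longlonglongrightarrow> 0" using LIMSEQ_inverse_real_of_nat by (simp add: inverse_eq_divide)
    qed auto
    have "l \<in> ?V" unfolding line_space_def
    proof (rule CollectI, rule allI)
      fix t :: real
      \<comment> \<open>Rounding down makes the integer multiple of \<open>b (s n)\<close> miss
        \<open>t *\<^sub>R u (s n)\<close> by at most \<open>norm (b (s n))\<close>, which tends to
        0.\<close>
      define k where "k n = \<lfloor>t / norm (b (s n))\<rfloor>" for n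
      have lim: "(\<lambda>n. of_int (k n) *\<^sub>R b (s n)) \<longlonglongrightarrow> t *\<^sub>R l"
      proof -
        have "(\<lambda>n. of_int (k n) *\<^sub>R b (s n) - t *\<^sub>R u (s n)) \<longlonglongrightarrow> 0"
        proof (rule Lim_null_comparison[OF always_eventually b0], rule allI)
          fix n
          have bn: "0 < norm (b (s n))" using b(2) by simp
          have "of_int (k n) *\<^sub>R b (s n) - t *\<^sub>R u (s n) = (of_int (k n) - t / norm (b (s n))) *\<^sub>R b (s n)"
            by (simp add: u_def sgn_div_norm algebra_simps divide_inverse)
          moreover have "\<bar>of_int (k n) - t / norm (b (s n))\<bar> \<le> 1" unfolding k_def by linarith
          ultimately show "norm (of_int (k n) *\<^sub>R b (s n) - t *\<^sub>R u (s n)) \<le> norm (b (s n))"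
            by (simp add: mult_left_le_one_le)
        qed
        moreover have "(\<lambda>n. t *\<^sub>R u (s n)) \<longlonglongrightarrow> t *\<^sub>R l" using l(3) by (intro tendsto_intros) (simp add: o_def)
        ultimately show ?thesis using tendsto_add[of "\<lambda>n. of_int (k n) *\<^sub>R b (s n) - t *\<^sub>R u (s n)" 0] by fastforce
      qed
      show "t *\<^sub>R l \<in> A"
        by (rule closed_sequentially[OF closed _ lim]) (use b(1) of_int_scale in blast)
    qed
    then have "\<And>n. u n \<bullet> l = 0" using b(4) by (simp add: u_def sgn_div_norm orthogonal_def)
    moreover have "(\<lambda>n. u (s n) \<bullet> l) \<longlonglongrightarrow> l \<bullet> l" using l(3) by (intro tendsto_intros) (simp add: o_def)
    ultimately have "(\<lambda>n. 0) \<longlonglongrightarrow> l \<bullet> l" by simp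
    then have "l \<bullet> l = 0" by (rule LIMSEQ_unique) simp
    then show False using l(1) by simp
  qed
  then show ?thesis using that by blast
qed

text \<open>By \<open>gap\<close> the linear part is relatively open in \<open>C\<close> as well as
  closed. Applied to the component of 0, this links the identity component, by which null sets are
  defined, with the linear part used for counting.\<close>

lemma connected_subset_line_space:
  assumes "connected C" "C \<subseteq> A" "0 \<in> C"
  shows "C \<subseteq> line_space A"
proof -
  let ?V = "line_space A"
  obtain g where g: "0 < g" "\<And>a. a \<in> A \<Longrightarrow> norm a < g \<Longrightarrow> a \<in> ?V" using gap by blast
  have "C \<inter> ?V = {} \<or> C \<inter> ?V = C"
  proof -
    have "openin (top_of_set C) (C \<inter> ?V)" unfolding openin_euclidean_subtopology_iff
    proof (intro conjI ballI)
      fix x assume x: "x \<in> C \<inter> ?V"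
      have "y \<in> C \<inter> ?V" if "y \<in> C" "dist y x < g" for y
      proof -
        have "y - x \<in> ?V" using g(2)[of "y - x"] that x assms(2) diff by (auto simp: dist_norm)
        then have "(y - x) + x \<in> ?V" using x subspace_line_space subspace_add by blast
        then show ?thesis using that by simp
      qed
      then show "\<exists>e>0. \<forall>x'\<in>C. dist x' x < e \<longrightarrow> x' \<in> C \<inter> ?V" using g(1) by blast
    qed auto
    moreover have "closedin (top_of_set C) (C \<inter> ?V)"
      using closed_subspace[OF subspace_line_space] by (simp add: closedin_closed_Int)
    ultimately show ?thesis using assms(1) unfolding connected_clopen by blast
  qed
  moreover have "0 \<in> ?V" using subspace_line_space subspace_0 by blast
  ultimately show ?thesis using assms(3) by blast
qed

end

section \<open>Counting lattice points by packing\<close>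

lemma emeasure_lborel_vimage_translate:
  fixes X :: "'a::euclidean_space set"
  assumes [measurable]: "X \<in> sets borel"
  shows "{x. x - a \<in> X} \<in> sets borel" "emeasure lborel {x. x - a \<in> X} = emeasure lborel X"
proof -
  have eq: "{x. x - a \<in> X} = (+) (- a) -` X" by auto
  have m: "(+) (- a) \<in> borel_measurable borel" by simp
  show "{x. x - a \<in> X} \<in> sets borel" unfolding eq using measurable_sets[OF m, of X] by simp
  have "emeasure lborel X = emeasure (distr lborel borel ((+) (- a))) X" by (simp add: lborel_distr_plus)
  also have "\<dots> = emeasure lborel {x. x - a \<in> X}" unfolding eq by (subst emeasure_distr) auto
  finally show "emeasure lborel {x. x - a \<in> X} = emeasure lborel X" ..
qed

text \<open>A small box \<open>K\<close> is cut into pieces, and each piece is moved by a lattice vector so that its extent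
  along \<open>V\<close> becomes smaller than \<open>\<delta>\<close>.  The pieces still pack under \<open>L\<close>, and the volume of \<open>K\<close> does
  not depend on \<open>\<delta>\<close>.\<close>

lemma lattice_point_count:
  fixes L :: "('a::euclidean_space \<times> 'b::euclidean_space) set"
  assumes L: "full_rank_lattice L" and V: "subspace V" "V \<subseteq> closure (snd ` L)"
  obtains \<kappa> r where "0 < \<kappa>" "0 < r"
    "\<And>\<delta>. 0 < \<delta> \<Longrightarrow> \<exists>R1>0. \<forall>c R U S. 0 \<le> R \<longrightarrow> S \<in> sets borel \<longrightarrow> emeasure lborel S < \<infinity> \<longrightarrow>
      (\<forall>u e b. u \<in> U \<longrightarrow> norm e < \<delta> \<longrightarrow> norm b \<le> r \<longrightarrow> (\<forall>v\<in>V. orthogonal b v) \<longrightarrow> u + b + e \<in> S) \<longrightarrow>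
      finite {y \<in> L. fst y \<in> ball c R \<and> snd y \<in> U} \<and>
      \<kappa> * real (card {y \<in> L. fst y \<in> ball c R \<and> snd y \<in> U})
        \<le> unit_ball_vol (real DIM('a)) * (R + R1) ^ DIM('a) * measure lborel S"
proof -
  obtain r0 where r0: "0 < r0" "\<And>y. y \<in> L \<Longrightarrow> norm y < r0 \<Longrightarrow> y = 0" using full_rank_lattice_discrete[OF L] by blast
  \<comment> \<open>Two points of the box \<open>K\<close> then differ by less than
    \<open>4 * r = r0\<close>, so the translates of \<open>K\<close> by \<open>L\<close> are
    disjoint.\<close>
  define r where "r = r0 / 4"
  have r: "0 < r" using r0 by (simp add: r_def)
  define K where "K = ball (0::'a) r \<times> ball (0::'b) r"
  have spanV: "span V = V" using V(1) by (simp add: span_eq_iff)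
  have Ks: "K \<in> sets borel" unfolding K_def by (intro borel_open open_Times open_ball)
  have Kpack: "k = k'" "y = y'" if "k \<in> K" "k' \<in> K" "y \<in> L" "y' \<in> L" "y + k = y' + k'" for k k' y y'
  proof -
    have "norm (k - k') \<le> norm (fst (k - k')) + norm (snd (k - k'))"
      by (metis norm_Pair_le prod.collapse)
    also have "\<dots> \<le> (norm (fst k) + norm (fst k')) + (norm (snd k) + norm (snd k'))"
      by (simp add: add_mono norm_triangle_ineq4)
    also have "\<dots> < r0" using that(1,2) by (auto simp: K_def r_def)
    finally have "norm (y' - y) < r0" using that(5) by (metis add_diff_cancel_left' add_diff_eq diff_add_eq diff_diff_eq2 norm_minus_commute)
    then have "y' - y = 0" using r0(2) full_rank_lattice_subgroup(4)[OF L that(4,3)] by blast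
    then show "k = k'" "y = y'" using that(5) by auto
  qed
  define \<kappa> where "\<kappa> = measure lborel K"
  have Ke: "emeasure lborel K = emeasure lborel (ball (0::'a) r) * emeasure lborel (ball (0::'b) r)"
    unfolding K_def by (subst lborel_prod[symmetric], rule lborel.emeasure_pair_measure_Times) auto
  have Kfin: "emeasure lborel K < \<infinity>"
    unfolding Ke using emeasure_lborel_ball_finite[of "0::'a" r] emeasure_lborel_ball_finite[of "0::'b" r]
    by (simp add: ennreal_mult_less_top)
  have "\<kappa> = measure lborel (ball (0::'a) r) * measure lborel (ball (0::'b) r)"
    unfolding \<kappa>_def measure_def Ke by (simp add: enn2real_mult)
  then have kap: "0 < \<kappa>" using content_ball_pos[OF r] by simp
  have main: "\<exists>R1>0. \<forall>c R U S. 0 \<le> R \<longrightarrow> S \<in> sets borel \<longrightarrow> emeasure lborel S < \<infinity> \<longrightarrow>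
      (\<forall>u e b. u \<in> U \<longrightarrow> norm e < \<delta> \<longrightarrow> norm b \<le> r \<longrightarrow> (\<forall>v\<in>V. orthogonal b v) \<longrightarrow> u + b + e \<in> S) \<longrightarrow>
      finite {y \<in> L. fst y \<in> ball c R \<and> snd y \<in> U} \<and>
      \<kappa> * real (card {y \<in> L. fst y \<in> ball c R \<and> snd y \<in> U})
        \<le> unit_ball_vol (real DIM('a)) * (R + R1) ^ DIM('a) * measure lborel S" if del: "0 < \<delta>" for \<delta>
  proof -
    define Q where "Q = {b. norm b \<le> r \<and> (\<forall>v\<in>V. orthogonal b v)}"
    \<comment> \<open>\<open>Ob z\<close> consists of the internal coordinates that the shift by
      \<open>z\<close> brings within \<open>\<delta>\<close> of \<open>Q\<close>. These sets cover
      the ball: the component along \<open>V\<close> is cancelled approximately by some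
      \<open>snd z\<close>, since \<open>V\<close> lies in the closure of the internal projection of
      \<open>L\<close>.\<close>
    define Ob where "Ob z = (\<Union>b\<in>Q. ball (b - snd z) \<delta>)" for z :: "'a \<times> 'b"
    have Oopen: "open (Ob z)" for z unfolding Ob_def by auto
    have cover: "cball 0 r \<subseteq> (\<Union>z\<in>L. Ob z)"
    proof
      fix x :: 'b assume x: "x \<in> cball 0 r"
      obtain a b where ab: "a \<in> span V" "\<And>w. w \<in> span V \<Longrightarrow> orthogonal b w" "x = a + b"
        using orthogonal_subspace_decomp_exists[of V x] by metis
      have "(norm x)\<^sup>2 = (norm a)\<^sup>2 + (norm b)\<^sup>2"
        unfolding ab(3) using ab(2)[OF ab(1)] by (intro norm_add_Pythagorean) (simp add: orthogonal_commute)
      then have "(norm b)\<^sup>2 \<le> (norm x)\<^sup>2" by simp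
      then have "norm b \<le> norm x" by (rule power2_le_imp_le) simp
      then have bQ: "b \<in> Q" using x ab(2) spanV by (auto simp: Q_def)
      have "- a \<in> closure (snd ` L)" using ab(1) spanV V subspace_neg by blast
      then obtain z where z: "z \<in> L" "dist (snd z) (- a) < \<delta>" using del unfolding closure_approachable by blast
      have "dist (b - snd z) x < \<delta>" proof -
        have "b - snd z - (a + b) = - (snd z - - a)" by simp
        then show ?thesis using z(2) unfolding ab(3) dist_norm by (simp only: norm_minus_cancel)
      qed
      then show "x \<in> (\<Union>z\<in>L. Ob z)" using z(1) bQ unfolding Ob_def by auto
    qed
    obtain J where J: "J \<subseteq> L" "finite J" "cball 0 r \<subseteq> (\<Union>z\<in>J. Ob z)"
      using compactE_image[OF compact_cball _ cover] Oopen by metis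
    obtain zs where zs: "set zs = J" using J(2) finite_list by blast
    define n where "n = length zs"
    define Ki where "Ki i = {k \<in> K. snd k \<in> Ob (zs ! i) \<and> (\<forall>j<i. snd k \<notin> Ob (zs ! j))}" for i
    have sn: "{k :: 'a \<times> 'b. snd k \<in> Ob z} \<in> sets borel" for z
    proof -
      have "open {k :: 'a \<times> 'b. snd k \<in> Ob z}" using open_vimage_snd[OF Oopen[of z]] by (simp add: vimage_def)
      then show ?thesis by (rule borel_open)
    qed
    have Kis: "Ki i \<in> sets borel" for i
    proof -
      have "Ki i = (K \<inter> {k. snd k \<in> Ob (zs ! i)}) - (\<Union>j<i. {k. snd k \<in> Ob (zs ! j)})" by (auto simp: Ki_def)
      then show ?thesis using Ks sn by auto
    qed
    have Kdisj: "i = j" if "k \<in> Ki i" "k \<in> Ki j" for k i j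
      using that by (auto simp: Ki_def) (metis linorder_neqE_nat)
    have Kun: "K = (\<Union>i<n. Ki i)"
    proof (intro equalityI subsetI)
      fix k assume k: "k \<in> K"
      then have "snd k \<in> cball 0 r" by (auto simp: K_def)
      then obtain z where "z \<in> J" "snd k \<in> Ob z" using J(3) by blast
      then obtain i where i: "i < n" "snd k \<in> Ob (zs ! i)" unfolding zs[symmetric] n_def by (metis in_set_conv_nth)
      define i0 where "i0 = (LEAST i. snd k \<in> Ob (zs ! i))"
      have "snd k \<in> Ob (zs ! i0)" unfolding i0_def using i(2) by (rule LeastI)
      moreover have "i0 < n" unfolding i0_def using Least_le[of "\<lambda>i. snd k \<in> Ob (zs ! i)", OF i(2)] i(1) by linarith
      moreover have "\<forall>j<i0. snd k \<notin> Ob (zs ! j)" unfolding i0_def using not_less_Least by blast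
      ultimately show "k \<in> (\<Union>i<n. Ki i)" using k by (auto simp: Ki_def)
    qed (auto simp: Ki_def)
    have Ksum: "emeasure lborel K = (\<Sum>i<n. emeasure lborel (Ki i))"
      unfolding Kun using Kis Kdisj by (subst sum_emeasure) (auto simp: disjoint_family_on_def)
    define R1 where "R1 = r + (\<Sum>z\<in>J. norm (fst z))"
    have R1: "0 < R1" unfolding R1_def using r by (simp add: add_pos_nonneg sum_nonneg)
    have bound: "\<kappa> * real (card F) \<le> unit_ball_vol (real DIM('a)) * (R + R1) ^ DIM('a) * measure lborel S"
      if R: "0 \<le> R" and S: "S \<in> sets borel" "emeasure lborel S < \<infinity>"
        and US: "\<And>u e b. u \<in> U \<Longrightarrow> norm e < \<delta> \<Longrightarrow> norm b \<le> r \<Longrightarrow> (\<forall>v\<in>V. orthogonal b v) \<Longrightarrow> u + b + e \<in> S"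
        and F: "finite F" "F \<subseteq> {y \<in> L. fst y \<in> ball c R \<and> snd y \<in> U}" for c R U S F
    proof -
      \<comment> \<open>For each lattice point the pieces \<open>Ki i\<close>, displaced by their
        own \<open>zs ! i\<close>, still have total volume \<open>\<kappa>\<close>. All
        displacements lie in \<open>L\<close>, so distinct pairs give disjoint sets, and these all
        fit into \<open>ball c (R + R1) \<times> S\<close>.\<close>
      define T where "T p = {x. x - (fst p + zs ! snd p) \<in> Ki (snd p)}" for p :: "('a \<times> 'b) \<times> nat"
      have Ts: "T p \<in> sets borel" and Te: "emeasure lborel (T p) = emeasure lborel (Ki (snd p))" for p
        unfolding T_def using emeasure_lborel_vimage_translate[OF Kis] by auto
      have zL: "zs ! i \<in> L" "zs ! i \<in> J" if "i < n" for i using that J(1) zs unfolding n_def by (auto dest: nth_mem)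
      have disj: "disjoint_family_on T (F \<times> {..<n})"
        unfolding disjoint_family_on_def
      proof (intro ballI impI equals0I)
        fix p p' x assume p: "p \<in> F \<times> {..<n}" "p' \<in> F \<times> {..<n}" "p \<noteq> p'" and x: "x \<in> T p \<inter> T p'"
        let ?k = "x - (fst p + zs ! snd p)" and ?k' = "x - (fst p' + zs ! snd p')"
        have k: "?k \<in> Ki (snd p)" "?k' \<in> Ki (snd p')" using x by (auto simp: T_def)
        then have kK: "?k \<in> K" "?k' \<in> K" by (auto simp: Ki_def)
        have yL: "fst p + zs ! snd p \<in> L" "fst p' + zs ! snd p' \<in> L"
          using p F(2) zL by (auto intro!: full_rank_lattice_subgroup(2)[OF L])
        have "?k = ?k'" "fst p + zs ! snd p = fst p' + zs ! snd p'" using Kpack[OF kK yL] by auto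
        then have "snd p = snd p'" "fst p = fst p'" using Kdisj k by (metis, metis Kdisj add_right_cancel k)
        then show False using p(3) by (simp add: prod_eq_iff)
      qed
      have sub: "(\<Union>p\<in>F \<times> {..<n}. T p) \<subseteq> ball c (R + R1) \<times> S"
      proof (rule UN_least)
        fix p assume p: "p \<in> F \<times> {..<n}"
        show "T p \<subseteq> ball c (R + R1) \<times> S"
        proof
          fix x assume x: "x \<in> T p"
          define k where "k = x - (fst p + zs ! snd p)"
          have xk: "x = fst p + zs ! snd p + k" by (simp add: k_def)
          have k: "k \<in> K" "snd k \<in> Ob (zs ! snd p)" using x by (auto simp: T_def k_def Ki_def)
          have y: "fst (fst p) \<in> ball c R" "snd (fst p) \<in> U" and z: "zs ! snd p \<in> J" using p F(2) zL by auto
          have "norm (fst (zs ! snd p)) \<le> (\<Sum>z\<in>J. norm (fst z))" using z J(2) by (intro member_le_sum) auto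
          moreover have "norm (fst k) < r" using k(1) by (auto simp: K_def)
          moreover have "dist c (fst x) \<le> dist c (fst (fst p)) + norm (fst (zs ! snd p)) + norm (fst k)"
          proof -
            have "dist c (fst x) = norm ((c - fst (fst p)) - fst (zs ! snd p) - fst k)"
              unfolding xk by (simp add: dist_norm algebra_simps)
            also have "\<dots> \<le> norm (c - fst (fst p)) + norm (fst (zs ! snd p)) + norm (fst k)"
              by (rule order_trans[OF norm_triangle_ineq4 add_right_mono[OF norm_triangle_ineq4]])
            finally show ?thesis by (simp add: dist_norm)
          qed
          ultimately have "fst x \<in> ball c (R + R1)" using y(1) by (simp add: R1_def)
          moreover obtain b where b: "b \<in> Q" "dist (b - snd (zs ! snd p)) (snd k) < \<delta>" using k(2) by (auto simp: Ob_def)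
          have "snd (fst p) + b + (snd k - (b - snd (zs ! snd p))) \<in> S"
            using b y(2) by (intro US) (auto simp: Q_def dist_norm norm_minus_commute)
          then have "snd x \<in> S" unfolding xk by (simp add: algebra_simps)
          ultimately show "x \<in> ball c (R + R1) \<times> S" by (simp add: mem_Times_iff)
        qed
      qed
      have "of_nat (card F) * emeasure lborel K = (\<Sum>y\<in>F. \<Sum>i<n. emeasure lborel (T (y, i)))"
        by (simp add: Te Ksum)
      also have "\<dots> = (\<Sum>p\<in>F \<times> {..<n}. emeasure lborel (T p))" by (simp add: sum.cartesian_product)
      also have "\<dots> = emeasure lborel (\<Union>p\<in>F \<times> {..<n}. T p)"
        using F(1) Ts disj by (intro sum_emeasure) auto
      also have "\<dots> \<le> emeasure lborel (ball c (R + R1) \<times> S)"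
        using sub S(1) by (intro emeasure_mono) (auto simp: borel_prod[symmetric])
      also have "\<dots> = emeasure lborel (ball c (R + R1)) * emeasure lborel S"
        by (subst lborel_prod[symmetric], rule lborel.emeasure_pair_measure_Times) (use S in auto)
      finally have le: "of_nat (card F) * emeasure lborel K \<le> emeasure lborel (ball c (R + R1)) * emeasure lborel S" .
      have "emeasure lborel (ball c (R + R1)) * emeasure lborel S < \<infinity>"
        using S(2) emeasure_lborel_ball_finite[of c "R + R1"] by (simp add: ennreal_mult_less_top)
      then have "enn2real (of_nat (card F) * emeasure lborel K) \<le> enn2real (emeasure lborel (ball c (R + R1)) * emeasure lborel S)"
        using le by (intro enn2real_mono) auto
      then have "real (card F) * \<kappa> \<le> measure lborel (ball c (R + R1)) * measure lborel S"
        by (simp add: enn2real_mult measure_def \<kappa>_def)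
      then show ?thesis using R R1 by (simp add: content_ball mult.commute)
    qed
    have "finite {y \<in> L. fst y \<in> ball c R \<and> snd y \<in> U} \<and>
      \<kappa> * real (card {y \<in> L. fst y \<in> ball c R \<and> snd y \<in> U})
        \<le> unit_ball_vol (real DIM('a)) * (R + R1) ^ DIM('a) * measure lborel S"
      if R: "0 \<le> R" and S: "S \<in> sets borel" "emeasure lborel S < \<infinity>"
        and US: "\<forall>u e b. u \<in> U \<longrightarrow> norm e < \<delta> \<longrightarrow> norm b \<le> r \<longrightarrow> (\<forall>v\<in>V. orthogonal b v) \<longrightarrow> u + b + e \<in> S" for c R U S
    proof
      let ?B = "unit_ball_vol (real DIM('a)) * (R + R1) ^ DIM('a) * measure lborel S"
      have b: "\<kappa> * real (card F) \<le> ?B" if "finite F" "F \<subseteq> {y \<in> L. fst y \<in> ball c R \<and> snd y \<in> U}" for F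
        using bound[OF R S _ that] US by blast
      have "card F \<le> nat \<lfloor>?B / \<kappa>\<rfloor>" if "F \<subseteq> {y \<in> L. fst y \<in> ball c R \<and> snd y \<in> U}" "finite F" for F
        using b[OF that(2,1)] kap by (simp add: le_nat_floor le_divide_eq mult.commute)
      then show fin: "finite {y \<in> L. fst y \<in> ball c R \<and> snd y \<in> U}"
        using finite_if_finite_subsets_card_bdd by blast
      show "\<kappa> * real (card {y \<in> L. fst y \<in> ball c R \<and> snd y \<in> U}) \<le> ?B" using b[OF fin] by simp
    qed
    then show ?thesis using R1 by blast
  qed
  show ?thesis by (rule that[OF kap r main])
qed

text \<open>A lattice vector near \<open>(c, 0)\<close> has a bounded internal part, which one of
  finitely many lattice vectors \<open>z\<close> matches up to \<open>\<delta>\<close>. The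
  difference is the near period: its physical part is off \<open>c\<close> by a bounded amount, and
  the gap assumption puts its internal part into \<open>V\<close>.\<close>

lemma lattice_near_periods:
  fixes L :: "('a::euclidean_space \<times> 'b::euclidean_space) set"
  assumes L: "full_rank_lattice L" and d: "0 < \<delta>"
    and gap: "\<And>a. a \<in> closure (snd ` L) \<Longrightarrow> norm a < \<delta> \<Longrightarrow> a \<in> V"
  obtains R1 where "\<And>c. \<exists>y\<in>L. snd y \<in> V \<and> norm (snd y) < \<delta> \<and> dist c (fst y) \<le> R1"
proof -
  obtain r where r: "0 < r" "\<And>x. \<exists>y\<in>L. norm (x - y) \<le> r" using full_rank_lattice_cocompact[OF L] by blast
  let ?C = "closure (snd ` L) \<inter> cball 0 r"
  have "compact ?C" by (simp add: closed_Int_compact)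
  moreover have "?C \<subseteq> (\<Union>z\<in>L. ball (snd z) \<delta>)"
  proof
    fix x assume "x \<in> ?C"
    then have "\<exists>y\<in>snd ` L. dist y x < \<delta>" using d closure_approachable[of x "snd ` L"] by blast
    then show "x \<in> (\<Union>z\<in>L. ball (snd z) \<delta>)" by auto
  qed
  ultimately obtain J where J: "J \<subseteq> L" "finite J" "?C \<subseteq> (\<Union>z\<in>J. ball (snd z) \<delta>)"
    using compactE_image[of ?C L "\<lambda>z. ball (snd z) \<delta>"] by (metis open_ball)
  have "\<exists>y\<in>L. snd y \<in> V \<and> norm (snd y) < \<delta> \<and> dist c (fst y) \<le> r + (\<Sum>z\<in>J. norm (fst z))" for c
  proof -
    obtain y where y: "y \<in> L" "norm ((c, 0) - y) \<le> r" using r(2) by blast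
    have y1: "norm (c - fst y) \<le> r" using norm_fst_le[of "c - fst y" "0 - snd y"] y(2) by (cases y) auto
    have y2: "norm (snd y) \<le> r" using norm_snd_le[of "0 - snd y" "c - fst y"] y(2) by (cases y) auto
    then have "snd y \<in> ?C" using y(1) closure_subset[of "snd ` L"] by auto
    then obtain z where z: "z \<in> J" "norm (snd z - snd y) < \<delta>" using J(3) by (auto simp: dist_norm)
    have zL: "z \<in> L" using z(1) J(1) by blast
    have m: "y - z \<in> L" using full_rank_lattice_subgroup(4)[OF L y(1) zL] .
    have nd: "norm (snd (y - z)) < \<delta>" using z(2) by (simp add: norm_minus_commute)
    have "snd (y - z) \<in> closure (snd ` L)" using m closure_subset[of "snd ` L"] by blast
    then have "snd (y - z) \<in> V" using gap nd by blast
    moreover have "dist c (fst (y - z)) \<le> r + (\<Sum>z\<in>J. norm (fst z))"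
    proof -
      have "dist c (fst (y - z)) = norm ((c - fst y) + fst z)" by (simp add: dist_norm algebra_simps)
      also have "\<dots> \<le> norm (c - fst y) + norm (fst z)" by (rule norm_triangle_ineq)
      also have "norm (fst z) \<le> (\<Sum>z\<in>J. norm (fst z))" using z(1) J(2) by (intro member_le_sum) auto
      finally show ?thesis using y1 by simp
    qed
    ultimately show ?thesis using m nd by blast
  qed
  then show ?thesis using that by blast
qed

section \<open>Almost periodicity of regular cut-and-project sets\<close>

lemma frontier_near_translate:
  fixes A :: "'b::euclidean_space set"
  assumes A: "closed_subgroup A" and a: "a \<in> A" and w: "w \<in> line_space A" and ne: "(a \<in> W) \<noteq> (a + w \<in> W)"
  obtains f where "f \<in> (top_of_set A) frontier_of W" "dist a f \<le> norm w"
proof -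
  interpret closed_subgroup A by fact
  \<comment> \<open>Since \<open>w\<close> lies in the linear part, the segment from
    \<open>a\<close> to \<open>a + w\<close> stays in \<open>A\<close>; being connected and meeting
    both \<open>W\<close> and its complement, it meets the relative frontier.\<close>
  have seg: "closed_segment a (a + w) \<subseteq> A"
  proof
    fix x assume "x \<in> closed_segment a (a + w)"
    then obtain u where "x = (1 - u) *\<^sub>R a + u *\<^sub>R (a + w)" by (auto simp: in_segment)
    then have "x = a + u *\<^sub>R w" by (simp add: algebra_simps)
    then show "x \<in> A" using add[OF a] w by (auto simp: line_space_def)
  qed
  have "connectedin (top_of_set A) (closed_segment a (a + w))" using seg by (simp add: connectedin_subtopology connected_segment)
  moreover have "closed_segment a (a + w) \<inter> W \<noteq> {}" "closed_segment a (a + w) - W \<noteq> {}"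
    using ne ends_in_segment[of a "a + w"] by blast+
  ultimately obtain f where f: "f \<in> closed_segment a (a + w)" "f \<in> (top_of_set A) frontier_of W"
    using connectedin_Int_frontier_of by blast
  have "dist a f \<le> norm w" using segment_bound(1)[OF f(1)] by (simp add: dist_norm norm_minus_commute)
  with f show ?thesis using that by blast
qed

text \<open>Outer regularity supplies \<open>U\<close>; the compact set \<open>X\<close> then has
  positive distance from the closed complement of \<open>U\<close>.\<close>

lemma compact_null_open_superset:
  fixes X :: "'b::euclidean_space set"
  assumes X: "compact X" "X \<in> null_sets lebesgue" and e: "0 < e"
  obtains U \<delta> where "open U" "emeasure lborel U < \<infinity>" "measure lborel U \<le> e" "0 < \<delta>"
    "\<And>x y. x \<in> X \<Longrightarrow> dist x y < \<delta> \<Longrightarrow> y \<in> U"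
proof -
  have Xl: "X \<in> sets lebesgue" using X(2) by auto
  obtain U where U: "open U" "X \<subseteq> U" "emeasure lebesgue (U - X) < ennreal e"
    using sets_lebesgue_outer_open[OF Xl e] by metis
  have "emeasure lborel U = emeasure lebesgue U" using U(1) by simp
  also have "\<dots> = emeasure lebesgue (U - X)"
    using U(1) X(2) by (intro emeasure_Diff_null_set[symmetric]) auto
  finally have eU: "emeasure lborel U < ennreal e" using U(3) by simp
  have "measure lborel U \<le> e"
    using enn2real_mono[OF less_imp_le[OF eU]] e by (simp add: measure_def)
  moreover obtain \<delta> where d: "0 < \<delta>" "\<And>x y. x \<in> X \<Longrightarrow> y \<in> - U \<Longrightarrow> \<delta> \<le> dist x y"
    using separate_compact_closed[OF X(1), of "- U"] U(1,2) by (auto simp: closed_Compl disjoint_eq_subset_Compl)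
  have "y \<in> U" if "x \<in> X" "dist x y < \<delta>" for x y using d(2)[OF that(1), of y] that(2) by auto
  moreover have "emeasure lborel U < \<infinity>" using order_less_trans[OF eU ennreal_less_top] by simp
  ultimately show ?thesis using that[OF U(1)] d(1) by blast
qed

text \<open>The geometric input of all later estimates. Both counts are uniform in the centre
  \<open>c\<close>, and \<open>R0\<close> serves every \<open>y\<close> of the relatively dense set
  \<open>Y\<close>: this is almost periodicity in the sense of Weyl, measured by the density of
  \<open>shift_diff P y\<close>.\<close>

locale almost_periodic_points =
  fixes P :: "'a::euclidean_space set" and C0 :: real
  assumes finite_count: "1 \<le> R \<Longrightarrow> finite (P \<inter> ball c R)"
    and count: "1 \<le> R \<Longrightarrow> real (card (P \<inter> ball c R)) \<le> C0 * R ^ DIM('a)"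
    and almost_periods: "0 < \<epsilon> \<Longrightarrow> \<exists>Y R1 R0. 1 \<le> R0 \<and> (\<forall>c. \<exists>y\<in>Y. dist c y \<le> R1) \<and>
      (\<forall>y\<in>Y. \<forall>c. \<forall>R\<ge>R0. real (card (shift_diff P y \<inter> ball c R)) \<le> \<epsilon> * R ^ DIM('a))"

lemma closed_subgroup_closure_snd:
  assumes "full_rank_lattice L"
  shows "closed_subgroup (closure (snd ` L))"
proof
  have sub: "snd ` L \<subseteq> closure (snd ` L)" by (rule closure_subset)
  show "0 \<in> closure (snd ` L)" using full_rank_lattice_subgroup(1)[OF assms] sub by force
  show "x - y \<in> closure (snd ` L)" if xy: "x \<in> closure (snd ` L)" "y \<in> closure (snd ` L)" for x y
  proof -
    obtain f g where fg: "\<And>n. f n \<in> snd ` L" "f \<longlonglongrightarrow> x" "\<And>n. g n \<in> snd ` L" "g \<longlonglongrightarrow> y"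
      using xy unfolding closure_sequential by metis
    have "f n - g n \<in> snd ` L" for n
    proof -
      obtain a b where "a \<in> L" "b \<in> L" "f n = snd a" "g n = snd b" using fg(1,3) by (metis imageE)
      then show ?thesis using full_rank_lattice_subgroup(4)[OF assms, of a b] by (metis snd_diff image_eqI)
    qed
    then show ?thesis unfolding closure_sequential
      using tendsto_diff[OF fg(2,4)] by (intro exI[of _ "\<lambda>n. f n - g n"]) blast
  qed
qed simp

text \<open>A point whose membership changes under a near period \<open>z\<close> has its internal
  part within \<open>norm (snd z)\<close> of the frontier of \<open>W\<close>, by
  \<open>frontier_near_translate\<close>. The cylinder over the frontier is null by regularity, so
  its compact part has neighbourhoods of arbitrarily small volume, and
  \<open>lattice_point_count\<close> turns small volume into small density.\<close>

lemma regular_cps_almost_periodic: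
  fixes W :: "(real^'m) set" and L :: "((real^'d) \<times> (real^'m)) set"
  assumes reg: "regular_cps W L"
  obtains C0 where "almost_periodic_points (cps W L) C0"
proof -
  let ?A = "closure (snd ` L)" and ?d = "DIM(real^'d)"
  have L: "full_rank_lattice L" and WA: "W \<subseteq> ?A" and Wb: "bounded W"
    and null: "haar_A_null L ((top_of_set ?A) frontier_of W)"
    using reg by (simp_all add: regular_cps_def cps_A_def)
  define V where "V = line_space ?A"
  have sg: "closed_subgroup ?A" by (rule closed_subgroup_closure_snd[OF L])
  interpret closed_subgroup ?A by (rule sg)
  have V: "subspace V" "V \<subseteq> ?A" using subspace_line_space line_space_subset by (simp_all add: V_def)
  obtain g where g: "0 < g" "\<And>a. a \<in> ?A \<Longrightarrow> norm a < g \<Longrightarrow> a \<in> V" using gap unfolding V_def by blast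
  obtain \<kappa> r where kap: "0 < \<kappa>" and r: "0 < r" and cnt:
    "\<And>\<delta>. 0 < \<delta> \<Longrightarrow> \<exists>R1>0. \<forall>c R U S. 0 \<le> R \<longrightarrow> S \<in> sets borel \<longrightarrow> emeasure lborel S < \<infinity> \<longrightarrow>
      (\<forall>u e b. u \<in> U \<longrightarrow> norm e < \<delta> \<longrightarrow> norm b \<le> r \<longrightarrow> (\<forall>v\<in>V. orthogonal b v) \<longrightarrow> u + b + e \<in> S) \<longrightarrow>
      finite {y \<in> L. fst y \<in> ball c R \<and> snd y \<in> U} \<and>
      \<kappa> * real (card {y \<in> L. fst y \<in> ball c R \<and> snd y \<in> U})
        \<le> unit_ball_vol (real ?d) * (R + R1) ^ ?d * measure lborel S"
    using lattice_point_count[OF L V] by blast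
  let ?\<omega> = "unit_ball_vol (real ?d)"
  have om: "0 < ?\<omega>" by simp
  have img: "cps W L \<inter> ball c R = fst ` {y \<in> L. fst y \<in> ball c R \<and> snd y \<in> W}" for c R
    by (auto simp: cps_def)
  obtain b0 where b0: "\<And>x. x \<in> W \<Longrightarrow> norm x \<le> b0" "0 < b0" using Wb unfolding bounded_pos by blast
  obtain R1 where R1: "0 < R1" and c1: "\<And>c R. 0 \<le> R \<Longrightarrow> finite {y \<in> L. fst y \<in> ball c R \<and> snd y \<in> W} \<and>
      \<kappa> * real (card {y \<in> L. fst y \<in> ball c R \<and> snd y \<in> W})
        \<le> ?\<omega> * (R + R1) ^ ?d * measure lborel (ball (0::real^'m) (b0 + r + 1))"
  proof -
    obtain R1 where R1: "R1 > 0" and c1: "\<forall>c R U S. 0 \<le> R \<longrightarrow> S \<in> sets borel \<longrightarrow> emeasure lborel S < \<infinity> \<longrightarrow>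
      (\<forall>u e b. u \<in> U \<longrightarrow> norm e < 1 \<longrightarrow> norm b \<le> r \<longrightarrow> (\<forall>v\<in>V. orthogonal b v) \<longrightarrow> u + b + e \<in> S) \<longrightarrow>
      finite {y \<in> L. fst y \<in> ball c R \<and> snd y \<in> U} \<and>
      \<kappa> * real (card {y \<in> L. fst y \<in> ball c R \<and> snd y \<in> U}) \<le> ?\<omega> * (R + R1) ^ ?d * measure lborel S"
      using cnt[of 1] by auto
    have "u + b + e \<in> ball 0 (b0 + r + 1)" if "u \<in> W" "norm e < 1" "norm b \<le> r" for u b e
      using b0(1)[OF that(1)] that norm_triangle_ineq[of "u + b" e] norm_triangle_ineq[of u b] by simp
    then show ?thesis
      by (intro that[OF R1] c1[rule_format, where S = "ball 0 (b0 + r + 1)"] emeasure_lborel_ball_finite) auto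
  qed
  \<comment> \<open>The window thickened by \<open>r\<close> and 1 lies in the ball of radius
    \<open>b0 + r + 1\<close>, and \<open>R + R1 \<le> (1 + R1) * R\<close> for
    \<open>R \<ge> 1\<close>.\<close>
  define C0 where "C0 = ?\<omega> * (1 + R1) ^ ?d * measure lborel (ball (0::real^'m) (b0 + r + 1)) / \<kappa>"
  have "almost_periodic_points (cps W L) C0"
  proof
    fix R :: real and c :: "real^'d" assume R: "1 \<le> R"
    show "finite (cps W L \<inter> ball c R)" unfolding img using c1[of R c] R by simp
    have "\<kappa> * real (card (cps W L \<inter> ball c R)) \<le> \<kappa> * real (card {y \<in> L. fst y \<in> ball c R \<and> snd y \<in> W})"
      unfolding img using kap c1[of R c] R by (intro mult_left_mono of_nat_mono card_image_le) auto
    also have "\<dots> \<le> ?\<omega> * (R + R1) ^ ?d * measure lborel (ball (0::real^'m) (b0 + r + 1))" using c1[of R c] R by simp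
    also have "\<dots> \<le> ?\<omega> * ((1 + R1) * R) ^ ?d * measure lborel (ball (0::real^'m) (b0 + r + 1))"
    proof (intro mult_right_mono mult_left_mono power_mono)
      show "R + R1 \<le> (1 + R1) * R" using R R1 mult_left_mono[of 1 R R1] by (simp add: distrib_right)
    qed (use R R1 om in auto)
    finally have "\<kappa> * real (card (cps W L \<inter> ball c R)) \<le> \<kappa> * (C0 * R ^ ?d)"
      using kap unfolding C0_def power_mult_distrib by (simp add: mult_ac)
    then show "real (card (cps W L \<inter> ball c R)) \<le> C0 * R ^ ?d" using kap by simp
  next
    fix \<epsilon> :: real assume eps: "0 < \<epsilon>"
    define fr where "fr = (top_of_set ?A) frontier_of W"
    \<comment> \<open>Truncating the orthogonal complement at radius \<open>r\<close> makes
      \<open>X\<close> compact while keeping it inside the null cylinder of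
      \<open>haar_A_null\<close>.\<close>
    define Q where "Q = {b. norm b \<le> r \<and> (\<forall>v\<in>V. orthogonal b v)}"
    define X where "X = {a + b | a b. a \<in> fr \<and> b \<in> Q}"
    have "closedin (top_of_set ?A) fr" unfolding fr_def by (rule closedin_frontier_of)
    then have "closed fr" by (rule closedin_closed_trans) simp
    moreover have "fr \<subseteq> cball 0 b0"
    proof -
      have "fr \<subseteq> (top_of_set ?A) closure_of W" by (simp add: fr_def frontier_of_def)
      also have "\<dots> \<subseteq> closure W" by (simp add: closure_of_subtopology) (meson Int_lower2 closure_mono order_trans inf_le2 inf_le1)
      also have "\<dots> \<subseteq> cball 0 b0" using b0(1) by (intro closure_minimal) auto
      finally show ?thesis .
    qed
    ultimately have frc: "compact fr" using bounded_subset[OF bounded_cball] compact_eq_bounded_closed by blast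
    have Qc: "compact Q"
    proof -
      have "Q = cball 0 r \<inter> (\<Inter>v\<in>V. {b. b \<bullet> v = 0})" by (auto simp: Q_def orthogonal_def)
      moreover have "closed (\<Inter>v\<in>V. {b. b \<bullet> v = 0})"
        by (intro closed_INT ballI closed_Collect_eq continuous_intros)
      ultimately show ?thesis by (simp add: compact_Int_closed)
    qed
    have Xc: "compact X" unfolding X_def using compact_sums[OF frc Qc] by simp
    have "X \<subseteq> {a + b | a b. a \<in> fr \<and> b \<in> orthogonal_comp (cps_A0 L)}"
    proof -
      have "cps_A0 L \<subseteq> V" unfolding V_def cps_A0_def cps_A_def
        using zero connected_component_refl_eq by (intro connected_subset_line_space) (auto simp: connected_component_subset connected_component_in)
      then have "Q \<subseteq> orthogonal_comp (cps_A0 L)"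
        unfolding Q_def orthogonal_comp_def by (auto simp: orthogonal_commute)
      then show ?thesis unfolding X_def by blast
    qed
    then have Xn: "X \<in> null_sets lebesgue"
      using null unfolding haar_A_null_def fr_def[symmetric] by (rule null_sets_completion_subset)
    \<comment> \<open>\<open>\<kappa>\<close> is fixed before \<open>\<epsilon>\<close>, so the
      admissible volume can be chosen in terms of it. The factor \<open>2 ^ ?d\<close> pays for
      \<open>R + R2 \<le> 2 * R\<close>.\<close>
    define e where "e = \<epsilon> * \<kappa> / (2 ^ ?d * ?\<omega>)"
    have e: "0 < e" using eps kap om by (simp add: e_def)
    obtain U \<delta> where U: "open U" "emeasure lborel U < \<infinity>" "measure lborel U \<le> e" and del: "0 < \<delta>"
      and XU: "\<And>x y. x \<in> X \<Longrightarrow> dist x y < \<delta> \<Longrightarrow> y \<in> U"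
      using compact_null_open_superset[OF Xc Xn e] by metis
    \<comment> \<open>One half of \<open>\<delta>\<close> is for the distance to the frontier, the
      other for the thickening in \<open>lattice_point_count\<close>; the bound \<open>g\<close>
      forces small internal parts into \<open>V\<close>.\<close>
    define \<delta>' where "\<delta>' = min (\<delta> / 2) g"
    have del': "0 < \<delta>'" "\<delta>' \<le> \<delta> / 2" "\<delta>' \<le> g" using del g(1) by (auto simp: \<delta>'_def)
    define Fr where "Fr = {x. \<exists>f\<in>fr. dist x f < \<delta>'}"
    obtain R2 where R2: "R2 > 0" and c2': "\<forall>c R U S. 0 \<le> R \<longrightarrow> S \<in> sets borel \<longrightarrow> emeasure lborel S < \<infinity> \<longrightarrow>
      (\<forall>u e b. u \<in> U \<longrightarrow> norm e < \<delta>' \<longrightarrow> norm b \<le> r \<longrightarrow> (\<forall>v\<in>V. orthogonal b v) \<longrightarrow> u + b + e \<in> S) \<longrightarrow>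
      finite {y \<in> L. fst y \<in> ball c R \<and> snd y \<in> U} \<and>
      \<kappa> * real (card {y \<in> L. fst y \<in> ball c R \<and> snd y \<in> U}) \<le> ?\<omega> * (R + R2) ^ ?d * measure lborel S"
      using cnt[OF del'(1)] by auto
    have FrU: "u + b + e' \<in> U" if u: "u \<in> Fr" and "norm e' < \<delta>'" "norm b \<le> r" "\<forall>v\<in>V. orthogonal b v" for u b e'
    proof -
      obtain f where f: "f \<in> fr" "dist u f < \<delta>'" using u by (auto simp: Fr_def)
      have "f + b \<in> X" using f(1) that by (auto simp: X_def Q_def)
      moreover have "dist (f + b) (u + b + e') < \<delta>"
      proof -
        have "dist (f + b) (u + b + e') = norm ((u - f) + e')" by (simp add: dist_norm norm_minus_commute algebra_simps)
        also have "\<dots> \<le> norm (u - f) + norm e'" by (rule norm_triangle_ineq)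
        also have "\<dots> < \<delta>" using f(2) that del'(2) by (simp add: dist_norm)
        finally show ?thesis .
      qed
      ultimately show ?thesis by (rule XU)
    qed
    have c2: "finite {y \<in> L. fst y \<in> ball c R \<and> snd y \<in> Fr} \<and>
      \<kappa> * real (card {y \<in> L. fst y \<in> ball c R \<and> snd y \<in> Fr}) \<le> ?\<omega> * (R + R2) ^ ?d * e" if "0 \<le> R" for c R
    proof -
      have "finite {y \<in> L. fst y \<in> ball c R \<and> snd y \<in> Fr} \<and>
        \<kappa> * real (card {y \<in> L. fst y \<in> ball c R \<and> snd y \<in> Fr}) \<le> ?\<omega> * (R + R2) ^ ?d * measure lborel U"
        by (rule c2'[rule_format, where S = U]) (use that U(1,2) FrU in auto)
      moreover have "?\<omega> * (R + R2) ^ ?d * measure lborel U \<le> ?\<omega> * (R + R2) ^ ?d * e"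
        using U(3) that R2 by (intro mult_left_mono) auto
      ultimately show ?thesis by linarith
    qed
    have gap': "a \<in> V" if "a \<in> ?A" "norm a < \<delta>'" for a using g(2)[OF that(1)] that(2) del'(3) by simp
    obtain R3 where R3: "\<And>c. \<exists>y\<in>L. snd y \<in> V \<and> norm (snd y) < \<delta>' \<and> dist c (fst y) \<le> R3"
      using lattice_near_periods[OF L del'(1) gap'] by blast
    define Y where "Y = fst ` {y \<in> L. snd y \<in> V \<and> norm (snd y) < \<delta>'}"
    have small: "real (card (shift_diff (cps W L) y \<inter> ball c R)) \<le> \<epsilon> * R ^ ?d"
      if y: "y \<in> Y" and R: "max 1 R2 \<le> R" for y c R
    proof -
      obtain z where z: "z \<in> L" "snd z \<in> V" "norm (snd z) < \<delta>'" "y = fst z" using y by (auto simp: Y_def)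
      let ?S = "{x \<in> L. fst x \<in> ball c R \<and> snd x \<in> Fr}"
      have fS: "finite ?S" and cS: "\<kappa> * real (card ?S) \<le> ?\<omega> * (R + R2) ^ ?d * e"
        using conjunct1[OF c2[of R c]] conjunct2[OF c2[of R c]] R by linarith+
      have sub: "shift_diff (cps W L) y \<inter> ball c R \<subseteq> fst ` ?S"
      proof
        fix p assume p: "p \<in> shift_diff (cps W L) y \<inter> ball c R"
        have key: "p \<in> fst ` ?S" if x: "x \<in> L" "fst x = p" and ne: "(snd x \<in> W) \<noteq> (snd x + snd z \<in> W)" for x
        proof -
          have "snd x \<in> ?A" using x(1) closure_subset[of "snd ` L"] by blast
          then obtain f where "f \<in> fr" "dist (snd x) f \<le> norm (snd z)"
            using frontier_near_translate[OF sg _ z(2)[unfolded V_def] ne] unfolding fr_def by blast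
          then have "snd x \<in> Fr" using z(3) unfolding Fr_def by force
          then show ?thesis using x p by auto
        qed
        show "p \<in> fst ` ?S"
        proof (cases "p \<in> cps W L")
          case True
          then obtain x where x: "x \<in> L" "snd x \<in> W" "p = fst x" by (auto simp: cps_def)
          have "p + y \<notin> cps W L" using p True by (auto simp: shift_diff_def)
          moreover have "x + z \<in> L" using x z full_rank_lattice_subgroup(2)[OF L] by blast
          ultimately have "snd x + snd z \<notin> W" using x z unfolding cps_def by force
          then show ?thesis using key[of x] x by blast
        next
          case False
          then have "p + y \<in> cps W L" using p by (auto simp: shift_diff_def)
          then obtain x where x: "x \<in> L" "snd x \<in> W" "p + y = fst x" by (auto simp: cps_def)
          have xz: "x - z \<in> L" "fst (x - z) = p"
            using x z full_rank_lattice_subgroup(4)[OF L] by (auto simp: diff_eq_eq)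
          then have "snd (x - z) \<notin> W" using False unfolding cps_def by blast
          then show ?thesis using key[OF xz] x(2) by simp
        qed
      qed
      have "\<kappa> * real (card (shift_diff (cps W L) y \<inter> ball c R)) \<le> \<kappa> * real (card ?S)"
        using surj_card_le[OF fS sub] kap by (intro mult_left_mono of_nat_mono) auto
      also have "\<dots> \<le> ?\<omega> * (R + R2) ^ ?d * e" by (rule cS)
      also have "\<dots> \<le> ?\<omega> * (2 * R) ^ ?d * e" using R R2 e om by (intro mult_right_mono mult_left_mono power_mono) auto
      also have "\<dots> = \<kappa> * (\<epsilon> * R ^ ?d)"
      proof -
        have "?\<omega> * (2 * R) ^ ?d * e = (?\<omega> * 2 ^ ?d * e) * R ^ ?d" by (simp only: power_mult_distrib mult_ac)
        also have "?\<omega> * 2 ^ ?d * e = \<kappa> * \<epsilon>" using less_imp_neq[OF om] unfolding e_def by simp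
        finally show ?thesis by (simp only: mult.assoc)
      qed
      finally show ?thesis using kap by (simp only: mult_le_cancel_left_pos)
    qed
    have rd: "\<exists>y\<in>Y. dist c y \<le> R3" for c unfolding Y_def using R3[of c] by blast
    show "\<exists>Y R1 R0. 1 \<le> R0 \<and> (\<forall>c. \<exists>y\<in>Y. dist c y \<le> R1) \<and>
      (\<forall>y\<in>Y. \<forall>c. \<forall>R\<ge>R0. real (card (shift_diff (cps W L) y \<inter> ball c R)) \<le> \<epsilon> * R ^ ?d)"
    proof (rule exI[of _ Y], rule exI[of _ R3], rule exI[of _ "max 1 R2"], intro conjI allI ballI impI)
      show "1 \<le> max 1 R2" by (rule max.cobounded1)
    qed (rule rd, rule small)
  qed
  then show ?thesis by (rule that)
qed

section \<open>Uniform almost periodicity\<close>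

locale weighted_points = almost_periodic_points P C0
  for P :: "'a::euclidean_space set" and C0 :: real +
  fixes b :: "'a \<Rightarrow> real" and K M :: real
  assumes dim: "2 \<le> DIM('a)"
    and b_measurable [measurable]: "b \<in> borel_measurable borel"
    and b_nonneg: "0 \<le> b x" and b_le_1: "b x \<le> 1"
    and b_Lipschitz: "\<bar>b x - b y\<bar> \<le> K * norm (x - y)"
    and b_support: "M < norm x \<Longrightarrow> b x = 0" and M_pos: "0 < M"
begin

definition G :: "real \<Rightarrow> real \<Rightarrow> 'a \<Rightarrow> real" where
  "G \<rho> l q = (\<integral>x. b x * free_ind P \<rho> l q x \<partial>lborel)"

text \<open>The radius \<open>sqrt \<rho>\<close> balances two needs. From outside, a scatterer
  covers at most an angle of order \<open>\<rho> / sqrt \<rho>\<close>, which tends to 0; the set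
  itself has density of order \<open>sqrt \<rho> ^ d \<le> \<rho>\<close>, which is summable along
  \<open>rho\<close>.\<close>

definition near_P :: "real \<Rightarrow> 'a set" where
  "near_P \<rho> = {q. \<exists>p\<in>P. dist p q < sqrt \<rho>}"

lemma G_measurable [measurable]: "G \<rho> l \<in> borel_measurable borel"
  unfolding G_def by measurable

lemma b_free_ind_bounds: "0 \<le> b x * free_ind P \<rho> l q x" "b x * free_ind P \<rho> l q x \<le> 1"
  using b_nonneg[of x] b_le_1[of x] free_ind_bounds[of P \<rho> l q x] by (auto intro: mult_le_one)

lemma b_zero: "x \<notin> cball 0 (M + 1) \<Longrightarrow> b x = 0" using b_support[of x] by auto

lemma integrable_b_free_ind: "integrable lborel (\<lambda>x. b x * free_ind P \<rho> l q x)"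
  by (rule integrable_bounded_support(1)[of _ 1 0 "M + 1"]) (use b_free_ind_bounds b_zero in \<open>auto simp: abs_le_iff\<close>)

lemma integrable_b: "integrable lborel b"
  by (rule integrable_bounded_support(1)[of _ 1 0 "M + 1"]) (use b_nonneg b_le_1 b_zero in \<open>auto simp: abs_le_iff\<close>)

lemma G_nonneg: "0 \<le> G \<rho> l q"
  unfolding G_def by (intro Bochner_Integration.integral_nonneg) (rule b_free_ind_bounds)

lemma G_le: "G \<rho> l q \<le> measure lborel (cball (0::'a) (M + 1))"
  using integrable_bounded_support(2)[of "\<lambda>x. b x * free_ind P \<rho> l q x" 1 0 "M + 1"] b_free_ind_bounds[of _ \<rho> l q] b_zero
  by (auto simp: G_def abs_le_iff)

lemma C0_nonneg: "0 \<le> C0"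
  using count[of 1 0] by simp

lemma finite_P_ball: "finite (P \<inter> ball c R)"
  by (rule finite_subset[OF _ finite_count[of "max 1 R" c]]) auto

lemma shift_diff_subset: "shift_diff P y \<inter> ball c R \<subseteq> (P \<inter> ball c R) \<union> (\<lambda>p. p - y) ` (P \<inter> ball (c + y) R)"
proof
  fix p assume p: "p \<in> shift_diff P y \<inter> ball c R"
  have "p \<in> (\<lambda>p. p - y) ` (P \<inter> ball (c + y) R)" if "p + y \<in> P"
    using p that by (intro image_eqI[of _ _ "p + y"]) auto
  then show "p \<in> (P \<inter> ball c R) \<union> (\<lambda>p. p - y) ` (P \<inter> ball (c + y) R)" using p by (auto simp: shift_diff_def)
qed

lemma finite_shift_diff: "finite (shift_diff P y \<inter> ball c R)"
  by (rule finite_subset[OF shift_diff_subset]) (simp add: finite_P_ball)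

lemma card_shift_diff:
  assumes "1 \<le> R" shows "real (card (shift_diff P y \<inter> ball c R)) \<le> 2 * C0 * R ^ DIM('a)"
proof -
  have "card (shift_diff P y \<inter> ball c R) \<le> card (P \<inter> ball c R) + card ((\<lambda>p. p - y) ` (P \<inter> ball (c + y) R))"
    using card_mono[OF _ shift_diff_subset] card_Un_le finite_P_ball by (meson finite_UnI finite_imageI order_trans)
  also have "\<dots> \<le> card (P \<inter> ball c R) + card (P \<inter> ball (c + y) R)"
    by (simp add: card_image_le finite_P_ball)
  finally show ?thesis using count[OF assms, of c] count[OF assms, of "c + y"] by simp
qed

text \<open>The indicators differ at \<open>x\<close> only if its direction hits a point of
  \<open>shift_diff P y\<close> within distance \<open>l + \<rho>\<close>, so the difference is at
  most the sum of the angular sizes of these points. Those nearer than \<open>R0\<close> are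
  boundedly many and at distance at least \<open>sqrt \<rho>\<close>, which gives the first term;
  the others are summed over dyadic shells. For \<open>l = \<xi> / \<rho> ^ (d - 1)\<close> the
  second term tends to a multiple of \<open>\<epsilon> * \<xi>\<close>.\<close>

lemma G_almost_period:
  assumes rho: "0 < \<rho>" "\<rho> \<le> 1 / 4" and l: "0 < l" and R0: "1 \<le> R0" and eps: "0 \<le> \<epsilon>"
    and ap: "\<And>c R. R0 \<le> R \<Longrightarrow> real (card (shift_diff P y \<inter> ball c R)) \<le> \<epsilon> * R ^ DIM('a)"
    and q: "q \<notin> near_P \<rho>" "q + y \<notin> near_P \<rho>"
  shows "\<bar>G \<rho> l q - G \<rho> l (q + y)\<bar>
    \<le> unit_ball_vol (real DIM('a)) * (4 * M) ^ DIM('a) * (2 * C0 * R0 ^ DIM('a) * sqrt \<rho> + \<epsilon> * 2 ^ DIM('a) * 2 * (\<rho> ^ (DIM('a) - 1) * (l + \<rho> + R0)))"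
proof -
  let ?d = "DIM('a)"
  define Z where "Z = shift_diff P y \<inter> ball q (l + \<rho>)"
  have finZ: "finite Z" unfolding Z_def by (rule finite_shift_diff)
  define S where "S p = {x \<in> cball 0 M. \<exists>t>0. dist (q + t *\<^sub>R sgn x) p < \<rho>}" for p
  have far: "sqrt \<rho> \<le> dist p q" if "p \<in> shift_diff P y" for p
  proof (cases "p \<in> P")
    case True then show ?thesis using q(1) by (auto simp: near_P_def)
  next
    case False
    then have "p + y \<in> P" using that by (auto simp: shift_diff_def)
    then have "sqrt \<rho> \<le> dist (p + y) (q + y)" using q(2) unfolding near_P_def by force
    then show ?thesis by simp
  qed
  \<comment> \<open>\<open>measure_cone_le\<close> asks for a distance of at least
    \<open>2 * \<rho>\<close>; with \<open>\<rho> \<le> 1 / 4\<close> this is implied by being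
    outside \<open>near_P\<close>.\<close>
  have sq: "2 * \<rho> \<le> sqrt \<rho>"
  proof (rule real_le_rsqrt)
    have "4 * \<rho> * \<rho> \<le> 1 * \<rho>" using rho by (intro mult_right_mono) auto
    then show "(2 * \<rho>)\<^sup>2 \<le> \<rho>" by (simp add: power2_eq_square)
  qed
  have sgm: "(sgn :: 'a \<Rightarrow> 'a) \<in> borel_measurable borel"
    unfolding sgn_div_norm[abs_def] by measurable
  have Sm: "S p \<in> sets borel" for p
  proof -
    have "open {v. \<exists>t>0. dist (q + t *\<^sub>R v) p < \<rho>}"
    proof -
      have "{v. \<exists>t>0. dist (q + t *\<^sub>R v) p < \<rho>} = (\<Union>t\<in>{0<..}. {v. dist (q + t *\<^sub>R v) p < \<rho>})" by auto
      moreover have "open \<dots>" by (intro open_UN ballI open_Collect_less continuous_intros)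
      ultimately show ?thesis by simp
    qed
    then have "sgn -` {v. \<exists>t>0. dist (q + t *\<^sub>R v) p < \<rho>} \<inter> space borel \<in> sets (borel :: 'a measure)"
      by (intro measurable_sets[OF sgm]) simp
    moreover have "S p = cball 0 M \<inter> (sgn -` {v. \<exists>t>0. dist (q + t *\<^sub>R v) p < \<rho>} \<inter> space borel)" by (auto simp: S_def)
    ultimately show ?thesis by simp
  qed
  have Sfm: "S p \<in> fmeasurable lborel" for p
    by (rule fmeasurableI2[of "cball 0 M"]) (use Sm in \<open>auto simp: S_def fmeasurable_def emeasure_lborel_cball_finite[simplified]\<close>)
  have UZ: "(\<Union>p\<in>Z. S p) \<in> fmeasurable lborel" using finZ Sfm by (intro fmeasurable.finite_UN) auto
  have pt: "\<bar>b x * free_ind P \<rho> l q x - b x * free_ind P \<rho> l (q + y) x\<bar> \<le> indicator (\<Union>p\<in>Z. S p) x" for x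
  proof (cases "b x = 0 \<or> free_ind P \<rho> l q x = free_ind P \<rho> l (q + y) x")
    case True then show ?thesis by (auto simp: indicator_def)
  next
    case False
    have xM: "x \<in> cball 0 M" using False b_support[of x] by force
    have "tube_free P \<rho> l q (sgn x) \<noteq> tube_free P \<rho> l (q + y) (sgn x)" using False by (auto simp: free_ind_def)
    then have "\<exists>t p. 0 < t \<and> t < l \<and> p \<in> shift_diff P y \<and> dist (q + t *\<^sub>R sgn x) p < \<rho>"
    proof (cases "tube_free P \<rho> l q (sgn x)")
      case True
      moreover assume "tube_free P \<rho> l q (sgn x) \<noteq> tube_free P \<rho> l (q + y) (sgn x)"
      ultimately have "\<not> tube_free P \<rho> l (q + y) (sgn x)" by simp
      then obtain t p where tp: "0 < t" "t < l" "p \<in> P" "dist (q + y + t *\<^sub>R sgn x) p < \<rho>" by (auto simp: tube_free_def not_le)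
      have "dist (q + t *\<^sub>R sgn x) (p - y) < \<rho>" using tp(4) by (simp add: dist_norm algebra_simps)
      moreover from this have "p - y \<notin> P" using True tp(1,2) by (force simp: tube_free_def)
      ultimately show ?thesis using tp by (intro exI[of _ t] exI[of _ "p - y"]) (auto simp: shift_diff_def)
    next
      case False
      assume "tube_free P \<rho> l q (sgn x) \<noteq> tube_free P \<rho> l (q + y) (sgn x)"
      with False have T: "tube_free P \<rho> l (q + y) (sgn x)" by simp
      from False obtain t p where tp: "0 < t" "t < l" "p \<in> P" "dist (q + t *\<^sub>R sgn x) p < \<rho>" by (auto simp: tube_free_def not_le)
      have "dist (q + y + t *\<^sub>R sgn x) (p + y) < \<rho>" using tp(4) by (simp add: dist_norm algebra_simps)
      then have "p + y \<notin> P" using T tp(1,2) by (force simp: tube_free_def)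
      then show ?thesis using tp by (intro exI[of _ t] exI[of _ p]) (auto simp: shift_diff_def)
    qed
    then obtain t p where tp: "0 < t" "t < l" "p \<in> shift_diff P y" "dist (q + t *\<^sub>R sgn x) p < \<rho>" by blast
    have "norm (sgn x) \<le> 1" by (simp add: norm_sgn)
    then have "dist q (q + t *\<^sub>R sgn x) \<le> t" using tp(1) by (simp add: dist_norm mult_left_le)
    then have "dist q p < l + \<rho>" using dist_triangle[of q p "q + t *\<^sub>R sgn x"] tp(2,4) by linarith
    then have "x \<in> (\<Union>p\<in>Z. S p)" using tp xM by (auto simp: Z_def S_def)
    then show ?thesis using b_free_ind_bounds[of x \<rho> l q] b_free_ind_bounds[of x \<rho> l "q + y"] by (simp add: abs_le_iff)
  qed
  have "\<bar>G \<rho> l q - G \<rho> l (q + y)\<bar> = \<bar>\<integral>x. b x * free_ind P \<rho> l q x - b x * free_ind P \<rho> l (q + y) x \<partial>lborel\<bar>"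
    unfolding G_def by (simp add: integrable_b_free_ind)
  also have "\<dots> \<le> (\<integral>x. \<bar>b x * free_ind P \<rho> l q x - b x * free_ind P \<rho> l (q + y) x\<bar> \<partial>lborel)" by (rule integral_abs_bound)
  also have "\<dots> \<le> (\<integral>x. indicator (\<Union>p\<in>Z. S p) x \<partial>lborel)"
    using UZ by (intro integral_mono pt integrable_real_indicator integrable_abs Bochner_Integration.integrable_diff integrable_b_free_ind)
      (auto simp: fmeasurable_def)
  also have "\<dots> = measure lborel (\<Union>p\<in>Z. S p)" by simp
  also have "\<dots> \<le> (\<Sum>p\<in>Z. measure lborel (S p))" using finZ Sm by (intro measure_UNION_le) auto
  also have "\<dots> \<le> (\<Sum>p\<in>Z. unit_ball_vol (real DIM('a)) * (4 * M) ^ ?d * (\<rho> / dist p q) ^ (?d - 1))"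
    unfolding S_def using far sq rho M_pos dim by (intro sum_mono measure_cone_le) (auto simp: Z_def intro: order_trans)
  also have "\<dots> = unit_ball_vol (real DIM('a)) * (4 * M) ^ ?d * (\<Sum>p\<in>Z. (\<rho> / dist p q) ^ (?d - 1))" by (simp add: sum_distrib_left)
  also have "\<dots> \<le> unit_ball_vol (real DIM('a)) * (4 * M) ^ ?d * (2 * C0 * R0 ^ ?d * sqrt \<rho> + \<epsilon> * 2 ^ ?d * 2 * (\<rho> ^ (?d - 1) * (l + \<rho> + R0)))"
  proof (rule mult_left_mono)
    let ?A = "{p \<in> Z. dist p q < R0}" and ?B = "{p \<in> Z. R0 \<le> dist p q}"
    have "(\<Sum>p\<in>Z. (\<rho> / dist p q) ^ (?d - 1)) = (\<Sum>p\<in>?A. (\<rho> / dist p q) ^ (?d - 1)) + (\<Sum>p\<in>?B. (\<rho> / dist p q) ^ (?d - 1))"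
      using finZ by (subst sum.union_disjoint[symmetric]) (auto intro!: sum.cong)
    also have "(\<Sum>p\<in>?A. (\<rho> / dist p q) ^ (?d - 1)) \<le> (\<Sum>p\<in>?A. sqrt \<rho>)"
    proof (rule sum_mono)
      fix p assume "p \<in> ?A"
      then have f: "sqrt \<rho> \<le> dist p q" using far by (auto simp: Z_def)
      have sp: "0 < sqrt \<rho>" using rho by simp
      have "\<rho> / dist p q \<le> \<rho> / sqrt \<rho>" using f rho sp less_le_trans[OF sp f] by (intro divide_left_mono mult_pos_pos) auto
      also have "\<dots> = sqrt \<rho>" using rho by (simp add: real_div_sqrt)
      finally have "(\<rho> / dist p q) ^ (?d - 1) \<le> sqrt \<rho> ^ (?d - 1)" using rho by (intro power_mono) auto
      also have "\<dots> \<le> sqrt \<rho> ^ 1" using rho dim by (intro power_decreasing) auto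
      finally show "(\<rho> / dist p q) ^ (?d - 1) \<le> sqrt \<rho>" by simp
    qed
    also have "(\<Sum>p\<in>?A. sqrt \<rho>) = real (card ?A) * sqrt \<rho>" by simp
    also have "\<dots> \<le> 2 * C0 * R0 ^ ?d * sqrt \<rho>"
    proof (rule mult_right_mono)
      have "card ?A \<le> card (shift_diff P y \<inter> ball q R0)"
        by (intro card_mono finite_shift_diff) (auto simp: Z_def dist_commute)
      also have "real \<dots> \<le> 2 * C0 * R0 ^ ?d" by (rule card_shift_diff[OF R0])
      finally show "real (card ?A) \<le> 2 * C0 * R0 ^ ?d" by simp
    qed (use rho in auto)
    also have "(\<Sum>p\<in>?B. (\<rho> / dist p q) ^ (?d - 1)) = \<rho> ^ (?d - 1) * (\<Sum>p\<in>?B. (1 / dist p q) ^ (?d - 1))"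
      by (simp add: sum_distrib_left power_divide)
    also have "\<dots> \<le> \<rho> ^ (?d - 1) * (\<epsilon> * 2 ^ ?d * (2 * (l + \<rho> + R0)))"
    proof (rule mult_left_mono)
      \<comment> \<open>Enough shells to reach distance \<open>l + \<rho>\<close>; the upper bound
        on \<open>2 ^ J\<close> keeps the outermost radius comparable to
        \<open>l + \<rho> + R0\<close>.\<close>
      obtain J where J: "(l + \<rho>) / R0 \<le> 2 ^ J" "2 ^ J \<le> 2 * max 1 ((l + \<rho>) / R0)" using ex_power_two_between by blast
      have "(\<Sum>p\<in>?B. (1 / dist p q) ^ (?d - 1)) \<le> \<epsilon> * 2 ^ ?d * (2 ^ J * R0)"
      proof (rule dyadic_shell_sum)
        fix R assume R: "R0 \<le> R"
        have "card {p \<in> ?B. dist p q < R} \<le> card (shift_diff P y \<inter> ball q R)"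
          by (intro card_mono finite_shift_diff) (auto simp: Z_def dist_commute)
        then show "real (card {p \<in> ?B. dist p q < R}) \<le> \<epsilon> * R ^ ?d" using ap[OF R, of q] by linarith
      next
        fix p assume "p \<in> ?B"
        then have "dist p q < l + \<rho>" by (auto simp: Z_def dist_commute)
        also have "\<dots> \<le> 2 ^ J * R0" using J(1) R0 by (simp add: divide_le_eq)
        finally show "dist p q < 2 ^ J * R0" .
      qed (use finZ dim R0 eps in auto)
      also have "\<dots> \<le> \<epsilon> * 2 ^ ?d * (2 * (l + \<rho> + R0))"
      proof (rule mult_left_mono)
        have "2 ^ J * R0 \<le> 2 * max 1 ((l + \<rho>) / R0) * R0" using J(2) R0 by (intro mult_right_mono) auto
        also have "\<dots> = 2 * max R0 (l + \<rho>)" using R0 by (auto simp: max_def divide_le_eq le_divide_eq)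
        also have "\<dots> \<le> 2 * (l + \<rho> + R0)" using R0 l rho by (simp add: max_def)
        finally show "2 ^ J * R0 \<le> 2 * (l + \<rho> + R0)" .
      qed (use eps in auto)
      finally show "(\<Sum>p\<in>?B. (1 / dist p q) ^ (?d - 1)) \<le> \<epsilon> * 2 ^ ?d * (2 * (l + \<rho> + R0))" .
    qed (use rho in auto)
    finally show "(\<Sum>p\<in>Z. (\<rho> / dist p q) ^ (?d - 1)) \<le> 2 * C0 * R0 ^ ?d * sqrt \<rho> + \<epsilon> * 2 ^ ?d * 2 * (\<rho> ^ (?d - 1) * (l + \<rho> + R0))"
      by (simp only: mult_ac)
  qed (use M_pos in auto)
  finally show ?thesis .
qed

lemma near_P_open: "open (near_P \<rho>)"
proof -
  have "near_P \<rho> = (\<Union>p\<in>P. ball p (sqrt \<rho>))" by (auto simp: near_P_def)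
  then show ?thesis by (simp only:) (intro open_UN ballI open_ball)
qed

lemma near_P_measurable [measurable]: "near_P \<rho> \<in> sets borel"
  using near_P_open by (rule borel_open)

lemma near_P_measure:
  assumes rho: "0 < \<rho>" "\<rho> \<le> 1" and R: "0 \<le> R"
  shows "measure lborel {q \<in> ball c R. q + h \<in> near_P \<rho>} \<le> C0 * (R + 1) ^ DIM('a) * unit_ball_vol (real DIM('a)) * \<rho>"
proof -
  have sq: "sqrt \<rho> \<le> 1" using rho by simp
  have "measure lborel {q \<in> ball c R. q + h \<in> near_P \<rho>} \<le> real (card (P \<inter> ball (c + h) (R + 1))) * (unit_ball_vol (real DIM('a)) * sqrt \<rho> ^ DIM('a))"
  proof (rule measure_le_cover_balls)
    show "{q \<in> ball c R. q + h \<in> near_P \<rho>} \<subseteq> (\<Union>p\<in>P \<inter> ball (c + h) (R + 1). ball (p - h) (sqrt \<rho>))"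
    proof
      fix q assume "q \<in> {q \<in> ball c R. q + h \<in> near_P \<rho>}"
      then obtain p where p: "p \<in> P" "dist p (q + h) < sqrt \<rho>" and q: "dist c q < R" by (auto simp: near_P_def)
      have "dist (c + h) p \<le> dist (c + h) (q + h) + dist (q + h) p" by (rule dist_triangle)
      also have "\<dots> < R + 1" using p(2) q sq by (simp add: dist_commute del: real_sqrt_le_1_iff)
      finally have "p \<in> P \<inter> ball (c + h) (R + 1)" using p(1) by simp
      moreover have "q \<in> ball (p - h) (sqrt \<rho>)" using p(2) by (simp add: dist_norm algebra_simps)
      ultimately show "q \<in> (\<Union>p\<in>P \<inter> ball (c + h) (R + 1). ball (p - h) (sqrt \<rho>))" by blast
    qed
  qed (use rho finite_P_ball in auto)
  also have "\<dots> \<le> (C0 * (R + 1) ^ DIM('a)) * (unit_ball_vol (real DIM('a)) * \<rho>)"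
  proof (rule mult_mono)
    have "sqrt \<rho> ^ DIM('a) \<le> sqrt \<rho> ^ 2" using rho dim by (intro power_decreasing) auto
    then show "unit_ball_vol (real DIM('a)) * sqrt \<rho> ^ DIM('a) \<le> unit_ball_vol (real DIM('a)) * \<rho>" using rho by (intro mult_left_mono) auto
  qed (use count[of "R + 1"] R C0_nonneg rho in auto)
  finally show ?thesis by simp
qed

text \<open>Moving along the velocity by \<open>T * norm x\<close> changes the tube only at its two
  ends, over a length of at most \<open>s\<close>: the indicators can differ only if a point of
  \<open>P\<close> is hit for \<open>t\<close> in \<open>{0..s}\<close> or in
  \<open>{l..l + s}\<close>. \<open>measure_tube_le\<close> bounds both events independently of
  \<open>l\<close>.\<close>

lemma free_ind_near_invariant:
  assumes rho: "0 < \<rho>" "\<rho> \<le> 1" and T: "0 \<le> T" "T * norm x \<le> s" and R: "0 \<le> R" and l: "0 < l"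
  shows "(\<integral>q. indicator (cball 0 R) q * \<bar>free_ind P \<rho> l q x - free_ind P \<rho> l (q + T *\<^sub>R x) x\<bar> \<partial>lborel)
    \<le> 2 * (C0 * (R + 2 + s) ^ DIM('a) * (s / \<rho> + 1) * (unit_ball_vol (real DIM('a)) * (2 * \<rho>) ^ DIM('a)))"
proof -
  have s0: "0 \<le> s" using T by (meson mult_nonneg_nonneg norm_ge_zero order_trans)
  define v where "v = sgn x"
  have v: "norm v \<le> 1" by (simp add: v_def norm_sgn)
  have Tx: "T *\<^sub>R x = (T * norm x) *\<^sub>R v" by (cases "x = 0") (simp_all add: v_def sgn_div_norm)
  define S where "S a = {q \<in> ball 0 (R + 1). \<exists>p\<in>P. \<exists>t\<in>{a..a + s}. dist (q + t *\<^sub>R v) p < \<rho>}" for a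
  have Sm: "S a \<in> sets borel" for a
  proof -
    have "S a = ball 0 (R + 1) \<inter> (\<Union>p\<in>P. \<Union>t\<in>{a..a + s}. {q. dist (q + t *\<^sub>R v) p < \<rho>})" by (auto simp: S_def)
    moreover have "open \<dots>" by (intro open_Int open_ball open_UN ballI open_Collect_less continuous_intros)
    ultimately show ?thesis by simp
  qed
  have Sfm: "S a \<in> fmeasurable lborel" for a
    by (rule fmeasurableI2[of "ball 0 (R + 1)"]) (use Sm in \<open>auto simp: S_def fmeasurable_def emeasure_lborel_ball_finite[simplified]\<close>)
  have Sb: "measure lborel (S a) \<le> C0 * (R + 2 + s) ^ DIM('a) * (s / \<rho> + 1) * (unit_ball_vol (real DIM('a)) * (2 * \<rho>) ^ DIM('a))" for a
  proof -
    have "measure lborel (S a) \<le> real (card (P \<inter> ball (0 + a *\<^sub>R v) (R + 1 + s + \<rho>))) * (s / \<rho> + 1) * (unit_ball_vol (real DIM('a)) * (2 * \<rho>) ^ DIM('a))"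
      unfolding S_def using v s0 rho by (intro measure_tube_le finite_P_ball) auto
    also have "\<dots> \<le> C0 * (R + 2 + s) ^ DIM('a) * (s / \<rho> + 1) * (unit_ball_vol (real DIM('a)) * (2 * \<rho>) ^ DIM('a))"
    proof (intro mult_right_mono)
      have "real (card (P \<inter> ball (0 + a *\<^sub>R v) (R + 1 + s + \<rho>))) \<le> C0 * (R + 1 + s + \<rho>) ^ DIM('a)"
        using R s0 rho by (intro count) auto
      also have "\<dots> \<le> C0 * (R + 2 + s) ^ DIM('a)" using R s0 rho C0_nonneg by (intro mult_left_mono power_mono) auto
      finally show "real (card (P \<inter> ball (0 + a *\<^sub>R v) (R + 1 + s + \<rho>))) \<le> C0 * (R + 2 + s) ^ DIM('a)" .
    qed (use rho s0 in auto)
    finally show ?thesis .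
  qed
  have pt: "indicator (cball 0 R) q * \<bar>free_ind P \<rho> l q x - free_ind P \<rho> l (q + T *\<^sub>R x) x\<bar> \<le> (indicator (S 0) q + indicator (S l) q :: real)" for q
  proof (cases "q \<in> cball 0 R \<and> free_ind P \<rho> l q x \<noteq> free_ind P \<rho> l (q + T *\<^sub>R x) x")
    case False then show ?thesis by (auto simp: indicator_def)
  next
    case True
    let ?w = "T * norm x"
    have w: "0 \<le> ?w" "?w \<le> s" using T by auto
    have tr: "q + T *\<^sub>R x + t *\<^sub>R v = q + (t + ?w) *\<^sub>R v" for t by (simp add: Tx algebra_simps)
    have "tube_free P \<rho> l q v \<noteq> tube_free P \<rho> l (q + T *\<^sub>R x) v" using True by (auto simp: free_ind_def v_def)
    then have "\<exists>t p. p \<in> P \<and> dist (q + t *\<^sub>R v) p < \<rho> \<and> (t \<in> {0..s} \<or> t \<in> {l..l + s})"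
    proof (cases "tube_free P \<rho> l q v")
      case True
      moreover assume "tube_free P \<rho> l q v \<noteq> tube_free P \<rho> l (q + T *\<^sub>R x) v"
      ultimately have "\<not> tube_free P \<rho> l (q + T *\<^sub>R x) v" by simp
      then obtain t p where tp: "0 < t" "t < l" "p \<in> P" "dist (q + (t + ?w) *\<^sub>R v) p < \<rho>" by (auto simp: tube_free_def not_le tr)
      have "l \<le> t + ?w"
      proof (rule ccontr)
        assume "\<not> l \<le> t + ?w"
        then have "\<rho> \<le> dist (q + (t + ?w) *\<^sub>R v) p" using True tp w unfolding tube_free_def by auto
        then show False using tp(4) by simp
      qed
      then show ?thesis using tp w by (intro exI[of _ "t + ?w"] exI[of _ p]) auto
    next
      case False
      assume "tube_free P \<rho> l q v \<noteq> tube_free P \<rho> l (q + T *\<^sub>R x) v"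
      with False have F: "tube_free P \<rho> l (q + T *\<^sub>R x) v" by simp
      from False obtain t p where tp: "0 < t" "t < l" "p \<in> P" "dist (q + t *\<^sub>R v) p < \<rho>" by (auto simp: tube_free_def not_le)
      have "t \<le> ?w"
      proof (rule ccontr)
        assume "\<not> t \<le> ?w"
        then have "\<rho> \<le> dist (q + T *\<^sub>R x + (t - ?w) *\<^sub>R v) p" using F tp w unfolding tube_free_def by auto
        then show False using tp(4) by (simp add: tr)
      qed
      then show ?thesis using tp w by (intro exI[of _ t] exI[of _ p]) auto
    qed
    then have "q \<in> S 0 \<or> q \<in> S l" using True R by (auto simp: S_def)
    then show ?thesis using free_ind_bounds[of P \<rho> l q x] free_ind_bounds[of P \<rho> l "q + T *\<^sub>R x" x]
      by (auto simp: indicator_def abs_le_iff)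
  qed
  have "(\<integral>q. indicator (cball 0 R) q * \<bar>free_ind P \<rho> l q x - free_ind P \<rho> l (q + T *\<^sub>R x) x\<bar> \<partial>lborel)
    \<le> (\<integral>q. indicator (S 0) q + indicator (S l) q \<partial>lborel)"
  proof (rule integral_mono[OF _ _ pt])
    show "integrable lborel (\<lambda>q. indicator (cball 0 R) q * \<bar>free_ind P \<rho> l q x - free_ind P \<rho> l (q + T *\<^sub>R x) x\<bar>)"
    proof (rule integrable_bounded_support(1)[of _ 1 0 R])
      show "(\<lambda>q. indicator (cball 0 R) q * \<bar>free_ind P \<rho> l q x - free_ind P \<rho> l (q + T *\<^sub>R x) x\<bar>) \<in> borel_measurable borel"
        by (intro borel_measurable_times borel_measurable_indicator borel_measurable_abs borel_measurable_diff free_ind_measurable') auto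
      show "\<bar>indicator (cball 0 R) q * \<bar>free_ind P \<rho> l q x - free_ind P \<rho> l (q + T *\<^sub>R x) x\<bar>\<bar> \<le> 1" for q
        using free_ind_bounds[of P \<rho> l q x] free_ind_bounds[of P \<rho> l "q + T *\<^sub>R x" x] by (auto simp: indicator_def abs_le_iff)
    qed auto
    show "integrable lborel (\<lambda>q. indicator (S 0) q + indicator (S l) q :: real)"
      using Sfm by (intro Bochner_Integration.integrable_add integrable_real_indicator) (auto simp: fmeasurable_def)
  qed
  also have "\<dots> = measure lborel (S 0) + measure lborel (S l)"
    using Sfm by (subst Bochner_Integration.integral_add) (auto simp: fmeasurable_def intro!: integrable_real_indicator)
  also have "\<dots> \<le> 2 * (C0 * (R + 2 + s) ^ DIM('a) * (s / \<rho> + 1) * (unit_ball_vol (real DIM('a)) * (2 * \<rho>) ^ DIM('a)))"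
    using add_mono[OF Sb[of 0] Sb[of l]] by (simp only: mult_2)
  finally show ?thesis .
qed

end

section \<open>Decorrelation along a sequence of radii\<close>

lemma ball_borel [measurable]: "ball (c::'a::euclidean_space) r \<in> sets borel"
  by simp

text \<open>If every ball of radius \<open>r\<close> carried more than \<open>Y\<close>, then
  integrating over the centres in \<open>ball 0 (N - r)\<close> and exchanging the integrals would
  contradict the assumption, since each \<open>q\<close> is counted with weight at most the volume
  of a ball of radius \<open>r\<close>.\<close>

lemma ex_center_small_integral:
  fixes D :: "'a::euclidean_space \<Rightarrow> real"
  assumes Dm [measurable]: "D \<in> borel_measurable borel" and D0: "\<And>q. 0 \<le> D q" and DB: "\<And>q. D q \<le> B"
    and r: "0 < r" "r < N"
    and less: "(\<integral>q. indicator (ball 0 N) q * D q \<partial>lborel) * measure lborel (ball (0::'a) r) < Y * measure lborel (ball (0::'a) (N - r))"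
  shows "\<exists>c. (\<integral>q. indicator (ball c r) q * D q \<partial>lborel) \<le> Y"
proof (rule ccontr)
  assume neg: "\<not> ?thesis"
  define I where "I c = (\<integral>q. indicator (ball c r) q * D q \<partial>lborel)" for c
  have pm: "(\<lambda>(c, q). indicator (ball c r) q :: real) \<in> borel_measurable (borel \<Otimes>\<^sub>M (borel :: 'a measure))"
  proof -
    have "open {z :: 'a \<times> 'a. dist (fst z) (snd z) < r}" by (intro open_Collect_less continuous_intros)
    then have "(indicator {z :: 'a \<times> 'a. dist (fst z) (snd z) < r} :: _ \<Rightarrow> real) \<in> borel_measurable (borel \<Otimes>\<^sub>M borel)"
      unfolding borel_prod by (intro borel_measurable_indicator) simp
    then show ?thesis by (rule measurable_cong[THEN iffD1, rotated]) (auto simp: indicator_def)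
  qed
  have pm' [measurable (raw)]: "(\<lambda>z. indicator (ball (g z) r) (k z) :: real) \<in> borel_measurable M'"
    if "g \<in> borel_measurable M'" "k \<in> borel_measurable M'" for g k :: "'z \<Rightarrow> 'a" and M'
    using measurable_compose[OF measurable_Pair[OF that] pm] by simp
  have B0: "0 \<le> B" using D0 DB order_trans by blast
  have integrand: "\<bar>indicator A q * D q\<bar> \<le> B" for A q using D0[of q] DB[of q] B0 by (auto simp: indicator_def)
  have Im [measurable]: "I \<in> borel_measurable borel" unfolding I_def by measurable
  have Ib: "\<bar>I c\<bar> \<le> B * measure lborel (cball c r)" for c
    unfolding I_def by (intro integrable_bounded_support(2) integrand) (auto simp: indicator_def)
  have Ib': "\<bar>I c\<bar> \<le> B * (unit_ball_vol (real DIM('a)) * r ^ DIM('a))" for c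
    using Ib[of c] r by (simp add: content_cball)
  have "(\<integral>c. indicator (ball (0::'a) (N - r)) c * Y \<partial>lborel) \<le> (\<integral>c. indicator (ball 0 (N - r)) c * I c \<partial>lborel)"
  proof (rule integral_mono)
    show "integrable lborel (\<lambda>c. indicator (ball (0::'a) (N - r)) c * Y)"
      by (rule integrable_bounded_support(1)[of _ "\<bar>Y\<bar>" 0 "N - r"]) (auto simp: indicator_def)
    show "integrable lborel (\<lambda>c. indicator (ball 0 (N - r)) c * I c)"
    proof (rule integrable_bounded_support(1)[of _ "B * (unit_ball_vol (real DIM('a)) * r ^ DIM('a))" 0 "N - r"])
      show "\<bar>indicator (ball 0 (N - r)) c * I c\<bar> \<le> B * (unit_ball_vol (real DIM('a)) * r ^ DIM('a))" for c
        using Ib'[of c] by (auto simp: indicator_def intro: order_trans[OF abs_ge_zero])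
    qed (auto simp: indicator_def)
    show "indicator (ball 0 (N - r)) c * Y \<le> indicator (ball 0 (N - r)) c * I c" for c
    proof -
      have "Y \<le> I c" using neg unfolding I_def by (meson less_imp_le not_le)
      then show ?thesis by (intro mult_left_mono) auto
    qed
  qed
  also have "(\<integral>c. indicator (ball 0 (N - r)) c * I c \<partial>lborel)
    = (\<integral>c. (\<integral>q. indicator (ball 0 (N - r)) c * (indicator (ball c r) q * D q) \<partial>lborel) \<partial>lborel)"
    by (simp add: I_def)
  also have "\<dots> = (\<integral>q. (\<integral>c. indicator (ball 0 (N - r)) c * (indicator (ball c r) q * D q) \<partial>lborel) \<partial>lborel)"
  proof (rule lborel_Fubini_bounded_support[of _ B 0 "N - r" 0 N])
    show "(\<lambda>(c, q). indicator (ball 0 (N - r)) c * (indicator (ball c r) q * D q)) \<in> borel_measurable (borel \<Otimes>\<^sub>M borel)"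
      unfolding case_prod_beta
      by (intro borel_measurable_times pm' measurable_fst measurable_snd measurable_compose[OF measurable_snd Dm]
        measurable_compose[OF measurable_fst borel_measurable_indicator]) simp
    show "\<bar>indicator (ball 0 (N - r)) c * (indicator (ball c r) q * D q)\<bar> \<le> B" for c q
      using integrand[of "ball c r" q] B0 by (auto simp: indicator_def)
    show "indicator (ball 0 (N - r)) c * (indicator (ball c r) q * D q) = 0" if "c \<notin> cball 0 (N - r)" for c q
      using that by (auto simp: indicator_def)
    show "indicator (ball 0 (N - r)) c * (indicator (ball c r) q * D q) = 0" if "q \<notin> cball 0 N" for c q
      using that norm_triangle_ineq[of c "q - c"] by (auto simp: indicator_def dist_norm norm_minus_commute)
  qed
  also have "\<dots> \<le> (\<integral>q. (indicator (ball 0 N) q * D q) * measure lborel (ball (0::'a) r) \<partial>lborel)"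
  proof (rule integral_mono)
    have eq: "(\<integral>c. indicator (ball 0 (N - r)) c * (indicator (ball c r) q * D q) \<partial>lborel)
      = D q * measure lborel (ball 0 (N - r) \<inter> ball q r)" for q
    proof -
      have "(\<integral>c. indicator (ball 0 (N - r)) c * (indicator (ball c r) q * D q) \<partial>lborel)
        = (\<integral>c. D q * indicator (ball 0 (N - r) \<inter> ball q r) c \<partial>lborel)"
        by (intro Bochner_Integration.integral_cong) (auto simp: indicator_def dist_commute)
      then show ?thesis by simp
    qed
    have le: "D q * measure lborel (ball 0 (N - r) \<inter> ball q r) \<le> (indicator (ball 0 N) q * D q) * measure lborel (ball (0::'a) r)" for q
    proof (cases "q \<in> ball 0 N")
      case True
      have "measure lborel (ball 0 (N - r) \<inter> ball q r) \<le> measure lborel (ball q r)"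
        by (rule measure_mono_fmeasurable) (auto simp: fmeasurable_def emeasure_lborel_ball_finite[simplified])
      also have "\<dots> = measure lborel (ball (0::'a) r)" using r by (simp add: content_ball)
      finally show ?thesis using True D0[of q] by (simp add: mult_left_mono)
    next
      case False
      have "ball 0 (N - r) \<inter> ball q r = {}"
      proof (rule equals0I)
        fix c assume "c \<in> ball 0 (N - r) \<inter> ball q r"
        then show False using False norm_triangle_ineq[of c "q - c"] by (simp add: dist_norm)
      qed
      then show ?thesis using False by simp
    qed
    show "integrable lborel (\<lambda>q. indicator (ball 0 N) q * D q * measure lborel (ball (0::'a) r))"
      by (intro integrable_mult_left integrable_bounded_support(1)[of _ B 0 N] integrand) (auto simp: indicator_def)
    show "(\<integral>c. indicator (ball 0 (N - r)) c * (indicator (ball c r) q * D q) \<partial>lborel) \<le> indicator (ball 0 N) q * D q * measure lborel (ball (0::'a) r)" for q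
      unfolding eq by (rule le)
    show "integrable lborel (\<lambda>q. (\<integral>c. indicator (ball 0 (N - r)) c * (indicator (ball c r) q * D q) \<partial>lborel))"
    proof (rule Bochner_Integration.integrable_bound[OF \<open>integrable lborel (\<lambda>q. indicator (ball 0 N) q * D q * measure lborel (ball (0::'a) r))\<close>])
      show "(\<lambda>q. (\<integral>c. indicator (ball 0 (N - r)) c * (indicator (ball c r) q * D q) \<partial>lborel)) \<in> borel_measurable lborel" by measurable
      show "AE q in lborel. norm (\<integral>c. indicator (ball 0 (N - r)) c * (indicator (ball c r) q * D q) \<partial>lborel) \<le> norm (indicator (ball 0 N) q * D q * measure lborel (ball (0::'a) r))"
        unfolding eq using le D0 by (intro AE_I2) simp
    qed
  qed
  also have "\<dots> = (\<integral>q. indicator (ball 0 N) q * D q \<partial>lborel) * measure lborel (ball (0::'a) r)" by simp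
  finally show False using less by (simp add: mult.commute)
qed

text \<open>Borel--Cantelli for functions: the integrals over the ball are summable, so the series
  of the \<open>H k\<close> is finite almost everywhere there and its terms tend to 0.\<close>

lemma AE_tendsto_0_if_integral_le:
  fixes H :: "nat \<Rightarrow> 'a::euclidean_space \<Rightarrow> real"
  assumes Hm [measurable]: "\<And>k. H k \<in> borel_measurable borel" and H0: "\<And>k q. 0 \<le> H k q" and HB: "\<And>k q. H k q \<le> B"
    and le: "\<And>k. k0 \<le> k \<Longrightarrow> (\<integral>q. indicator (ball c r) q * H k q \<partial>lborel) \<le> C / real (Suc k) ^ 2"
  shows "AE q in lborel. q \<in> ball c r \<longrightarrow> (\<lambda>k. H k q) \<longlonglongrightarrow> 0"
proof -
  define h where "h k q = indicator (ball c r) q * H (k + k0) q" for k q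
  have hm [measurable]: "h k \<in> borel_measurable borel" for k
    unfolding h_def by (intro borel_measurable_times borel_measurable_indicator Hm) simp
  have h0: "0 \<le> h k q" for k q using H0 by (simp add: h_def)
  have hint: "integrable lborel (h k)" for k
    by (rule integrable_bounded_support(1)[of _ "\<bar>B\<bar>" c r]) (use H0 HB in \<open>auto simp: h_def indicator_def intro: order_trans[OF HB abs_ge_self]\<close>)
  have C0: "0 \<le> C"
  proof -
    have "0 \<le> (\<integral>q. h 0 q \<partial>lborel)" using h0 by (intro Bochner_Integration.integral_nonneg)
    also have "\<dots> \<le> C / real (Suc k0) ^ 2" using le[of k0] by (simp add: h_def)
    finally show ?thesis by (simp add: zero_le_divide_iff)
  qed
  have sm: "summable (\<lambda>k. C / real (Suc (k + k0)) ^ 2)"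
    using summable_mult[OF summable_ignore_initial_segment[of "\<lambda>k. inverse (real k ^ 2)" "Suc k0"], of C] inverse_power_summable[of 2]
    by (simp add: divide_inverse)
  have "(\<integral>\<^sup>+q. (\<Sum>k. ennreal (h k q)) \<partial>lborel) = (\<Sum>k. (\<integral>\<^sup>+q. ennreal (h k q) \<partial>lborel))"
    by (rule nn_integral_suminf) simp
  also have "\<dots> \<le> (\<Sum>k. ennreal (C / real (Suc (k + k0)) ^ 2))"
  proof (intro suminf_le summableI)
    fix k
    have "(\<integral>\<^sup>+q. ennreal (h k q) \<partial>lborel) = ennreal (\<integral>q. h k q \<partial>lborel)"
      by (rule nn_integral_eq_integral[OF hint]) (simp add: h0)
    also have "\<dots> \<le> ennreal (C / real (Suc (k + k0)) ^ 2)" using le[of "k + k0"] by (intro ennreal_leI) (simp add: h_def)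
    finally show "(\<integral>\<^sup>+q. ennreal (h k q) \<partial>lborel) \<le> ennreal (C / real (Suc (k + k0)) ^ 2)" .
  qed
  also have "\<dots> = ennreal (\<Sum>k. C / real (Suc (k + k0)) ^ 2)" using C0 sm by (intro suminf_ennreal2) auto
  also have "\<dots> < \<infinity>" by simp
  finally have "AE q in lborel. (\<Sum>k. ennreal (h k q)) \<noteq> \<infinity>" by (intro nn_integral_noteq_infinite) auto
  then show ?thesis
  proof (rule AE_mp, intro AE_I2 impI)
    fix q assume fin: "(\<Sum>k. ennreal (h k q)) \<noteq> \<infinity>" and q: "q \<in> ball c r"
    have "summable (\<lambda>k. h k q)" by (rule summable_suminf_not_top) (use h0 fin in auto)
    then have "(\<lambda>k. h k q) \<longlonglongrightarrow> 0" by (rule summable_LIMSEQ_zero)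
    then have "(\<lambda>k. H (k + k0) q) \<longlonglongrightarrow> 0" using q by (simp add: h_def)
    then show "(\<lambda>k. H k q) \<longlonglongrightarrow> 0" by (rule LIMSEQ_offset)
  qed
qed

text \<open>Fast enough for Borel--Cantelli, slow enough that consecutive ratios tend to 1.\<close>

definition rho :: "nat \<Rightarrow> real" where "rho k = 1 / real (Suc k) ^ 10"

lemma rho_pos: "0 < rho k" by (simp add: rho_def)
lemma rho_le_1: "rho k \<le> 1" by (simp add: rho_def divide_le_eq del: of_nat_Suc)

lemma rho_tendsto_0: "rho \<longlonglongrightarrow> 0"
proof -
  have "(\<lambda>k. (inverse (real (Suc k))) ^ 10) \<longlonglongrightarrow> 0 ^ 10" by (intro tendsto_power LIMSEQ_inverse_real_of_nat)
  then show ?thesis by (simp add: rho_def[abs_def] inverse_eq_divide power_one_over del: of_nat_Suc)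
qed

context weighted_points
begin

text \<open>The tube length is on the Boltzmann--Grad scale \<open>\<rho> ^ (1 - d)\<close>, on
  which the volume of a tube stays of order \<open>\<xi>\<close> as \<open>\<rho>\<close> tends to
  0.\<close>

definition Gs :: "real \<Rightarrow> nat \<Rightarrow> 'a \<Rightarrow> real" where
  "Gs \<xi> k = G (rho k) (\<xi> / rho k ^ (DIM('a) - 1))"

lemma Gs_measurable [measurable]: "Gs \<xi> k \<in> borel_measurable borel" unfolding Gs_def by simp

lemma Gs_bounds: "0 \<le> Gs \<xi> k q" "Gs \<xi> k q \<le> measure lborel (cball (0::'a) (M + 1))"
  unfolding Gs_def by (rule G_nonneg G_le)+

lemma K_nonneg: "0 \<le> K"
proof -
  obtain i :: 'a where "i \<in> Basis" using nonempty_Basis by blast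
  then have "\<bar>b i - b 0\<bar> \<le> K" using b_Lipschitz[of i 0] by simp
  then show ?thesis using abs_ge_zero[of "b i - b 0"] by linarith
qed

text \<open>This is \<open>decorrelation\<close> with \<open>n = s ^ 4\<close>,
  \<open>N = s ^ 8\<close> and \<open>\<eta> = s ^ (-2)\<close>, where \<open>s = k + 1\<close>. The
  largest displacement \<open>n * n * M\<close> is comparable to \<open>N\<close>. Relative to the
  volume \<open>N ^ d\<close> and up to constants, the transport error is
  \<open>(N / \<rho>) * \<rho> ^ d \<le> N * \<rho> = s ^ (-2)\<close>, and the other two terms are
  \<open>\<eta>\<close> and \<open>1 / (\<eta> * n)\<close>, again \<open>s ^ (-2)\<close>.\<close>

lemma Gs_variance:
  assumes xi: "0 < \<xi>"
  obtains C where "\<And>k. norm h \<le> real (Suc k) \<Longrightarrow>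
    (\<integral>q. indicator (cball 0 (real (Suc k) ^ 8)) q * (Gs \<xi> k q - Gs \<xi> k (q + h))\<^sup>2 \<partial>lborel)
      \<le> C * (real (Suc k) ^ 8) ^ DIM('a) / real (Suc k) ^ 2"
proof -
  let ?d = "DIM('a)" and ?\<omega> = "unit_ball_vol (real DIM('a))"
  define \<kappa> where "\<kappa> = measure lborel (cball (0::'a) (M + 1))"
  define ce where "ce = 2 * (C0 * (4 + M) ^ ?d * (?\<omega> * 2 ^ ?d) * (M + 1))"
  define C where "C = \<kappa> * (2 * \<kappa> * ce + ?\<omega> * (2 + M) ^ ?d / 2) + (4 * \<kappa> + 2 * \<kappa> * K * norm h) * \<kappa>\<^sup>2 * (?\<omega> * 2 ^ ?d) / 2"
  have kap: "0 \<le> \<kappa>" by (simp add: \<kappa>_def)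
  have om: "0 < ?\<omega>" by simp
  have "(\<integral>q. indicator (cball 0 (real (Suc k) ^ 8)) q * (Gs \<xi> k q - Gs \<xi> k (q + h))\<^sup>2 \<partial>lborel)
      \<le> C * (real (Suc k) ^ 8) ^ ?d / real (Suc k) ^ 2" if hk: "norm h \<le> real (Suc k)" for k
  proof -
    define s where "s = real (Suc k)"
    define N where "N = s ^ 8"
    define l where "l = \<xi> / rho k ^ (?d - 1)"
    have s: "1 \<le> s" "norm h \<le> s" using hk by (simp_all add: s_def)
    have sN: "s \<le> N" unfolding N_def using power_increasing[of 1 8 s] s by simp
    have hN: "norm h \<le> N" "1 \<le> N" using s sN by auto
    have rho: "0 < rho k" "rho k \<le> 1" "rho k = 1 / s ^ 10" using rho_pos rho_le_1 by (simp_all add: s_def rho_def)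
    have l: "0 < l" using xi rho by (simp add: l_def)
    let ?e = "2 * (C0 * ((N + norm h) + 2 + N * M) ^ ?d * (N * M / rho k + 1) * (?\<omega> * (2 * rho k) ^ ?d))"
    have nn: "real ((Suc k) ^ 4) = s ^ 4" by (simp add: s_def)
    have nnM: "real ((Suc k) ^ 4) * real ((Suc k) ^ 4) = N" unfolding nn N_def by (simp flip: power_add)
    have main: "(\<integral>q. indicator (cball 0 N) q * (Gs \<xi> k q - Gs \<xi> k (q + h))\<^sup>2 \<partial>lborel)
      \<le> \<kappa> * (2 * \<kappa> * ?e + (1 / s\<^sup>2) / 2 * measure lborel (cball (0::'a) (N + norm h + real ((Suc k) ^ 4) * real ((Suc k) ^ 4) * M)))
        + (4 * \<kappa> + 2 * \<kappa> * K * norm h) * \<kappa>\<^sup>2 * measure lborel (cball (0::'a) (N + norm h)) / (2 * (1 / s\<^sup>2) * real ((Suc k) ^ 4))"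
      unfolding \<kappa>_def Gs_def G_def l_def[symmetric]
    proof (rule decorrelation[where f = "free_ind P (rho k) l" and b = b and K = K and M = M])
      show "(\<lambda>(q, x). free_ind P (rho k) l q x) \<in> borel_measurable (borel \<Otimes>\<^sub>M borel)" by (rule free_ind_measurable)
      show "norm h \<le> real ((Suc k) ^ 4)" unfolding nn using power_increasing[of 1 4 s] s by simp
      show "(\<integral>q. indicator (cball 0 (N + norm h)) q * \<bar>free_ind P (rho k) l q x
          - free_ind P (rho k) l (q + (real i * real ((Suc k) ^ 4)) *\<^sub>R x) x\<bar> \<partial>lborel) \<le> ?e"
        if x: "norm x \<le> M" and i: "i \<in> {1..(Suc k) ^ 4}" for x i
      proof (rule free_ind_near_invariant)
        have "real i * real ((Suc k) ^ 4) \<le> N" unfolding nnM[symmetric] using i by (intro mult_right_mono of_nat_mono) auto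
        then show "real i * real ((Suc k) ^ 4) * norm x \<le> N * M" using x hN by (intro mult_mono) auto
      qed (use rho l hN in auto)
    qed (use b_nonneg b_le_1 b_Lipschitz b_support M_pos s free_ind_bounds in auto)
    have rs: "N * rho k = 1 / s\<^sup>2" using s by (simp add: N_def rho(3) field_simps flip: power_add)
    have "rho k \<le> N * rho k" using hN(2) rho(1) by simp
    then have rs2: "rho k \<le> 1 / s\<^sup>2" using rs by simp
    have e: "?e \<le> ce * (N ^ ?d / s\<^sup>2)"
    proof -
      obtain m where m: "?d = Suc m" "1 \<le> m" using dim by (metis Suc_le_D Suc_le_mono Suc_1)
      have "(N * M / rho k + 1) * rho k ^ ?d = N * M * rho k ^ m + rho k ^ ?d"
        using rho(1) by (simp add: m field_simps)
      \<comment> \<open>Dimension at least two enters as \<open>m \<ge> 1\<close>; the worst case is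
        \<open>m = 1\<close>.\<close>
      also have "\<dots> \<le> N * M * rho k ^ 1 + rho k ^ 1"
        using rho M_pos hN m by (intro add_mono mult_left_mono power_decreasing) auto
      also have "\<dots> \<le> M * (1 / s\<^sup>2) + 1 / s\<^sup>2" using rs rs2 by (simp add: mult.commute mult.left_commute)
      finally have f1: "(N * M / rho k + 1) * rho k ^ ?d \<le> (M + 1) / s\<^sup>2" by (simp add: add_divide_distrib)
      have f2: "((N + norm h) + 2 + N * M) ^ ?d \<le> (4 + M) ^ ?d * N ^ ?d"
      proof -
        have "(N + norm h) + 2 + N * M \<le> (4 + M) * N" using hN by (simp add: algebra_simps)
        then show ?thesis unfolding power_mult_distrib[symmetric] using hN M_pos by (intro power_mono) (auto intro!: add_nonneg_nonneg)
      qed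
      have "?e = 2 * (C0 * (?\<omega> * 2 ^ ?d)) * (((N + norm h) + 2 + N * M) ^ ?d * ((N * M / rho k + 1) * rho k ^ ?d))"
        by (simp only: power_mult_distrib mult_ac)
      also have "\<dots> \<le> 2 * (C0 * (?\<omega> * 2 ^ ?d)) * (((4 + M) ^ ?d * N ^ ?d) * ((M + 1) / s\<^sup>2))"
        using f1 f2 C0_nonneg hN M_pos rho by (intro mult_left_mono mult_mono) (auto intro!: mult_nonneg_nonneg add_nonneg_nonneg)
      also have "\<dots> = ce * (N ^ ?d / s\<^sup>2)" by (simp add: ce_def)
      finally show ?thesis .
    qed
    have B2: "measure lborel (cball (0::'a) (N + norm h + real ((Suc k) ^ 4) * real ((Suc k) ^ 4) * M)) \<le> ?\<omega> * (2 + M) ^ ?d * N ^ ?d"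
    proof -
      have "(N + norm h + N * M) ^ ?d \<le> ((2 + M) * N) ^ ?d" using hN M_pos by (intro power_mono) (auto simp: algebra_simps intro!: add_nonneg_nonneg)
      moreover have "measure lborel (cball (0::'a) (N + norm h + N * M)) = ?\<omega> * (N + norm h + N * M) ^ ?d"
        using hN M_pos by (intro content_cball) (auto intro!: add_nonneg_nonneg)
      ultimately show ?thesis unfolding nnM using om by (simp add: power_mult_distrib mult.assoc)
    qed
    have B1: "measure lborel (cball (0::'a) (N + norm h)) \<le> ?\<omega> * 2 ^ ?d * N ^ ?d"
    proof -
      have "(N + norm h) ^ ?d \<le> (2 * N) ^ ?d" using hN by (intro power_mono) auto
      moreover have "measure lborel (cball (0::'a) (N + norm h)) = ?\<omega> * (N + norm h) ^ ?d"
        using hN by (intro content_cball) auto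
      ultimately show ?thesis using om by (simp add: power_mult_distrib mult.assoc)
    qed
    have den: "2 * (1 / s\<^sup>2) * real ((Suc k) ^ 4) = 2 * s\<^sup>2" unfolding nn using s by (simp add: field_simps flip: power_add)
    have "\<kappa> * (2 * \<kappa> * ?e + (1 / s\<^sup>2) / 2 * measure lborel (cball (0::'a) (N + norm h + real ((Suc k) ^ 4) * real ((Suc k) ^ 4) * M)))
      \<le> \<kappa> * (2 * \<kappa> * (ce * (N ^ ?d / s\<^sup>2)) + (1 / s\<^sup>2) / 2 * (?\<omega> * (2 + M) ^ ?d * N ^ ?d))"
      using e B2 kap s by (intro mult_left_mono add_mono) auto
    moreover have "(4 * \<kappa> + 2 * \<kappa> * K * norm h) * \<kappa>\<^sup>2 * measure lborel (cball (0::'a) (N + norm h)) / (2 * s\<^sup>2)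
      \<le> (4 * \<kappa> + 2 * \<kappa> * K * norm h) * \<kappa>\<^sup>2 * (?\<omega> * 2 ^ ?d * N ^ ?d) / (2 * s\<^sup>2)"
      using B1 kap K_nonneg s by (intro divide_right_mono mult_left_mono) auto
    moreover have "\<kappa> * (2 * \<kappa> * (ce * (N ^ ?d / s\<^sup>2)) + (1 / s\<^sup>2) / 2 * (?\<omega> * (2 + M) ^ ?d * N ^ ?d))
      + (4 * \<kappa> + 2 * \<kappa> * K * norm h) * \<kappa>\<^sup>2 * (?\<omega> * 2 ^ ?d * N ^ ?d) / (2 * s\<^sup>2) = C * N ^ ?d / s\<^sup>2"
      using s by (simp add: C_def field_simps)
    ultimately have "(\<integral>q. indicator (cball 0 N) q * (Gs \<xi> k q - Gs \<xi> k (q + h))\<^sup>2 \<partial>lborel) \<le> C * N ^ ?d / s\<^sup>2"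
      using main unfolding den by linarith
    then show ?thesis by (simp add: N_def s_def)
  qed
  then show ?thesis by (rule that)
qed

end

section \<open>Transfer to a fixed ball by almost periods\<close>

context weighted_points
begin

lemma Gs_almost_period:
  assumes xi: "0 < \<xi>" and eps: "0 < \<epsilon>"
  obtains Y R1 k0 where "\<And>c. \<exists>y\<in>Y. dist c y \<le> R1"
    "\<And>k y q. k0 \<le> k \<Longrightarrow> y \<in> Y \<Longrightarrow> q \<notin> near_P (rho k) \<Longrightarrow> q + y \<notin> near_P (rho k) \<Longrightarrow>
      \<bar>Gs \<xi> k q - Gs \<xi> k (q + y)\<bar> \<le> \<epsilon>"
proof -
  let ?d = "DIM('a)"
  define A where "A = unit_ball_vol (real ?d) * (4 * M) ^ ?d"
  have A: "0 < A" using M_pos by (simp add: A_def)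
  \<comment> \<open>With this \<open>e\<close> the bound \<open>Bd k\<close> below tends to
    \<open>\<epsilon> / 2\<close>.\<close>
  define e where "e = \<epsilon> / (A * (2 ^ ?d * 2) * (2 * \<xi>))"
  have e: "0 < e" using eps A xi by (simp add: e_def)
  obtain Y R1 R0 where Y: "1 \<le> R0" "\<And>c. \<exists>y\<in>Y. dist c y \<le> R1"
    "\<And>y c R. y \<in> Y \<Longrightarrow> R0 \<le> R \<Longrightarrow> real (card (shift_diff P y \<inter> ball c R)) \<le> e * R ^ ?d"
    using almost_periods[OF e] by blast
  define Bd where "Bd k = A * (2 * C0 * R0 ^ ?d * sqrt (rho k) + e * 2 ^ ?d * 2 * (\<xi> + rho k ^ (?d - 1) * (rho k + R0)))" for k
  have "Bd \<longlonglongrightarrow> A * (2 * C0 * R0 ^ ?d * sqrt 0 + e * 2 ^ ?d * 2 * (\<xi> + 0 ^ (?d - 1) * (0 + R0)))"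
    unfolding Bd_def[abs_def] by (intro tendsto_intros rho_tendsto_0)
  moreover have "A * (2 * C0 * R0 ^ ?d * sqrt 0 + e * 2 ^ ?d * 2 * (\<xi> + 0 ^ (?d - 1) * (0 + R0))) < \<epsilon>"
  proof -
    have z: "(0::real) ^ (?d - 1) = 0" using dim by simp
    show ?thesis unfolding z using A xi eps by (simp add: e_def field_simps)
  qed
  ultimately have "\<forall>\<^sub>F k in sequentially. Bd k < \<epsilon>" by (rule order_tendstoD)
  moreover have "\<forall>\<^sub>F k in sequentially. rho k < 1 / 4" by (rule order_tendstoD[OF rho_tendsto_0]) simp
  ultimately have "\<forall>\<^sub>F k in sequentially. Bd k < \<epsilon> \<and> rho k < 1 / 4" by (rule eventually_conj)
  then obtain k0 where k0: "\<And>k. k0 \<le> k \<Longrightarrow> Bd k < \<epsilon> \<and> rho k < 1 / 4" unfolding eventually_sequentially by blast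
  have "\<bar>Gs \<xi> k q - Gs \<xi> k (q + y)\<bar> \<le> \<epsilon>"
    if k: "k0 \<le> k" and y: "y \<in> Y" and q: "q \<notin> near_P (rho k)" "q + y \<notin> near_P (rho k)" for k y q
  proof -
    have r: "0 < rho k" "rho k \<le> 1 / 4" using rho_pos k0[OF k] by auto
    have "\<bar>Gs \<xi> k q - Gs \<xi> k (q + y)\<bar> \<le> unit_ball_vol (real ?d) * (4 * M) ^ ?d * (2 * C0 * R0 ^ ?d * sqrt (rho k)
      + e * 2 ^ ?d * 2 * (rho k ^ (?d - 1) * (\<xi> / rho k ^ (?d - 1) + rho k + R0)))"
      unfolding Gs_def using r xi Y(1,3) e y q by (intro G_almost_period) auto
    also have "rho k ^ (?d - 1) * (\<xi> / rho k ^ (?d - 1) + rho k + R0) = \<xi> + rho k ^ (?d - 1) * (rho k + R0)"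
      using r by (simp add: distrib_left)
    finally have "\<bar>Gs \<xi> k q - Gs \<xi> k (q + y)\<bar> \<le> Bd k" by (simp add: Bd_def A_def)
    then show ?thesis using k0[OF k] by linarith
  qed
  then show ?thesis using that Y(2) by blast
qed

text \<open>The indicators make a small value of \<open>dev\<close> certify that both points avoid the exceptional
  set \<open>near_P\<close>, on which the almost periodicity estimate fails.\<close>

definition dev :: "real \<Rightarrow> 'a \<Rightarrow> nat \<Rightarrow> 'a \<Rightarrow> real" where
  "dev \<xi> h k q = (Gs \<xi> k q - Gs \<xi> k (q + h))\<^sup>2 + indicator (near_P (rho k)) q + indicator (near_P (rho k)) (q + h)"

lemma Gs_translate_measurable [measurable]: "(\<lambda>q. Gs \<xi> k (q + h)) \<in> borel_measurable borel"
  by (rule measurable_compose[OF _ Gs_measurable]) simp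

lemma dev_measurable [measurable]: "dev \<xi> h k \<in> borel_measurable borel"
proof -
  have "(\<lambda>q. indicator (near_P (rho k)) (q + h) :: real) \<in> borel_measurable borel"
    by (rule measurable_compose[of "\<lambda>q. q + h" borel borel]) (auto intro: borel_measurable_indicator near_P_measurable)
  then show ?thesis unfolding dev_def[abs_def] by measurable
qed

lemma dev_bounds: "0 \<le> dev \<xi> h k q" "dev \<xi> h k q \<le> (measure lborel (cball (0::'a) (M + 1)))\<^sup>2 + 2"
proof -
  show "0 \<le> dev \<xi> h k q" by (simp add: dev_def)
  have "\<bar>Gs \<xi> k q - Gs \<xi> k (q + h)\<bar> \<le> measure lborel (cball (0::'a) (M + 1))"
    using Gs_bounds[of \<xi> k q] Gs_bounds[of \<xi> k "q + h"] by linarith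
  then have "(Gs \<xi> k q - Gs \<xi> k (q + h))\<^sup>2 \<le> (measure lborel (cball (0::'a) (M + 1)))\<^sup>2"
    by (metis abs_ge_zero power2_abs power_mono)
  then show "dev \<xi> h k q \<le> (measure lborel (cball (0::'a) (M + 1)))\<^sup>2 + 2"
    by (simp add: dev_def indicator_def)
qed

text \<open>On the ball of radius \<open>N\<close> the mean square from \<open>Gs_variance\<close>
  and the share of \<open>near_P\<close> are both of order \<open>s ^ (-2)\<close>, and some ball of
  radius \<open>r\<close> does as well as the average. Its centre depends on \<open>k\<close> and is
  not controlled.\<close>

lemma dev_small_center:
  assumes xi: "0 < \<xi>" and r: "0 < r"
  obtains C k0 where "\<And>k. k0 \<le> k \<Longrightarrow> \<exists>c. (\<integral>q. indicator (ball c r) q * dev \<xi> h k q \<partial>lborel) \<le> C / real (Suc k) ^ 2"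
proof -
  let ?d = "DIM('a)" and ?\<omega> = "unit_ball_vol (real DIM('a))"
  obtain C1 where C1: "\<And>k. norm h \<le> real (Suc k) \<Longrightarrow>
    (\<integral>q. indicator (cball 0 (real (Suc k) ^ 8)) q * (Gs \<xi> k q - Gs \<xi> k (q + h))\<^sup>2 \<partial>lborel)
      \<le> C1 * (real (Suc k) ^ 8) ^ ?d / real (Suc k) ^ 2" using Gs_variance[OF xi] by blast
  define C2 where "C2 = C1 + 2 * (C0 * 2 ^ ?d * ?\<omega>)"
  define k0 where "k0 = nat \<lceil>max (norm h) (2 * r)\<rceil>"
  \<comment> \<open>The factor \<open>2 ^ ?d\<close> comes from \<open>N - r \<ge> N / 2\<close>;
    the summand 1 makes the comparison strict.\<close>
  define C where "C = C2 * 2 ^ ?d * r ^ ?d + 1"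
  have "\<exists>c. (\<integral>q. indicator (ball c r) q * dev \<xi> h k q \<partial>lborel) \<le> C / real (Suc k) ^ 2" if k: "k0 \<le> k" for k
  proof -
    define s where "s = real (Suc k)"
    define N where "N = s ^ 8"
    have s: "1 \<le> s" "norm h \<le> s" "2 * r \<le> s" using k unfolding s_def k0_def by (auto simp: nat_le_iff ceiling_le_iff)
    have sN: "s \<le> N" unfolding N_def using power_increasing[of 1 8 s] s by simp
    then have N: "1 \<le> N" "2 * r \<le> N" using s by auto
    have rho: "0 < rho k" "rho k \<le> 1" using rho_pos rho_le_1 by auto
    have rhos: "rho k \<le> 1 / s\<^sup>2"
      unfolding rho_def s_def[symmetric] using s by (intro divide_left_mono power_increasing) auto
    have nearb: "measure lborel {q \<in> ball 0 N. q + h' \<in> near_P (rho k)} \<le> C0 * 2 ^ ?d * ?\<omega> * (N ^ ?d / s\<^sup>2)" for h'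
    proof -
      have "measure lborel {q \<in> ball 0 N. q + h' \<in> near_P (rho k)} \<le> C0 * (N + 1) ^ ?d * ?\<omega> * rho k"
        using rho N by (intro near_P_measure) auto
      also have "\<dots> \<le> C0 * (2 * N) ^ ?d * ?\<omega> * (1 / s\<^sup>2)"
        using rho N rhos C0_nonneg by (intro mult_mono power_mono mult_nonneg_nonneg mult_right_mono mult_left_mono) auto
      finally show ?thesis by (simp add: power_mult_distrib mult_ac)
    qed
    have meas: "{q \<in> ball 0 N. q + h' \<in> near_P (rho k)} \<in> sets borel" for h'
    proof -
      have "(\<lambda>q. q + h') -` near_P (rho k) \<inter> space borel \<in> sets (borel :: 'a measure)"
        by (intro measurable_sets[OF _ near_P_measurable]) simp
      moreover have "{q \<in> ball 0 N. q + h' \<in> near_P (rho k)} = ball 0 N \<inter> ((\<lambda>q. q + h') -` near_P (rho k) \<inter> space borel)" by auto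
      ultimately show ?thesis by simp
    qed
    have fm: "{q \<in> ball 0 N. q + h' \<in> near_P (rho k)} \<in> fmeasurable lborel" for h'
      by (rule fmeasurableI2[of "ball 0 N"]) (use meas in \<open>auto simp: fmeasurable_def emeasure_lborel_ball_finite[simplified]\<close>)
    let ?S = "\<lambda>h'. {q \<in> ball 0 N. q + h' \<in> near_P (rho k)}"
    let ?v = "\<lambda>q. indicator (cball 0 N) q * (Gs \<xi> k q - Gs \<xi> k (q + h))\<^sup>2"
    have vi: "integrable lborel ?v"
    proof (rule integrable_bounded_support(1)[of _ "(measure lborel (cball (0::'a) (M + 1)))\<^sup>2 + 2" 0 N])
      show "\<bar>?v q\<bar> \<le> (measure lborel (cball (0::'a) (M + 1)))\<^sup>2 + 2" for q
      proof -
        have "(Gs \<xi> k q - Gs \<xi> k (q + h))\<^sup>2 \<le> dev \<xi> h k q" by (simp add: dev_def)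
        then have "(Gs \<xi> k q - Gs \<xi> k (q + h))\<^sup>2 \<le> (measure lborel (cball (0::'a) (M + 1)))\<^sup>2 + 2"
          using dev_bounds(2) by (rule order_trans)
        then show ?thesis by (auto simp: indicator_def)
      qed
    next
      show "?v \<in> borel_measurable borel"
        by (intro borel_measurable_times borel_measurable_indicator borel_measurable_power borel_measurable_diff
          Gs_measurable Gs_translate_measurable) simp
    qed simp
    have si: "integrable lborel (indicator (?S h') :: 'a \<Rightarrow> real)" for h'
      using fm[of h'] by (intro integrable_real_indicator) (auto simp: fmeasurable_def)
    have "(\<integral>q. indicator (ball 0 N) q * dev \<xi> h k q \<partial>lborel) \<le> (\<integral>q. ?v q + (indicator (?S 0) q + indicator (?S h) q) \<partial>lborel)"
    proof (rule integral_mono)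
      show "integrable lborel (\<lambda>q. indicator (ball 0 N) q * dev \<xi> h k q)"
        by (rule integrable_bounded_support(1)[of _ "(measure lborel (cball (0::'a) (M + 1)))\<^sup>2 + 2" 0 N])
          (use dev_bounds in \<open>auto simp: indicator_def\<close>)
      show "indicator (ball 0 N) q * dev \<xi> h k q \<le> ?v q + (indicator (?S 0) q + indicator (?S h) q)" for q
        by (auto simp: indicator_def dev_def)
    qed (intro Bochner_Integration.integrable_add vi si)
    also have "\<dots> = (\<integral>q. ?v q \<partial>lborel) + (measure lborel (?S 0) + measure lborel (?S h))"
      by (simp only: Bochner_Integration.integral_add[OF vi Bochner_Integration.integrable_add[OF si si]]
        Bochner_Integration.integral_add[OF si si] Bochner_Integration.integral_indicator space_lborel space_borel Int_UNIV_right)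
    also have "\<dots> \<le> C2 * N ^ ?d / s\<^sup>2"
      using C1[of k] s nearb[of 0] nearb[of h] unfolding C2_def by (simp add: s_def N_def field_simps del: of_nat_Suc)
    finally have I: "(\<integral>q. indicator (ball 0 N) q * dev \<xi> h k q \<partial>lborel) \<le> C2 * N ^ ?d / s\<^sup>2" .
    show ?thesis unfolding s_def[symmetric]
    proof (rule ex_center_small_integral[OF dev_measurable dev_bounds])
      show "(\<integral>q. indicator (ball 0 N) q * dev \<xi> h k q \<partial>lborel) * measure lborel (ball (0::'a) r)
        < C / s\<^sup>2 * measure lborel (ball (0::'a) (N - r))"
      proof -
        have "(\<integral>q. indicator (ball 0 N) q * dev \<xi> h k q \<partial>lborel) * measure lborel (ball (0::'a) r)
          \<le> C2 * N ^ ?d / s\<^sup>2 * (?\<omega> * r ^ ?d)"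
          unfolding content_ball[OF less_imp_le[OF r]] by (rule mult_right_mono[OF I]) (use r in simp)
        also have "\<dots> < C / s\<^sup>2 * (?\<omega> * (N / 2) ^ ?d)"
          using s N unfolding C_def by (simp add: power_divide field_simps)
        also have "\<dots> \<le> C / s\<^sup>2 * (?\<omega> * (N - r) ^ ?d)"
        proof (intro mult_left_mono power_mono)
          have "0 \<le> C2 * N ^ ?d / s\<^sup>2"
            by (rule order_trans[OF Bochner_Integration.integral_nonneg I]) (use dev_bounds in auto)
          moreover have "0 < N ^ ?d" using N by simp
          ultimately have "0 \<le> C2" using s by (auto simp: zero_le_divide_iff zero_le_mult_iff dest: leD)
          then show "0 \<le> C / s\<^sup>2" using r by (simp add: C_def)
        qed (use N r in auto)
        finally show ?thesis using N r by (simp add: content_ball)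
      qed
    qed (use N r in auto)
  qed
  then show ?thesis by (rule that)
qed

lemma eventually_not_near_P:
  assumes "q \<notin> P"
  shows "\<forall>\<^sub>F k in sequentially. q \<notin> near_P (rho k)"
proof -
  have fin: "finite (P \<inter> ball q 1)" by (rule finite_P_ball)
  obtain \<delta> where d: "0 < \<delta>" "\<And>p. p \<in> P \<inter> ball q 1 \<Longrightarrow> p \<noteq> q \<Longrightarrow> \<delta> \<le> dist q p"
    using finite_set_avoid[OF fin] by metis
  have "(\<lambda>k. sqrt (rho k)) \<longlonglongrightarrow> sqrt 0" by (intro tendsto_real_sqrt rho_tendsto_0)
  then have "\<forall>\<^sub>F k in sequentially. sqrt (rho k) < min \<delta> 1" using d(1) by (intro order_tendstoD(2)) auto
  then show ?thesis
  proof (rule eventually_mono)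
    fix k assume k: "sqrt (rho k) < min \<delta> 1"
    show "q \<notin> near_P (rho k)"
    proof
      assume "q \<in> near_P (rho k)"
      then obtain p where p: "p \<in> P" "dist p q < sqrt (rho k)" by (auto simp: near_P_def)
      then have "p \<in> P \<inter> ball q 1" using k by (simp add: dist_commute del: real_sqrt_lt_1_iff)
      then show False using d(2)[of p] p k assms by (auto simp: dist_commute)
    qed
  qed
qed

lemma countable_P: "countable P"
proof -
  have "P = (\<Union>n::nat. P \<inter> ball 0 (real n))" using reals_Archimedean2 by auto
  moreover have "countable \<dots>" by (intro countable_UN) (auto intro: countable_finite finite_P_ball)
  ultimately show ?thesis by simp
qed

lemma AE_translate_not_in_P: "AE q in lborel. q + h \<notin> P"
proof -
  have "countable ((\<lambda>p. p - h) ` P)" using countable_P by simp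
  then have "(\<lambda>p. p - h) ` P \<in> null_sets lborel" by (rule countable_imp_null_set_lborel)
  then have "AE q in lborel. q \<notin> (\<lambda>p. p - h) ` P" by (rule AE_not_in)
  then show ?thesis by (rule AE_mp) (auto simp: image_iff algebra_simps intro!: AE_I2)
qed

text \<open>The ball on which \<open>dev\<close> is small wanders with \<open>k\<close>. An almost
  period \<open>y k\<close> within \<open>R1\<close> of its centre moves it back, so that
  \<open>dev \<xi> h k (q + y k)\<close> has summable integrals over a fixed ball. The increment at
  \<open>q\<close> then differs from the one at \<open>q + y k\<close> by two almost-period errors,
  which together with the small increment there makes \<open>3 * \<epsilon>\<close>. That
  \<open>y\<close> depends on \<open>k\<close> is harmless because the almost-period estimate is
  uniform over \<open>Y\<close>.\<close>

lemma Gs_shift_tendsto: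
  assumes xi: "0 < \<xi>"
  shows "AE q in lborel. (\<lambda>k. Gs \<xi> k q - Gs \<xi> k (q + h)) \<longlonglongrightarrow> 0"
proof -
  have key: "AE q in lborel. q \<in> ball 0 (real (Suc j)) \<longrightarrow> (\<forall>\<^sub>F k in sequentially. \<bar>Gs \<xi> k q - Gs \<xi> k (q + h)\<bar> < 3 * \<epsilon>)"
    if eps: "0 < \<epsilon>" for j \<epsilon>
  proof -
    obtain Y R1 k1 where Y: "\<And>c. \<exists>y\<in>Y. dist c y \<le> R1"
      "\<And>k y q. k1 \<le> k \<Longrightarrow> y \<in> Y \<Longrightarrow> q \<notin> near_P (rho k) \<Longrightarrow> q + y \<notin> near_P (rho k) \<Longrightarrow>
        \<bar>Gs \<xi> k q - Gs \<xi> k (q + y)\<bar> \<le> \<epsilon>" using Gs_almost_period[OF xi eps] by blast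
    have R1: "0 \<le> R1" using Y(1)[of 0] by (meson order_trans zero_le_dist)
    \<comment> \<open>Large enough that \<open>ball y (real (Suc j))\<close> lies in
      \<open>ball c r\<close> whenever \<open>dist c y \<le> R1\<close>.\<close>
    define r where "r = R1 + real (Suc j)"
    have r: "0 < r" using R1 by (simp add: r_def)
    obtain C k2 where C: "\<And>k. k2 \<le> k \<Longrightarrow> \<exists>c. (\<integral>q. indicator (ball c r) q * dev \<xi> h k q \<partial>lborel) \<le> C / real (Suc k) ^ 2"
      using dev_small_center[OF xi r] by blast
    have "\<exists>y\<in>Y. k2 \<le> k \<longrightarrow> (\<integral>q. indicator (ball 0 (real (Suc j))) q * dev \<xi> h k (q + y) \<partial>lborel) \<le> C / real (Suc k) ^ 2" for k
    proof (cases "k2 \<le> k")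
      case True
      obtain c where c: "(\<integral>q. indicator (ball c r) q * dev \<xi> h k q \<partial>lborel) \<le> C / real (Suc k) ^ 2" using C[OF True] by blast
      obtain y where y: "y \<in> Y" "dist c y \<le> R1" using Y(1) by blast
      have "(\<integral>q. indicator (ball 0 (real (Suc j))) q * dev \<xi> h k (q + y) \<partial>lborel)
        = (\<integral>q. indicator (ball y (real (Suc j))) (q + y) * dev \<xi> h k (q + y) \<partial>lborel)"
        by (intro Bochner_Integration.integral_cong) (auto simp: indicator_def dist_norm)
      also have "\<dots> = (\<integral>q. indicator (ball y (real (Suc j))) q * dev \<xi> h k q \<partial>lborel)"
        by (rule lborel_integral_translate) measurable
      also have "\<dots> \<le> (\<integral>q. indicator (ball c r) q * dev \<xi> h k q \<partial>lborel)"
      proof (rule integral_mono)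
        show "integrable lborel (\<lambda>q. indicator (ball x R) q * dev \<xi> h k q)" for x R
          by (rule integrable_bounded_support(1)[of _ "(measure lborel (cball (0::'a) (M + 1)))\<^sup>2 + 2" x R])
            (use dev_bounds in \<open>auto simp: indicator_def\<close>)
        then show "integrable lborel (\<lambda>q. indicator (ball c r) q * dev \<xi> h k q)" .
        show "indicator (ball y (real (Suc j))) q * dev \<xi> h k q \<le> indicator (ball c r) q * dev \<xi> h k q" for q
        proof (rule mult_right_mono)
          have "dist c q < r" if "dist y q < real (Suc j)"
            using dist_triangle[of c q y] y(2) that by (simp add: r_def)
          then show "indicator (ball y (real (Suc j))) q \<le> (indicator (ball c r) q :: real)" by (auto simp: indicator_def)
        qed (rule dev_bounds)
      qed
      finally show ?thesis using c y(1) by force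
    next
      case False then show ?thesis using Y(1)[of 0] by blast
    qed
    then obtain y where y: "\<And>k. y k \<in> Y"
      "\<And>k. k2 \<le> k \<Longrightarrow> (\<integral>q. indicator (ball 0 (real (Suc j))) q * dev \<xi> h k (q + y k) \<partial>lborel) \<le> C / real (Suc k) ^ 2"
      by metis
    have "AE q in lborel. q \<in> ball 0 (real (Suc j)) \<longrightarrow> (\<lambda>k. dev \<xi> h k (q + y k)) \<longlonglongrightarrow> 0"
    proof (rule AE_tendsto_0_if_integral_le)
      show "(\<lambda>q. dev \<xi> h k (q + y k)) \<in> borel_measurable borel" for k
        by (rule measurable_compose[OF _ dev_measurable]) simp
    qed (use y(2) dev_bounds in auto)
    then show ?thesis using AE_translate_not_in_P[of 0] AE_translate_not_in_P[of h]
    proof eventually_elim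
      case (elim q)
      show ?case
      proof
        assume "q \<in> ball 0 (real (Suc j))"
        then have "(\<lambda>k. dev \<xi> h k (q + y k)) \<longlonglongrightarrow> 0" using elim(1) by blast
        then have "\<forall>\<^sub>F k in sequentially. dev \<xi> h k (q + y k) < min 1 (\<epsilon>\<^sup>2)" using eps by (intro order_tendstoD(2)) auto
        moreover have "\<forall>\<^sub>F k in sequentially. q \<notin> near_P (rho k)" using elim(2) by (intro eventually_not_near_P) simp
        moreover have "\<forall>\<^sub>F k in sequentially. q + h \<notin> near_P (rho k)" using elim(3) by (rule eventually_not_near_P)
        ultimately show "\<forall>\<^sub>F k in sequentially. \<bar>Gs \<xi> k q - Gs \<xi> k (q + h)\<bar> < 3 * \<epsilon>"
          using eventually_ge_at_top[of k1]
        proof eventually_elim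
          case (elim k)
          let ?q = "q + y k"
          have "dev \<xi> h k ?q < 1" using elim(1) by simp
          then have "indicator (near_P (rho k)) ?q + indicator (near_P (rho k)) (?q + h) < (1::real)"
            using zero_le_power2[of "Gs \<xi> k ?q - Gs \<xi> k (?q + h)"] unfolding dev_def by linarith
          then have n1: "?q \<notin> near_P (rho k)" "?q + h \<notin> near_P (rho k)"
            by (auto simp: indicator_def of_bool_def split: if_splits)
          have "(Gs \<xi> k ?q - Gs \<xi> k (?q + h))\<^sup>2 \<le> dev \<xi> h k ?q" by (simp add: dev_def)
          then have "(Gs \<xi> k ?q - Gs \<xi> k (?q + h))\<^sup>2 < \<epsilon>\<^sup>2" using elim(1) by linarith
          then have a: "\<bar>Gs \<xi> k ?q - Gs \<xi> k (?q + h)\<bar> < \<epsilon>"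
            using eps by (metis abs_of_pos power2_less_imp_less power2_abs less_imp_le)
          have b: "\<bar>Gs \<xi> k q - Gs \<xi> k ?q\<bar> \<le> \<epsilon>" using Y(2)[OF elim(4) y(1) elim(2) n1(1)] .
          have "q + h + y k = ?q + h" by simp
          then have "\<bar>Gs \<xi> k (q + h) - Gs \<xi> k (?q + h)\<bar> \<le> \<epsilon>" using Y(2)[OF elim(4) y(1) elim(3)] n1(2) by metis
          then show ?case using a b by linarith
        qed
      qed
    qed
  qed
  have "AE q in lborel. \<forall>j m. q \<in> ball 0 (real (Suc j)) \<longrightarrow>
      (\<forall>\<^sub>F k in sequentially. \<bar>Gs \<xi> k q - Gs \<xi> k (q + h)\<bar> < 3 * (1 / real (Suc m)))"
    unfolding AE_all_countable by (intro allI key) simp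
  then show ?thesis
  proof (rule AE_mp, intro AE_I2 impI)
    fix q assume H: "\<forall>j m. q \<in> ball 0 (real (Suc j)) \<longrightarrow>
      (\<forall>\<^sub>F k in sequentially. \<bar>Gs \<xi> k q - Gs \<xi> k (q + h)\<bar> < 3 * (1 / real (Suc m)))"
    obtain j where "norm q < real j" using reals_Archimedean2 by blast
    then have q: "q \<in> ball 0 (real (Suc j))" by simp
    show "(\<lambda>k. Gs \<xi> k q - Gs \<xi> k (q + h)) \<longlonglongrightarrow> 0"
    proof (rule tendstoI)
      fix e :: real assume e: "0 < e"
      obtain m where m: "inverse (real (Suc m)) < e / 3" using reals_Archimedean[of "e / 3"] e by auto
      have "\<forall>\<^sub>F k in sequentially. \<bar>Gs \<xi> k q - Gs \<xi> k (q + h)\<bar> < 3 * (1 / real (Suc m))" using H q by blast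
      then show "\<forall>\<^sub>F k in sequentially. dist (Gs \<xi> k q - Gs \<xi> k (q + h)) 0 < e"
        by (rule eventually_mono) (use m in \<open>simp add: inverse_eq_divide\<close>)
    qed
  qed
qed

end

section \<open>Ball means and the macroscopic mean\<close>

text \<open>Countable quantifiers make the set where a sequence of measurable functions tends to 0
  visibly measurable, as the exchange of almost-everywhere quantifiers requires.\<close>

lemma tendsto_0_iff_countable:
  fixes X :: "nat \<Rightarrow> real"
  shows "X \<longlonglongrightarrow> 0 \<longleftrightarrow> (\<forall>m. \<exists>k0. \<forall>k. k0 \<le> k \<longrightarrow> \<bar>X k\<bar> < inverse (real (Suc m)))"
proof
  assume "X \<longlonglongrightarrow> 0"
  then show "\<forall>m. \<exists>k0. \<forall>k. k0 \<le> k \<longrightarrow> \<bar>X k\<bar> < inverse (real (Suc m))"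
    unfolding LIMSEQ_iff by (auto simp del: of_nat_Suc)
next
  assume H: "\<forall>m. \<exists>k0. \<forall>k. k0 \<le> k \<longrightarrow> \<bar>X k\<bar> < inverse (real (Suc m))"
  show "X \<longlonglongrightarrow> 0" unfolding LIMSEQ_iff
  proof (intro allI impI)
    fix r :: real assume "0 < r"
    then obtain m where "inverse (real (Suc m)) < r" using reals_Archimedean by blast
    moreover obtain k0 where "\<forall>k. k0 \<le> k \<longrightarrow> \<bar>X k\<bar> < inverse (real (Suc m))" using H by blast
    ultimately show "\<exists>no. \<forall>n\<ge>no. norm (X n - 0) < r" by (intro exI[of _ k0]) fastforce
  qed
qed

context weighted_points
begin

text \<open>In \<open>Gs_shift_tendsto\<close> the exceptional null set depends on \<open>h\<close>.
  Fubini exchanges the quantifiers: for almost every \<open>q\<close> there is convergence for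
  almost every \<open>h\<close>, and dominated convergence integrates it over every ball.\<close>

lemma Gs_ball_average:
  assumes xi: "0 < \<xi>"
  shows "AE q in lborel. \<forall>R. (\<lambda>k. \<integral>h. indicator (ball 0 R) h * \<bar>Gs \<xi> k q - Gs \<xi> k (q + h)\<bar> \<partial>lborel) \<longlonglongrightarrow> 0"
proof -
  let ?Q = "\<lambda>h q. (\<lambda>k. Gs \<xi> k q - Gs \<xi> k (q + h)) \<longlonglongrightarrow> 0"
  have pm: "(\<lambda>z. \<bar>Gs \<xi> k (snd z) - Gs \<xi> k (snd z + fst z)\<bar>) \<in> borel_measurable (lborel \<Otimes>\<^sub>M lborel)" for k
    by (intro borel_measurable_abs borel_measurable_diff measurable_compose[OF _ Gs_measurable] borel_measurable_add) simp_all
  have "{z \<in> space (lborel \<Otimes>\<^sub>M lborel). ?Q (fst z) (snd z)} \<in> sets (lborel \<Otimes>\<^sub>M (lborel :: 'a measure))"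
    unfolding tendsto_0_iff_countable
    by (intro sets.sets_Collect sets.sets_Collect_countable_All sets.sets_Collect_countable_Ex borel_measurable_less pm borel_measurable_const)
  then have "AE q in lborel. AE h in lborel. ?Q h q"
    using Gs_shift_tendsto[OF xi] by (subst lborel_pair.AE_commute[symmetric]) (auto intro!: AE_I2)
  then show ?thesis
  proof (rule AE_mp, intro AE_I2 impI allI)
    fix q R assume H: "AE h in lborel. ?Q h q"
    let ?s = "\<lambda>k h. indicator (ball 0 R) h * \<bar>Gs \<xi> k q - Gs \<xi> k (q + h)\<bar>"
    let ?\<kappa> = "measure lborel (cball (0::'a) (M + 1))"
    have "(\<lambda>k. \<integral>h. ?s k h \<partial>lborel) \<longlonglongrightarrow> (\<integral>h. 0 \<partial>(lborel :: 'a measure))"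
    proof (rule integral_dominated_convergence[where w = "\<lambda>h. ?\<kappa> * indicator (cball 0 R) h"])
      show "?s k \<in> borel_measurable lborel" for k
        by (intro borel_measurable_times borel_measurable_indicator borel_measurable_abs borel_measurable_diff
          measurable_compose[OF _ Gs_measurable] borel_measurable_add) simp_all
      show "integrable lborel (\<lambda>h. ?\<kappa> * indicator (cball (0::'a) R) h)" by (intro integrable_mult_right integrable_indicator_cball)
      show "AE h in lborel. (\<lambda>k. ?s k h) \<longlonglongrightarrow> 0"
        using H
      proof (rule AE_mp, intro AE_I2 impI)
        fix h assume "?Q h q"
        then have "(\<lambda>k. indicator (ball 0 R) h * \<bar>Gs \<xi> k q - Gs \<xi> k (q + h)\<bar>) \<longlonglongrightarrow> indicator (ball 0 R) h * \<bar>0\<bar>"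
          by (intro tendsto_intros)
        then show "(\<lambda>k. ?s k h) \<longlonglongrightarrow> 0" by simp
      qed
      show "AE h in lborel. norm (?s k h) \<le> ?\<kappa> * indicator (cball 0 R) h" for k
      proof (rule AE_I2)
        fix h
        have "\<bar>Gs \<xi> k q - Gs \<xi> k (q + h)\<bar> \<le> ?\<kappa>"
          using Gs_bounds[of \<xi> k q] Gs_bounds[of \<xi> k "q + h"] by linarith
        then show "norm (?s k h) \<le> ?\<kappa> * indicator (cball 0 R) h" by (auto simp: indicator_def)
      qed
    qed simp
    then show "(\<lambda>k. \<integral>h. ?s k h \<partial>lborel) \<longlonglongrightarrow> 0" by simp
  qed
qed

definition ball_int :: "real \<Rightarrow> nat \<Rightarrow> real \<Rightarrow> 'a \<Rightarrow> real" where
  "ball_int \<xi> k R c = (\<integral>h. indicator (ball 0 R) h * Gs \<xi> k (c + h) \<partial>lborel)"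

lemma ball_int_eq: "ball_int \<xi> k R c = (\<integral>z. indicator (ball c R) z * Gs \<xi> k z \<partial>lborel)"
proof -
  have "(\<integral>z. indicator (ball c R) z * Gs \<xi> k z \<partial>lborel) = (\<integral>h. indicator (ball c R) (h + c) * Gs \<xi> k (h + c) \<partial>lborel)"
    by (rule lborel_integral_translate[symmetric])
      (intro borel_measurable_times borel_measurable_indicator Gs_measurable ball_borel)
  also have "\<dots> = ball_int \<xi> k R c"
    unfolding ball_int_def by (intro Bochner_Integration.integral_cong) (auto simp: indicator_def dist_norm add.commute)
  finally show ?thesis by simp
qed

lemma Gs_ball_integrable: "integrable lborel (\<lambda>z. indicator (ball c R) z * Gs \<xi> k z)"
proof (rule integrable_bounded_support(1)[of _ "measure lborel (cball (0::'a) (M + 1))" c R])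
  show "\<bar>indicator (ball c R) z * Gs \<xi> k z\<bar> \<le> measure lborel (cball (0::'a) (M + 1))" for z
    using Gs_bounds[of \<xi> k z] by (auto simp: indicator_def)
qed (auto intro!: borel_measurable_times borel_measurable_indicator)

lemma integrable_indicator_ball: "integrable lborel (indicator (ball (c::'a) R) :: 'a \<Rightarrow> real)"
  by (intro integrable_real_indicator) (auto simp: emeasure_lborel_ball_finite[simplified])

lemma ball_int_measurable: "ball_int \<xi> k R \<in> borel_measurable borel"
proof -
  have "(\<lambda>(c, h). indicator (ball 0 R) h * Gs \<xi> k (c + h)) \<in> borel_measurable (borel \<Otimes>\<^sub>M lborel)"
    unfolding case_prod_beta
    by (intro borel_measurable_times measurable_compose[OF measurable_snd borel_measurable_indicator]
      measurable_compose[OF _ Gs_measurable] borel_measurable_add) simp_all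
  then show ?thesis unfolding ball_int_def[abs_def] by (intro lborel.borel_measurable_lebesgue_integral) simp
qed

lemma ball_int_bound:
  assumes "0 \<le> R"
  shows "\<bar>ball_int \<xi> k R c\<bar> \<le> measure lborel (cball (0::'a) (M + 1)) * (unit_ball_vol (real DIM('a)) * R ^ DIM('a))"
proof -
  have Gb: "\<bar>Gs \<xi> k z\<bar> \<le> measure lborel (cball (0::'a) (M + 1))" for z using Gs_bounds[of \<xi> k z] by simp
  have "\<bar>ball_int \<xi> k R c\<bar> \<le> measure lborel (cball (0::'a) (M + 1)) * measure lborel (cball c R)"
    unfolding ball_int_eq using Gb
    by (intro integrable_bounded_support(2)) (auto simp: indicator_def intro!: borel_measurable_times borel_measurable_indicator)
  then show ?thesis using assms by (simp add: content_cball)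
qed

lemma ball_int_integrable:
  assumes "0 \<le> R"
  shows "integrable lborel (\<lambda>c. indicator (ball (0::'a) S) c * ball_int \<xi> k R c)"
proof (rule integrable_bounded_support(1)[of _ "measure lborel (cball (0::'a) (M + 1)) * (unit_ball_vol (real DIM('a)) * R ^ DIM('a))" 0 S])
  show "\<bar>indicator (ball 0 S) c * ball_int \<xi> k R c\<bar> \<le> measure lborel (cball (0::'a) (M + 1)) * (unit_ball_vol (real DIM('a)) * R ^ DIM('a))" for c
    using ball_int_bound[OF assms, of \<xi> k c] by (auto simp: indicator_def intro: order_trans[OF abs_ge_zero])
qed (auto intro!: borel_measurable_times borel_measurable_indicator ball_int_measurable)

text \<open>\<open>Gs\<close> is bounded, and a point in exactly one of the two balls lies in the
  shell between the radii \<open>R\<close> and \<open>R + R1\<close> about the other centre.\<close>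

lemma ball_int_shift:
  assumes R: "0 \<le> R" "0 \<le> R1" and d: "dist c c' \<le> R1"
  shows "\<bar>ball_int \<xi> k R c - ball_int \<xi> k R c'\<bar>
    \<le> 2 * measure lborel (cball (0::'a) (M + 1)) * (unit_ball_vol (real DIM('a)) * ((R + R1) ^ DIM('a) - R ^ DIM('a)))"
proof -
  let ?\<kappa> = "measure lborel (cball (0::'a) (M + 1))"
  let ?g = "\<lambda>z. ?\<kappa> * ((indicator (ball c' (R + R1)) z - indicator (ball c' R) z) + (indicator (ball c (R + R1)) z - indicator (ball c R) z))"
  have gi: "integrable lborel ?g"
    by (intro integrable_mult_right Bochner_Integration.integrable_add Bochner_Integration.integrable_diff integrable_indicator_ball)
  have "\<bar>ball_int \<xi> k R c - ball_int \<xi> k R c'\<bar> = \<bar>\<integral>z. indicator (ball c R) z * Gs \<xi> k z - indicator (ball c' R) z * Gs \<xi> k z \<partial>lborel\<bar>"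
    unfolding ball_int_eq by (simp add: Gs_ball_integrable)
  also have "\<dots> \<le> (\<integral>z. \<bar>indicator (ball c R) z * Gs \<xi> k z - indicator (ball c' R) z * Gs \<xi> k z\<bar> \<partial>lborel)" by (rule integral_abs_bound)
  also have "\<dots> \<le> (\<integral>z. ?g z \<partial>lborel)"
  proof (rule integral_mono[OF _ gi])
    show "integrable lborel (\<lambda>z. \<bar>indicator (ball c R) z * Gs \<xi> k z - indicator (ball c' R) z * Gs \<xi> k z\<bar>)"
      by (intro integrable_abs Bochner_Integration.integrable_diff Gs_ball_integrable)
    fix z
    have i1: "dist c' z < R + R1" if "dist c z < R" using dist_triangle[of c' z c] d that by (simp add: dist_commute)
    have i2: "dist c z < R + R1" if "dist c' z < R" using dist_triangle[of c z c'] d that by (simp add: dist_commute)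
    show "\<bar>indicator (ball c R) z * Gs \<xi> k z - indicator (ball c' R) z * Gs \<xi> k z\<bar> \<le> ?g z"
      using Gs_bounds[of \<xi> k z] i1 i2 R by (auto simp: indicator_def)
  qed
  also have "\<dots> = ?\<kappa> * ((measure lborel (ball c' (R + R1)) - measure lborel (ball c' R)) + (measure lborel (ball c (R + R1)) - measure lborel (ball c R)))"
    by (simp add: integrable_indicator_ball)
  also have "\<dots> = 2 * ?\<kappa> * (unit_ball_vol (real DIM('a)) * ((R + R1) ^ DIM('a) - R ^ DIM('a)))"
    using R by (simp add: content_ball algebra_simps)
  finally show ?thesis .
qed

text \<open>The hypothesis covers the points \<open>z\<close> with \<open>z\<close> and
  \<open>z + y\<close> both outside \<open>near_P\<close>; on the rest, whose volume is proportional
  to \<open>rho k\<close>, the trivial bound on \<open>Gs\<close> is used.\<close>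

lemma ball_int_almost_period:
  assumes per: "\<And>q. q \<notin> near_P (rho k) \<Longrightarrow> q + y \<notin> near_P (rho k) \<Longrightarrow> \<bar>Gs \<xi> k q - Gs \<xi> k (q + y)\<bar> \<le> \<epsilon>"
    and R: "0 \<le> R" and eps: "0 \<le> \<epsilon>"
  shows "\<bar>ball_int \<xi> k R c - ball_int \<xi> k R (c + y)\<bar> \<le> \<epsilon> * (unit_ball_vol (real DIM('a)) * R ^ DIM('a))
    + 2 * measure lborel (cball (0::'a) (M + 1)) * (C0 * (R + 1) ^ DIM('a) * unit_ball_vol (real DIM('a)) * rho k)"
proof -
  let ?\<kappa> = "measure lborel (cball (0::'a) (M + 1))"
  let ?S = "\<lambda>h'. {q \<in> ball c R. q + h' \<in> near_P (rho k)}"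
  have meas: "?S h' \<in> sets borel" for h'
  proof -
    have "(\<lambda>q. q + h') -` near_P (rho k) \<inter> space borel \<in> sets (borel :: 'a measure)"
      by (intro measurable_sets[OF _ near_P_measurable]) simp
    moreover have "?S h' = ball c R \<inter> ((\<lambda>q. q + h') -` near_P (rho k) \<inter> space borel)" by auto
    ultimately show ?thesis by simp
  qed
  have fm: "?S h' \<in> fmeasurable lborel" for h'
    by (rule fmeasurableI2[of "ball c R"]) (use meas in \<open>auto simp: fmeasurable_def emeasure_lborel_ball_finite[simplified]\<close>)
  have si: "integrable lborel (indicator (?S h') :: 'a \<Rightarrow> real)" for h'
    using fm[of h'] by (intro integrable_real_indicator) (auto simp: fmeasurable_def)
  have sm: "measure lborel (?S h') \<le> C0 * (R + 1) ^ DIM('a) * unit_ball_vol (real DIM('a)) * rho k" for h'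
    using rho_pos rho_le_1 R by (rule near_P_measure)
  let ?g = "\<lambda>z. \<epsilon> * indicator (ball c R) z + ?\<kappa> * (indicator (?S 0) z + indicator (?S y) z)"
  have gi: "integrable lborel ?g"
    by (intro integrable_mult_right Bochner_Integration.integrable_add integrable_indicator_ball si)
  have sh: "ball_int \<xi> k R (c + y) = (\<integral>z. indicator (ball c R) z * Gs \<xi> k (z + y) \<partial>lborel)"
  proof -
    have "ball_int \<xi> k R (c + y) = (\<integral>z. indicator (ball (c + y) R) (z + y) * Gs \<xi> k (z + y) \<partial>lborel)"
      unfolding ball_int_eq by (rule lborel_integral_translate[symmetric])
        (intro borel_measurable_times borel_measurable_indicator Gs_measurable ball_borel)
    also have "\<dots> = (\<integral>z. indicator (ball c R) z * Gs \<xi> k (z + y) \<partial>lborel)"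
      by (intro Bochner_Integration.integral_cong) (auto simp: indicator_def dist_norm)
    finally show ?thesis .
  qed
  have i2: "integrable lborel (\<lambda>z. indicator (ball c R) z * Gs \<xi> k (z + y))"
  proof (rule integrable_bounded_support(1)[of _ ?\<kappa> c R])
    show "\<bar>indicator (ball c R) z * Gs \<xi> k (z + y)\<bar> \<le> ?\<kappa>" for z
      using Gs_bounds[of \<xi> k "z + y"] by (auto simp: indicator_def)
  qed (auto intro!: borel_measurable_times borel_measurable_indicator Gs_translate_measurable)
  have "\<bar>ball_int \<xi> k R c - ball_int \<xi> k R (c + y)\<bar> = \<bar>\<integral>z. indicator (ball c R) z * Gs \<xi> k z - indicator (ball c R) z * Gs \<xi> k (z + y) \<partial>lborel\<bar>"
    unfolding sh unfolding ball_int_eq by (simp add: Gs_ball_integrable i2)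
  also have "\<dots> \<le> (\<integral>z. \<bar>indicator (ball c R) z * Gs \<xi> k z - indicator (ball c R) z * Gs \<xi> k (z + y)\<bar> \<partial>lborel)" by (rule integral_abs_bound)
  also have "\<dots> \<le> (\<integral>z. ?g z \<partial>lborel)"
  proof (rule integral_mono[OF _ gi])
    show "integrable lborel (\<lambda>z. \<bar>indicator (ball c R) z * Gs \<xi> k z - indicator (ball c R) z * Gs \<xi> k (z + y)\<bar>)"
      by (intro integrable_abs Bochner_Integration.integrable_diff Gs_ball_integrable i2)
    fix z
    show "\<bar>indicator (ball c R) z * Gs \<xi> k z - indicator (ball c R) z * Gs \<xi> k (z + y)\<bar> \<le> ?g z"
    proof (cases "z \<in> ball c R")
      case True
      have b: "\<bar>Gs \<xi> k z - Gs \<xi> k (z + y)\<bar> \<le> ?\<kappa>" using Gs_bounds[of \<xi> k z] Gs_bounds[of \<xi> k "z + y"] by linarith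
      show ?thesis
      proof (cases "z \<in> near_P (rho k) \<or> z + y \<in> near_P (rho k)")
        case True
        then have "1 \<le> (indicator (?S 0) z + indicator (?S y) z :: real)" using \<open>z \<in> ball c R\<close> by (auto simp: indicator_def)
        then have "?\<kappa> * 1 \<le> ?\<kappa> * (indicator (?S 0) z + indicator (?S y) z)" by (intro mult_left_mono) auto
        then show ?thesis using b eps \<open>z \<in> ball c R\<close> by simp
      next
        case False
        then show ?thesis using per[of z] \<open>z \<in> ball c R\<close> by simp
      qed
    qed (simp add: indicator_def)
  qed
  also have "\<dots> = \<epsilon> * measure lborel (ball c R) + ?\<kappa> * (measure lborel (?S 0) + measure lborel (?S y))"
  proof -
    have "(\<integral>z. ?g z \<partial>lborel) = (\<integral>z. \<epsilon> * indicator (ball c R) z \<partial>lborel) + (\<integral>z. ?\<kappa> * (indicator (?S 0) z + indicator (?S y) z) \<partial>lborel)"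
      by (intro Bochner_Integration.integral_add integrable_mult_right Bochner_Integration.integrable_add integrable_indicator_ball si)
    also have "(\<integral>z. ?\<kappa> * (indicator (?S 0) z + indicator (?S y) z) \<partial>lborel) = ?\<kappa> * (measure lborel (?S 0) + measure lborel (?S y))"
      by (simp only: integral_mult_right_zero Bochner_Integration.integral_add[OF si si] Bochner_Integration.integral_indicator space_lborel space_borel Int_UNIV_right)
    finally show ?thesis by simp
  qed
  also have "\<dots> \<le> \<epsilon> * measure lborel (ball c R) + ?\<kappa> * (C0 * (R + 1) ^ DIM('a) * unit_ball_vol (real DIM('a)) * rho k + C0 * (R + 1) ^ DIM('a) * unit_ball_vol (real DIM('a)) * rho k)"
    by (intro add_left_mono mult_left_mono add_mono sm) simp
  finally show ?thesis using R by (simp add: content_ball mult_ac)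
qed

text \<open>The mean of the ball means over a large ball is the mean over that ball up to a boundary
  layer of width \<open>R\<close>: after exchanging the integrals, each \<open>h\<close> with
  \<open>norm h < R\<close> sees the large ball shifted by \<open>h\<close>.\<close>

lemma ball_int_Fubini:
  assumes R: "0 \<le> R" and S: "0 \<le> S"
  shows "\<bar>(\<integral>c. indicator (ball 0 S) c * ball_int \<xi> k R c \<partial>lborel) - measure lborel (ball (0::'a) R) * ball_int \<xi> k S 0\<bar>
    \<le> measure lborel (ball (0::'a) R) * (2 * measure lborel (cball (0::'a) (M + 1)) * (unit_ball_vol (real DIM('a)) * ((S + R) ^ DIM('a) - S ^ DIM('a))))"
proof -
  let ?\<kappa> = "measure lborel (cball (0::'a) (M + 1))"
  let ?E = "2 * ?\<kappa> * (unit_ball_vol (real DIM('a)) * ((S + R) ^ DIM('a) - S ^ DIM('a)))"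
  have Gb: "\<bar>Gs \<xi> k z\<bar> \<le> ?\<kappa>" for z using Gs_bounds[of \<xi> k z] by simp
  have "(\<integral>c. indicator (ball 0 S) c * ball_int \<xi> k R c \<partial>lborel)
    = (\<integral>c. (\<integral>h. indicator (ball 0 S) c * (indicator (ball 0 R) h * Gs \<xi> k (c + h)) \<partial>lborel) \<partial>lborel)"
    by (simp add: ball_int_def)
  also have "\<dots> = (\<integral>h. (\<integral>c. indicator (ball 0 S) c * (indicator (ball 0 R) h * Gs \<xi> k (c + h)) \<partial>lborel) \<partial>lborel)"
  proof (rule lborel_Fubini_bounded_support[of _ ?\<kappa> 0 S 0 R])
    show "(\<lambda>(c, h). indicator (ball 0 S) c * (indicator (ball 0 R) h * Gs \<xi> k (c + h))) \<in> borel_measurable (borel \<Otimes>\<^sub>M borel)"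
      unfolding case_prod_beta
      by (intro borel_measurable_times measurable_compose[OF measurable_snd borel_measurable_indicator]
        measurable_compose[OF measurable_fst borel_measurable_indicator] measurable_compose[OF _ Gs_measurable] borel_measurable_add) simp_all
    show "\<bar>indicator (ball 0 S) c * (indicator (ball 0 R) h * Gs \<xi> k (c + h))\<bar> \<le> ?\<kappa>" for c h
      using Gb[of "c + h"] by (auto simp: indicator_def)
  qed (auto simp: indicator_def)
  also have "\<dots> = (\<integral>h. indicator (ball 0 R) h * ball_int \<xi> k S h \<partial>lborel)"
  proof (rule Bochner_Integration.integral_cong)
    fix h
    have "(\<integral>c. indicator (ball 0 S) c * (indicator (ball 0 R) h * Gs \<xi> k (c + h)) \<partial>lborel)
      = (\<integral>c. indicator (ball 0 R) h * (indicator (ball 0 S) c * Gs \<xi> k (h + c)) \<partial>lborel)"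
      by (intro Bochner_Integration.integral_cong) (simp_all add: add.commute)
    then show "(\<integral>c. indicator (ball 0 S) c * (indicator (ball 0 R) h * Gs \<xi> k (c + h)) \<partial>lborel) = indicator (ball 0 R) h * ball_int \<xi> k S h"
      by (simp add: ball_int_def)
  qed simp
  finally have eq: "(\<integral>c. indicator (ball 0 S) c * ball_int \<xi> k R c \<partial>lborel) = (\<integral>h. indicator (ball 0 R) h * ball_int \<xi> k S h \<partial>lborel)" .
  note bb = ball_int_bound[OF S, of \<xi> k]
  have bi: "integrable lborel (\<lambda>h. indicator (ball (0::'a) R) h * ball_int \<xi> k S h)"
  proof (rule integrable_bounded_support(1)[of _ "?\<kappa> * (unit_ball_vol (real DIM('a)) * S ^ DIM('a))" 0 R])
    show "\<bar>indicator (ball 0 R) h * ball_int \<xi> k S h\<bar> \<le> ?\<kappa> * (unit_ball_vol (real DIM('a)) * S ^ DIM('a))" for h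
      using bb[of h] by (auto simp: indicator_def intro: order_trans[OF abs_ge_zero])
  qed (auto intro!: borel_measurable_times borel_measurable_indicator ball_int_measurable)
  have "(\<integral>h. indicator (ball 0 R) h * ball_int \<xi> k S h \<partial>lborel) - measure lborel (ball (0::'a) R) * ball_int \<xi> k S 0
    = (\<integral>h. indicator (ball 0 R) h * ball_int \<xi> k S h - ball_int \<xi> k S 0 * indicator (ball 0 R) h \<partial>lborel)"
    using bi integrable_indicator_ball[of 0 R] by simp
  also have "\<bar>\<dots>\<bar> \<le> (\<integral>h. \<bar>indicator (ball 0 R) h * ball_int \<xi> k S h - ball_int \<xi> k S 0 * indicator (ball 0 R) h\<bar> \<partial>lborel)" by (rule integral_abs_bound)
  also have "\<dots> \<le> (\<integral>h. ?E * indicator (ball (0::'a) R) h \<partial>lborel)"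
  proof (rule integral_mono)
    show "integrable lborel (\<lambda>h. \<bar>indicator (ball 0 R) h * ball_int \<xi> k S h - ball_int \<xi> k S 0 * indicator (ball 0 R) h\<bar>)"
      by (intro integrable_abs Bochner_Integration.integrable_diff bi integrable_mult_right integrable_indicator_ball)
    show "integrable lborel (\<lambda>h. ?E * indicator (ball (0::'a) R) h)"
      by (intro integrable_mult_right integrable_indicator_ball)
    fix h
    show "\<bar>indicator (ball 0 R) h * ball_int \<xi> k S h - ball_int \<xi> k S 0 * indicator (ball 0 R) h\<bar> \<le> ?E * indicator (ball 0 R) h"
      using ball_int_shift[OF S R, of h 0 \<xi> k] by (auto simp: indicator_def)
  qed
  also have "\<dots> = measure lborel (ball (0::'a) R) * ?E" by (simp add: mult.commute)
  finally show ?thesis unfolding eq .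
qed

text \<open>Every centre \<open>c\<close> lies within \<open>R1\<close> of \<open>q + y\<close> for
  some almost period \<open>y\<close>, so the ball means at \<open>c\<close> and at \<open>q\<close>
  agree up to an error uniform in both. Averaging over \<open>c\<close> in the ball of radius
  \<open>S k\<close> turns the ball means into the macroscopic mean. \<open>R\<close> only has to be
  large against \<open>R1\<close> and is chosen before \<open>q\<close>.\<close>

lemma ball_mean_near_macro_mean:
  assumes xi: "0 < \<xi>" and eps: "0 < \<epsilon>"
    and macro: "(\<lambda>k. ball_int \<xi> k (1 / rho k ^ (DIM('a) - 1)) 0 / measure lborel (ball (0::'a) (1 / rho k ^ (DIM('a) - 1)))) \<longlonglongrightarrow> m"
  obtains R where "0 < R" "\<And>q. \<forall>\<^sub>F k in sequentially. \<bar>ball_int \<xi> k R q / measure lborel (ball (0::'a) R) - m\<bar> < 3 * \<epsilon>"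
proof -
  let ?d = "DIM('a)" and ?\<omega> = "unit_ball_vol (real DIM('a))"
  define \<kappa> where "\<kappa> = measure lborel (cball (0::'a) (M + 1))"
  obtain Y R1 k0 where Y: "\<And>c. \<exists>y\<in>Y. dist c y \<le> R1"
    "\<And>k y q. k0 \<le> k \<Longrightarrow> y \<in> Y \<Longrightarrow> q \<notin> near_P (rho k) \<Longrightarrow> q + y \<notin> near_P (rho k) \<Longrightarrow>
      \<bar>Gs \<xi> k q - Gs \<xi> k (q + y)\<bar> \<le> \<epsilon>" using Gs_almost_period[OF xi eps] by blast
  have R1: "0 \<le> R1" using Y(1)[of 0] by (meson order_trans zero_le_dist)
  have om: "0 < ?\<omega>" by simp
  have "(\<lambda>n. 2 * \<kappa> * ((1 + R1 * inverse (real (Suc n))) ^ ?d - 1)) \<longlonglongrightarrow> 2 * \<kappa> * ((1 + R1 * 0) ^ ?d - 1)"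
    by (intro tendsto_intros LIMSEQ_inverse_real_of_nat)
  then have "\<forall>\<^sub>F n in sequentially. 2 * \<kappa> * ((1 + R1 * inverse (real (Suc n))) ^ ?d - 1) < \<epsilon>"
    using eps by (intro order_tendstoD(2)) auto
  then obtain n where n: "2 * \<kappa> * ((1 + R1 * inverse (real (Suc n))) ^ ?d - 1) < \<epsilon>"
    by (meson eventually_sequentially order_refl)
  define R where "R = real (Suc n)"
  have R: "0 < R" by (simp add: R_def)
  define S where "S k = 1 / rho k ^ (?d - 1)" for k
  have S: "0 < S k" for k using rho_pos by (simp add: S_def)
  \<comment> \<open>The four terms come from the shift by at most \<open>R1\<close>, the almost
    period, the neighbourhood \<open>near_P\<close> and the boundary layer of the large ball. The
    last two vanish in the limit, and the first is below \<open>\<epsilon>\<close> by the choice of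
    \<open>R\<close>.\<close>
  define Er where "Er k = 2 * \<kappa> * ((1 + R1 / R) ^ ?d - 1) + \<epsilon> + (2 * \<kappa> * C0 * (R + 1) ^ ?d / R ^ ?d) * rho k
    + 2 * \<kappa> * ((1 + R * rho k ^ (?d - 1)) ^ ?d - 1)" for k
  have "Er \<longlonglongrightarrow> 2 * \<kappa> * ((1 + R1 / R) ^ ?d - 1) + \<epsilon> + (2 * \<kappa> * C0 * (R + 1) ^ ?d / R ^ ?d) * 0
    + 2 * \<kappa> * ((1 + R * 0 ^ (?d - 1)) ^ ?d - 1)"
    unfolding Er_def[abs_def] by (intro tendsto_intros rho_tendsto_0)
  moreover have "2 * \<kappa> * ((1 + R1 / R) ^ ?d - 1) + \<epsilon> + (2 * \<kappa> * C0 * (R + 1) ^ ?d / R ^ ?d) * 0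
    + 2 * \<kappa> * ((1 + R * 0 ^ (?d - 1)) ^ ?d - 1) < 2 * \<epsilon>"
  proof -
    have z: "(0::real) ^ (?d - 1) = 0" using dim by simp
    show ?thesis using n unfolding z R_def by (simp add: divide_inverse)
  qed
  ultimately have ErE: "\<forall>\<^sub>F k in sequentially. Er k < 2 * \<epsilon>" by (rule order_tendstoD)
  have main: "\<bar>ball_int \<xi> k (S k) 0 / measure lborel (ball (0::'a) (S k)) - ball_int \<xi> k R q / measure lborel (ball (0::'a) R)\<bar> \<le> Er k"
    if k: "k0 \<le> k" for k q
  proof -
    define E where "E = 2 * \<kappa> * (?\<omega> * ((R + R1) ^ ?d - R ^ ?d)) + (\<epsilon> * (?\<omega> * R ^ ?d) + 2 * \<kappa> * (C0 * (R + 1) ^ ?d * ?\<omega> * rho k))"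
    have near: "\<bar>ball_int \<xi> k R c - ball_int \<xi> k R q\<bar> \<le> E" for c
    proof -
      obtain y where y: "y \<in> Y" "dist (c - q) y \<le> R1" using Y(1) by blast
      have "dist c (q + y) \<le> R1" using y(2) by (simp add: dist_norm algebra_simps)
      then have "\<bar>ball_int \<xi> k R c - ball_int \<xi> k R (q + y)\<bar> \<le> 2 * \<kappa> * (?\<omega> * ((R + R1) ^ ?d - R ^ ?d))"
        unfolding \<kappa>_def using R R1 by (intro ball_int_shift) auto
      moreover have "\<bar>ball_int \<xi> k R q - ball_int \<xi> k R (q + y)\<bar> \<le> \<epsilon> * (?\<omega> * R ^ ?d) + 2 * \<kappa> * (C0 * (R + 1) ^ ?d * ?\<omega> * rho k)"
        unfolding \<kappa>_def using Y(2)[OF k y(1)] R eps by (intro ball_int_almost_period) auto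
      ultimately show ?thesis unfolding E_def by linarith
    qed
    let ?BS = "measure lborel (ball (0::'a) (S k))" and ?BR = "measure lborel (ball (0::'a) R)"
    have BS: "?BS = ?\<omega> * S k ^ ?d" and BR: "?BR = ?\<omega> * R ^ ?d" using S[of k] R by (simp_all add: content_ball)
    have bpos: "0 < ?BS" "0 < ?BR" unfolding BS BR using S[of k] R om by simp_all
    have bi: "integrable lborel (\<lambda>c. indicator (ball 0 (S k)) c * ball_int \<xi> k R c)" using R by (intro ball_int_integrable) simp
    have "(\<integral>c. indicator (ball 0 (S k)) c * ball_int \<xi> k R c \<partial>lborel) - ?BS * ball_int \<xi> k R q
      = (\<integral>c. indicator (ball 0 (S k)) c * ball_int \<xi> k R c - ball_int \<xi> k R q * indicator (ball 0 (S k)) c \<partial>lborel)"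
      using bi integrable_indicator_ball[of 0 "S k"] by simp
    also have "\<bar>\<dots>\<bar> \<le> (\<integral>c. \<bar>indicator (ball 0 (S k)) c * ball_int \<xi> k R c - ball_int \<xi> k R q * indicator (ball 0 (S k)) c\<bar> \<partial>lborel)"
      by (rule integral_abs_bound)
    also have "\<dots> \<le> (\<integral>c. E * indicator (ball (0::'a) (S k)) c \<partial>lborel)"
    proof (rule integral_mono)
      show "integrable lborel (\<lambda>c. \<bar>indicator (ball 0 (S k)) c * ball_int \<xi> k R c - ball_int \<xi> k R q * indicator (ball 0 (S k)) c\<bar>)"
        by (intro integrable_abs Bochner_Integration.integrable_diff bi integrable_mult_right integrable_indicator_ball)
      show "integrable lborel (\<lambda>c. E * indicator (ball (0::'a) (S k)) c)" by (intro integrable_mult_right integrable_indicator_ball)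
      fix c
      show "\<bar>indicator (ball 0 (S k)) c * ball_int \<xi> k R c - ball_int \<xi> k R q * indicator (ball 0 (S k)) c\<bar> \<le> E * indicator (ball 0 (S k)) c"
        using near[of c] by (auto simp: indicator_def)
    qed
    also have "\<dots> = ?BS * E" by (simp add: mult.commute)
    finally have a: "\<bar>(\<integral>c. indicator (ball 0 (S k)) c * ball_int \<xi> k R c \<partial>lborel) - ?BS * ball_int \<xi> k R q\<bar> \<le> ?BS * E" .
    have b: "\<bar>(\<integral>c. indicator (ball 0 (S k)) c * ball_int \<xi> k R c \<partial>lborel) - ?BR * ball_int \<xi> k (S k) 0\<bar>
      \<le> ?BR * (2 * \<kappa> * (?\<omega> * ((S k + R) ^ ?d - S k ^ ?d)))"
      unfolding \<kappa>_def using R S[of k] by (intro ball_int_Fubini) auto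
    have "\<bar>?BR * ball_int \<xi> k (S k) 0 - ?BS * ball_int \<xi> k R q\<bar> \<le> ?BS * E + ?BR * (2 * \<kappa> * (?\<omega> * ((S k + R) ^ ?d - S k ^ ?d)))"
      using a b by linarith
    then have "\<bar>?BR * ball_int \<xi> k (S k) 0 - ?BS * ball_int \<xi> k R q\<bar> / (?BR * ?BS)
      \<le> (?BS * E + ?BR * (2 * \<kappa> * (?\<omega> * ((S k + R) ^ ?d - S k ^ ?d)))) / (?BR * ?BS)"
      using bpos by (intro divide_right_mono) auto
    also have "\<bar>?BR * ball_int \<xi> k (S k) 0 - ?BS * ball_int \<xi> k R q\<bar> / (?BR * ?BS)
      = \<bar>(?BR * ball_int \<xi> k (S k) 0 - ?BS * ball_int \<xi> k R q) / (?BR * ?BS)\<bar>" using bpos by (simp add: abs_mult)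
    also have "(?BR * ball_int \<xi> k (S k) 0 - ?BS * ball_int \<xi> k R q) / (?BR * ?BS) = ball_int \<xi> k (S k) 0 / ?BS - ball_int \<xi> k R q / ?BR"
      using bpos by (simp add: diff_divide_distrib)
    also have "(?BS * E + ?BR * (2 * \<kappa> * (?\<omega> * ((S k + R) ^ ?d - S k ^ ?d)))) / (?BR * ?BS)
      = E / ?BR + 2 * \<kappa> * (?\<omega> * ((S k + R) ^ ?d - S k ^ ?d)) / ?BS" using bpos by (simp add: add_divide_distrib)
    also have "E / ?BR = 2 * \<kappa> * ((1 + R1 / R) ^ ?d - 1) + \<epsilon> + (2 * \<kappa> * C0 * (R + 1) ^ ?d / R ^ ?d) * rho k"
    proof -
      have p: "(R + R1) ^ ?d = R ^ ?d * (1 + R1 / R) ^ ?d" using R by (simp add: distrib_left flip: power_mult_distrib)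
      have x: "?\<omega> \<noteq> 0" "R ^ ?d \<noteq> 0" using less_imp_neq[OF om] R by simp_all
      show ?thesis unfolding E_def BR p using x by (simp add: field_simps)
    qed
    also have "2 * \<kappa> * (?\<omega> * ((S k + R) ^ ?d - S k ^ ?d)) / ?BS = 2 * \<kappa> * ((1 + R * rho k ^ (?d - 1)) ^ ?d - 1)"
    proof -
      have p: "(S k + R) ^ ?d = S k ^ ?d * (1 + R / S k) ^ ?d" using S[of k] by (simp add: distrib_left flip: power_mult_distrib)
      have q: "R / S k = R * rho k ^ (?d - 1)" by (simp add: S_def)
      have x: "?\<omega> \<noteq> 0" "S k ^ ?d \<noteq> 0" using less_imp_neq[OF om] S[of k] by simp_all
      have "S k ^ ?d * (1 + R / S k) ^ ?d - S k ^ ?d = S k ^ ?d * ((1 + R / S k) ^ ?d - 1)" by (simp add: right_diff_distrib)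
      then show ?thesis unfolding BS p q[symmetric] using x by simp
    qed
    finally show ?thesis unfolding Er_def by simp
  qed
  have "\<forall>\<^sub>F k in sequentially. \<bar>ball_int \<xi> k R q / measure lborel (ball (0::'a) R) - m\<bar> < 3 * \<epsilon>" for q
  proof -
    have "\<forall>\<^sub>F k in sequentially. dist (ball_int \<xi> k (S k) 0 / measure lborel (ball (0::'a) (S k))) m < \<epsilon>"
      using tendstoD[OF macro eps] by (simp add: S_def)
    then show ?thesis using ErE eventually_ge_at_top[of k0]
    proof eventually_elim
      case (elim k)
      then show ?case using main[of k q] unfolding dist_real_def by linarith
    qed
  qed
  then show ?thesis using that R by blast
qed

text \<open>\<open>Gs_ball_average\<close> holds for all radii outside one null set, so the radius
  may be chosen afterwards, according to the tolerance \<open>e\<close>.\<close>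

lemma Gs_tendsto:
  assumes xi: "0 < \<xi>"
    and macro: "(\<lambda>k. ball_int \<xi> k (1 / rho k ^ (DIM('a) - 1)) 0 / measure lborel (ball (0::'a) (1 / rho k ^ (DIM('a) - 1)))) \<longlonglongrightarrow> m"
  shows "AE q in lborel. (\<lambda>k. Gs \<xi> k q) \<longlonglongrightarrow> m"
  using Gs_ball_average[OF xi]
proof (rule AE_mp, intro AE_I2 impI)
  fix q assume H: "\<forall>R. (\<lambda>k. \<integral>h. indicator (ball 0 R) h * \<bar>Gs \<xi> k q - Gs \<xi> k (q + h)\<bar> \<partial>lborel) \<longlonglongrightarrow> 0"
  show "(\<lambda>k. Gs \<xi> k q) \<longlonglongrightarrow> m"
  proof (rule tendstoI)
    fix e :: real assume e: "0 < e"
    define \<epsilon> where "\<epsilon> = e / 4"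
    have eps: "0 < \<epsilon>" using e by (simp add: \<epsilon>_def)
    obtain R where R: "0 < R" "\<And>q. \<forall>\<^sub>F k in sequentially. \<bar>ball_int \<xi> k R q / measure lborel (ball (0::'a) R) - m\<bar> < 3 * \<epsilon>"
      using ball_mean_near_macro_mean[OF xi eps macro] by blast
    let ?BR = "measure lborel (ball (0::'a) R)"
    have BR: "0 < ?BR" using R(1) by (rule content_ball_pos)
    have "\<forall>\<^sub>F k in sequentially. (\<integral>h. indicator (ball 0 R) h * \<bar>Gs \<xi> k q - Gs \<xi> k (q + h)\<bar> \<partial>lborel) < \<epsilon> * ?BR"
      using H BR eps by (intro order_tendstoD(2)[of _ 0]) auto
    then show "\<forall>\<^sub>F k in sequentially. dist (Gs \<xi> k q) m < e" using R(2)[of q]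
    proof eventually_elim
      case (elim k)
      have i1: "integrable lborel (\<lambda>h. indicator (ball 0 R) h * Gs \<xi> k (q + h))"
      proof (rule integrable_bounded_support(1)[of _ "measure lborel (cball (0::'a) (M + 1))" 0 R])
        show "\<bar>indicator (ball 0 R) h * Gs \<xi> k (q + h)\<bar> \<le> measure lborel (cball (0::'a) (M + 1))" for h
          using Gs_bounds[of \<xi> k "q + h"] by (auto simp: indicator_def)
      qed (auto intro!: borel_measurable_times borel_measurable_indicator measurable_compose[OF _ Gs_measurable])
      have "Gs \<xi> k q * ?BR - ball_int \<xi> k R q = (\<integral>h. Gs \<xi> k q * indicator (ball 0 R) h - indicator (ball 0 R) h * Gs \<xi> k (q + h) \<partial>lborel)"
        unfolding ball_int_def using i1 integrable_indicator_ball[of 0 R] by simp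
      also have "\<bar>\<dots>\<bar> \<le> (\<integral>h. \<bar>Gs \<xi> k q * indicator (ball 0 R) h - indicator (ball 0 R) h * Gs \<xi> k (q + h)\<bar> \<partial>lborel)" by (rule integral_abs_bound)
      also have "\<dots> = (\<integral>h. indicator (ball 0 R) h * \<bar>Gs \<xi> k q - Gs \<xi> k (q + h)\<bar> \<partial>lborel)"
        by (intro Bochner_Integration.integral_cong) (auto simp: indicator_def)
      also have "\<dots> < \<epsilon> * ?BR" by (rule elim(1))
      finally have "\<bar>Gs \<xi> k q * ?BR - ball_int \<xi> k R q\<bar> / ?BR < \<epsilon>" using BR by (simp add: divide_less_eq)
      also have "\<bar>Gs \<xi> k q * ?BR - ball_int \<xi> k R q\<bar> / ?BR = \<bar>(Gs \<xi> k q * ?BR - ball_int \<xi> k R q) / ?BR\<bar>"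
        using BR by simp
      also have "(Gs \<xi> k q * ?BR - ball_int \<xi> k R q) / ?BR = Gs \<xi> k q - ball_int \<xi> k R q / ?BR"
        using BR by (simp add: diff_divide_distrib)
      finally have "\<bar>Gs \<xi> k q - ball_int \<xi> k R q / ?BR\<bar> < \<epsilon>" .
      then show ?case using elim(2) unfolding dist_real_def \<epsilon>_def by linarith
    qed
  qed
qed

end

section \<open>From Lipschitz weights to integrable densities\<close>

text \<open>Weak-star convergence of \<open>f k\<close> to the constant \<open>c\<close>, tested
  against the single function \<open>\<Phi>\<close>.\<close>

definition L1_limit :: "(nat \<Rightarrow> 'a::euclidean_space \<Rightarrow> real) \<Rightarrow> real \<Rightarrow> ('a \<Rightarrow> real) \<Rightarrow> bool" where
  "L1_limit f c \<Phi> \<longleftrightarrow> (\<lambda>k. \<integral>x. \<Phi> x * f k x \<partial>lborel) \<longlonglongrightarrow> c * (\<integral>x. \<Phi> x \<partial>lborel)"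

context
  fixes f :: "nat \<Rightarrow> 'a::euclidean_space \<Rightarrow> real" and c :: real
  assumes f_measurable [measurable]: "\<And>k. f k \<in> borel_measurable borel"
    and f_nonneg: "\<And>k x. 0 \<le> f k x" and f_le_1: "\<And>k x. f k x \<le> 1"
begin

lemma L1_limit_integrable: "integrable lborel \<Phi> \<Longrightarrow> integrable lborel (\<lambda>x. \<Phi> x * f k x)"
  by (rule Bochner_Integration.integrable_bound[of lborel \<Phi>])
    (use f_nonneg f_le_1 in \<open>auto simp: abs_mult mult_left_le intro!: borel_measurable_times f_measurable\<close>)

text \<open>Because \<open>0 \<le> f k \<le> 1\<close>, an error in the \<open>L1\<close> norm of
  \<open>\<Phi>\<close> enters the integrals with factor at most 1, uniformly in \<open>k\<close>,
  and the limit with factor \<open>\<bar>c\<bar>\<close>. The admissible \<open>\<Phi>\<close>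
  therefore form a closed set in \<open>L1\<close>.\<close>

lemma L1_limit_approx:
  assumes \<Phi>: "integrable lborel \<Phi>"
    and approx: "\<And>\<epsilon>. 0 < \<epsilon> \<Longrightarrow> \<exists>\<Psi>. integrable lborel \<Psi> \<and> L1_limit f c \<Psi> \<and> (\<integral>x. \<bar>\<Phi> x - \<Psi> x\<bar> \<partial>lborel) \<le> \<epsilon>"
  shows "L1_limit f c \<Phi>"
  unfolding L1_limit_def
proof (rule tendstoI)
  fix e :: real assume e: "0 < e"
  \<comment> \<open>The three errors
    \<open>\<epsilon> + \<epsilon> + \<bar>c\<bar> * \<epsilon>\<close> add up to
    \<open>e / 2\<close>.\<close>
  define \<epsilon> where "\<epsilon> = e / (2 * (2 + \<bar>c\<bar>))"
  have eps: "0 < \<epsilon>" using e by (simp add: \<epsilon>_def)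
  obtain \<Psi> where \<Psi>: "integrable lborel \<Psi>" "L1_limit f c \<Psi>" "(\<integral>x. \<bar>\<Phi> x - \<Psi> x\<bar> \<partial>lborel) \<le> \<epsilon>"
    using approx[OF eps] by blast
  have a: "\<bar>(\<integral>x. \<Phi> x * f k x \<partial>lborel) - (\<integral>x. \<Psi> x * f k x \<partial>lborel)\<bar> \<le> \<epsilon>" for k
  proof -
    have "\<bar>(\<integral>x. \<Phi> x * f k x \<partial>lborel) - (\<integral>x. \<Psi> x * f k x \<partial>lborel)\<bar> = \<bar>\<integral>x. \<Phi> x * f k x - \<Psi> x * f k x \<partial>lborel\<bar>"
      using \<Phi> \<Psi>(1) by (simp add: L1_limit_integrable)
    also have "\<dots> \<le> (\<integral>x. \<bar>\<Phi> x * f k x - \<Psi> x * f k x\<bar> \<partial>lborel)" by (rule integral_abs_bound)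
    also have "\<dots> \<le> (\<integral>x. \<bar>\<Phi> x - \<Psi> x\<bar> \<partial>lborel)"
    proof (rule integral_mono)
      fix x
      have "\<bar>\<Phi> x * f k x - \<Psi> x * f k x\<bar> = \<bar>\<Phi> x - \<Psi> x\<bar> * f k x"
        using f_nonneg[of k x] by (simp add: abs_mult flip: left_diff_distrib)
      also have "\<dots> \<le> \<bar>\<Phi> x - \<Psi> x\<bar>" using f_nonneg f_le_1 by (simp add: mult_left_le)
      finally show "\<bar>\<Phi> x * f k x - \<Psi> x * f k x\<bar> \<le> \<bar>\<Phi> x - \<Psi> x\<bar>" .
    qed (use \<Phi> \<Psi>(1) in \<open>auto intro!: integrable_abs Bochner_Integration.integrable_diff L1_limit_integrable\<close>)
    also have "\<dots> \<le> \<epsilon>" by (rule \<Psi>(3))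
    finally show ?thesis .
  qed
  have b: "\<bar>(\<integral>x. \<Phi> x \<partial>lborel) - (\<integral>x. \<Psi> x \<partial>lborel)\<bar> \<le> \<epsilon>"
    using integral_abs_bound[of lborel "\<lambda>x. \<Phi> x - \<Psi> x"] \<Phi> \<Psi>(1,3) by simp
  have "\<forall>\<^sub>F k in sequentially. dist (\<integral>x. \<Psi> x * f k x \<partial>lborel) (c * (\<integral>x. \<Psi> x \<partial>lborel)) < \<epsilon>"
    using \<Psi>(2) eps unfolding L1_limit_def by (rule tendstoD)
  then show "\<forall>\<^sub>F k in sequentially. dist (\<integral>x. \<Phi> x * f k x \<partial>lborel) (c * (\<integral>x. \<Phi> x \<partial>lborel)) < e"
  proof (rule eventually_mono)
    fix k assume k: "dist (\<integral>x. \<Psi> x * f k x \<partial>lborel) (c * (\<integral>x. \<Psi> x \<partial>lborel)) < \<epsilon>"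
    have "\<bar>c * (\<integral>x. \<Phi> x \<partial>lborel) - c * (\<integral>x. \<Psi> x \<partial>lborel)\<bar> \<le> \<bar>c\<bar> * \<epsilon>"
      using b by (simp add: abs_mult mult_left_mono flip: right_diff_distrib)
    then have "dist (\<integral>x. \<Phi> x * f k x \<partial>lborel) (c * (\<integral>x. \<Phi> x \<partial>lborel)) < \<epsilon> + \<epsilon> + \<bar>c\<bar> * \<epsilon>"
      using a[of k] k unfolding dist_real_def by linarith
    also have "\<dots> = (2 + \<bar>c\<bar>) * \<epsilon>" by (simp add: algebra_simps)
    also have "\<dots> = e / 2"
    proof -
      have "2 + \<bar>c\<bar> \<noteq> 0" by linarith
      then show ?thesis unfolding \<epsilon>_def by (simp add: divide_simps)
    qed
    also have "\<dots> < e" using e by simp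
    finally show "dist (\<integral>x. \<Phi> x * f k x \<partial>lborel) (c * (\<integral>x. \<Phi> x \<partial>lborel)) < e" .
  qed
qed

lemma L1_limit_dominated:
  assumes s: "\<And>i. integrable lborel (s i)" "\<And>i. L1_limit f c (s i)"
    and lim: "\<And>x. (\<lambda>i. s i x) \<longlonglongrightarrow> \<Phi> x" and w: "integrable lborel w" and dom: "\<And>i x. \<bar>s i x\<bar> \<le> w x"
    and \<Phi>: "integrable lborel \<Phi>"
  shows "L1_limit f c \<Phi>"
proof (rule L1_limit_approx[OF \<Phi>])
  fix \<epsilon> :: real assume eps: "0 < \<epsilon>"
  have domP: "\<bar>\<Phi> x\<bar> \<le> w x" for x
    using lim[of x] dom by (intro LIMSEQ_le_const2[OF tendsto_rabs[OF lim[of x]]]) auto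
  have "(\<lambda>i. \<integral>x. \<bar>\<Phi> x - s i x\<bar> \<partial>lborel) \<longlonglongrightarrow> (\<integral>x. 0 \<partial>(lborel :: 'a measure))"
  proof (rule integral_dominated_convergence[where w = "\<lambda>x. 2 * w x"])
    show "AE x in lborel. (\<lambda>i. \<bar>\<Phi> x - s i x\<bar>) \<longlonglongrightarrow> 0"
    proof (rule AE_I2)
      fix x show "(\<lambda>i. \<bar>\<Phi> x - s i x\<bar>) \<longlonglongrightarrow> 0"
        using tendsto_rabs[OF tendsto_diff[OF tendsto_const[of "\<Phi> x"] lim[of x]]] by simp
    qed
    show "AE x in lborel. norm \<bar>\<Phi> x - s i x\<bar> \<le> 2 * w x" for i
    proof (rule AE_I2)
      fix x show "norm \<bar>\<Phi> x - s i x\<bar> \<le> 2 * w x" using dom[of i x] domP[of x] by simp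
    qed
  qed (use s(1) \<Phi> w in \<open>auto intro!: borel_measurable_abs borel_measurable_diff dest: borel_measurable_integrable\<close>)
  then have "\<forall>\<^sub>F i in sequentially. (\<integral>x. \<bar>\<Phi> x - s i x\<bar> \<partial>lborel) < \<epsilon>"
    using eps by (intro order_tendstoD(2)[of _ 0]) auto
  then obtain i where "(\<integral>x. \<bar>\<Phi> x - s i x\<bar> \<partial>lborel) < \<epsilon>" by (meson eventually_sequentially order_refl)
  then show "\<exists>\<Psi>. integrable lborel \<Psi> \<and> L1_limit f c \<Psi> \<and> (\<integral>x. \<bar>\<Phi> x - \<Psi> x\<bar> \<partial>lborel) \<le> \<epsilon>"
    using s by (intro exI[of _ "s i"]) auto
qed

lemma L1_limit_add:
  assumes "integrable lborel \<Phi>" "integrable lborel \<Psi>" "L1_limit f c \<Phi>" "L1_limit f c \<Psi>"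
  shows "L1_limit f c (\<lambda>x. \<Phi> x + \<Psi> x)"
  using tendsto_add[OF assms(3,4)[unfolded L1_limit_def]] assms(1,2)
  unfolding L1_limit_def by (simp add: L1_limit_integrable distrib_left distrib_right)

lemma L1_limit_diff:
  assumes "integrable lborel \<Phi>" "integrable lborel \<Psi>" "L1_limit f c \<Phi>" "L1_limit f c \<Psi>"
  shows "L1_limit f c (\<lambda>x. \<Phi> x - \<Psi> x)"
  using tendsto_diff[OF assms(3,4)[unfolded L1_limit_def]] assms(1,2)
  unfolding L1_limit_def by (simp add: L1_limit_integrable left_diff_distrib right_diff_distrib)

lemma L1_limit_mult:
  assumes "L1_limit f c \<Phi>"
  shows "L1_limit f c (\<lambda>x. a * \<Phi> x)"
  using tendsto_mult[OF tendsto_const[of a] assms[unfolded L1_limit_def]]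
  unfolding L1_limit_def by (simp add: mult.assoc mult.left_commute)

text \<open>Dynkin's argument, carried out inside \<open>cball 0 (real n)\<close> so that
  complements and countable unions stay integrable. Dominated convergence removes the cutoff, and
  simple functions lead to all of \<open>L1\<close>.\<close>

lemma L1_limit_if_generator:
  assumes stable: "Int_stable \<G>" and gen: "sets (borel :: 'a measure) = sigma_sets UNIV \<G>"
    and balls: "\<And>n::nat. cball 0 (real n) \<in> \<G>"
    and fin: "\<And>A. A \<in> \<G> \<Longrightarrow> L1_limit f c (indicator A)"
    and \<Phi>: "integrable lborel \<Phi>"
  shows "L1_limit f c \<Phi>"
proof -
  have bi: "integrable lborel (indicator (A \<inter> cball 0 (real n)) :: 'a \<Rightarrow> real)" if "A \<in> sets borel" for A n
    using that emeasure_lborel_cball_finite[of "0::'a" "real n"]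
    by (intro integrable_real_indicator) (auto intro: le_less_trans[OF emeasure_mono])
  have sub: "\<G> \<subseteq> Pow UNIV" by simp
  have local: "L1_limit f c (indicator (A \<inter> cball 0 (real n)))" if A: "A \<in> sets borel" for A n
  proof -
    have "A \<in> sigma_sets UNIV \<G>" using A gen by simp
    with stable sub show ?thesis
    proof (induction A rule: sigma_sets_induct_disjoint)
      case (basic B)
      then show ?case using fin stable balls[of n] by (auto simp: Int_stable_def)
    next
      case empty then show ?case by (simp add: L1_limit_def)
    next
      case (compl B)
      then have B: "B \<in> sets borel" using gen by simp
      have "L1_limit f c (\<lambda>x. indicator (UNIV \<inter> cball 0 (real n)) x - indicator (B \<inter> cball 0 (real n)) x)"
        using bi[OF B] bi[of UNIV] compl.IH fin[OF balls] by (intro L1_limit_diff) auto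
      moreover have "(\<lambda>x. indicator (UNIV \<inter> cball 0 (real n)) x - indicator (B \<inter> cball 0 (real n)) x :: real) = indicator ((UNIV - B) \<inter> cball (0::'a) (real n))"
        by (auto simp: indicator_def fun_eq_iff)
      ultimately show ?case by simp
    next
      case (union B)
      then have B: "B i \<in> sets borel" for i using gen by auto
      define s where "s m = (\<lambda>x. \<Sum>i<m. indicator (B i \<inter> cball 0 (real n)) x :: real)" for m
      have sint: "integrable lborel (s m)" for m unfolding s_def using bi B by (intro Bochner_Integration.integrable_sum) auto
      have seq: "s m x = indicator ((\<Union>i<m. B i) \<inter> cball 0 (real n)) x" for m x
      proof -
        have "s m x = (\<Sum>i<m. indicator (B i) x) * indicator (cball 0 (real n)) x"
          by (simp add: s_def indicator_inter_arith sum_distrib_right)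
        also have "(\<Sum>i<m. indicator (B i) x) = (indicator (\<Union>i<m. B i) x :: real)"
          by (rule indicator_UN_disjoint[symmetric]) (use union(1) in \<open>auto simp: disjoint_family_on_def\<close>)
        finally show ?thesis by (simp add: indicator_inter_arith)
      qed
      show ?case
      proof (rule L1_limit_dominated[of s _ "indicator (cball 0 (real n))"])
        show "L1_limit f c (s m)" for m
        proof (induction m)
          case 0 then show ?case by (simp add: s_def L1_limit_def)
        next
          case (Suc m)
          have "s (Suc m) = (\<lambda>x. s m x + indicator (B m \<inter> cball 0 (real n)) x)" by (simp add: s_def)
          then show ?case using Suc sint bi[OF B] union(3) by (simp add: L1_limit_add)
        qed
        show "(\<lambda>m. s m x) \<longlonglongrightarrow> indicator ((\<Union>i. B i) \<inter> cball 0 (real n)) x" for x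
        proof (cases "\<exists>i. x \<in> B i")
          case True
          then obtain i where i: "x \<in> B i" by blast
          have "\<forall>\<^sub>F m in sequentially. s m x = indicator ((\<Union>i. B i) \<inter> cball 0 (real n)) x"
            using eventually_gt_at_top[of i]
          proof eventually_elim
            case (elim m)
            then show ?case unfolding seq using i by (auto simp: indicator_def)
          qed
          then show ?thesis by (rule tendsto_eventually)
        next
          case False then show ?thesis unfolding seq by (simp add: indicator_def)
        qed
        show "\<bar>s m x\<bar> \<le> indicator (cball 0 (real n)) x" for m x unfolding seq by (auto simp: indicator_def)
      qed (use sint bi[of "\<Union>i. B i" n] B in \<open>auto intro: integrable_indicator_cball\<close>)
    qed
  qed
  show ?thesis using \<Phi>
  proof (induction rule: integrable_induct)
    case (base A a)
    have "L1_limit f c (indicator A)"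
    proof (rule L1_limit_dominated[of "\<lambda>n. indicator (A \<inter> cball 0 (real n))" _ "indicator A"])
      show "(\<lambda>n. indicator (A \<inter> cball 0 (real n)) x :: real) \<longlonglongrightarrow> indicator A x" for x
      proof -
        obtain n0 :: nat where "norm x \<le> real n0" using real_arch_simple by blast
        then have "\<forall>\<^sub>F n in sequentially. indicator (A \<inter> cball 0 (real n)) x = (indicator A x :: real)"
          by (intro eventually_sequentiallyI[of n0]) (auto simp: indicator_def)
        then show ?thesis by (rule tendsto_eventually)
      qed
    qed (use base bi local in \<open>auto simp: indicator_def intro!: integrable_real_indicator\<close>)
    then have "L1_limit f c (\<lambda>x. a * indicator A x)" by (rule L1_limit_mult)
    then show ?case by (simp add: mult.commute)
  next
    case (add g h) then show ?case by (rule L1_limit_add)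
  next
    case (lim g s)
    then show ?case
      by (intro L1_limit_dominated[of s g "\<lambda>x. 2 * norm (g x)"]) auto
  qed
qed

end

text \<open>Countability later allows a single null set of starting points. The balls about 0 serve
  the cutoff in \<open>L1_limit_if_generator\<close>, and the balls are closed because Lipschitz
  bumps converge to indicators of closed sets.\<close>

lemma borel_generator_cballs:
  obtains \<B> :: "'a::euclidean_space set set" where "countable \<B>" "\<And>n::nat. cball 0 (real n) \<in> \<B>"
    "\<And>B. B \<in> \<B> \<Longrightarrow> \<exists>c r. B = cball c r" "sets (borel :: 'a measure) = sigma_sets UNIV \<B>"
proof -
  obtain D :: "'a set" where D: "countable D" "\<And>X. open X \<Longrightarrow> X \<noteq> {} \<Longrightarrow> \<exists>d\<in>D. d \<in> X"
    using countable_dense_setE by metis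
  define \<B> :: "'a set set" where "\<B> = (\<lambda>(c, r). cball c r) ` (D \<times> \<rat>) \<union> range (\<lambda>n::nat. cball 0 (real n))"
  have c: "countable \<B>" unfolding \<B>_def using D(1) countable_rat by (intro countable_Un countable_image countable_SIGMA) auto
  have sub: "\<B> \<subseteq> sets borel" unfolding \<B>_def by auto
  have "U \<in> sigma_sets UNIV \<B>" if U: "open U" for U
  proof -
    have "U = \<Union>{B \<in> \<B>. B \<subseteq> U}"
    proof (intro equalityI subsetI)
      fix x assume "x \<in> U"
      then obtain e where e: "0 < e" "ball x e \<subseteq> U" using U open_contains_ball by blast
      obtain r where r: "r \<in> \<rat>" "e / 4 < r" "r < e / 2" using Rats_dense_in_real[of "e / 4" "e / 2"] e(1) by auto
      obtain d where d: "d \<in> D" "d \<in> ball x (e / 4)" using D(2)[of "ball x (e / 4)"] e(1) by auto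
      have "x \<in> cball d r" using d r by (simp add: dist_commute)
      moreover have "cball d r \<subseteq> U"
      proof
        fix z assume "z \<in> cball d r"
        then have "dist x z < e" using dist_triangle[of x z d] d(2) r by simp
        then show "z \<in> U" using e(2) by auto
      qed
      moreover have "cball d r \<in> \<B>" unfolding \<B>_def using d(1) r(1) by auto
      ultimately show "x \<in> \<Union>{B \<in> \<B>. B \<subseteq> U}" by blast
    qed auto
    moreover have "\<Union>{B \<in> \<B>. B \<subseteq> U} \<in> sigma_sets UNIV \<B>"
      by (rule sigma_sets_UNION) (use c in \<open>auto intro: countable_subset[of _ \<B>]\<close>)
    ultimately show ?thesis by simp
  qed
  then have "sigma_sets UNIV {S. open S} \<subseteq> sigma_sets UNIV \<B>" by (intro sigma_sets_mono) auto
  moreover have "sigma_sets UNIV \<B> \<subseteq> sets borel" using sets.sigma_sets_subset[OF sub] by simp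
  ultimately have "sets (borel :: 'a measure) = sigma_sets UNIV \<B>" by (auto simp: sets_borel)
  moreover have "\<exists>c r. B = cball c r" if "B \<in> \<B>" for B using that by (auto simp: \<B>_def)
  moreover have "cball 0 (real n) \<in> \<B>" for n by (auto simp: \<B>_def)
  ultimately show ?thesis using that[OF c] by blast
qed

section \<open>The free path limit function\<close>

lemma tau1_ge_iff:
  assumes \<rho>: "0 < \<rho>"
  shows "ereal \<xi> \<le> ereal (\<rho> ^ n) * tau1 P q v \<rho> \<longleftrightarrow> tube_free P \<rho> (\<xi> / \<rho> ^ n) q v"
proof -
  have c: "0 < \<rho> ^ n" using \<rho> by simp
  have K: "x \<notin> K_rho P \<rho> \<longleftrightarrow> (\<exists>p\<in>P. dist x p < \<rho>)" for x
  proof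
    assume "x \<notin> K_rho P \<rho>"
    then obtain b p where bp: "x = b + p" "norm b < \<rho>" "p \<in> P" by (auto simp: K_rho_def)
    then have "dist x p < \<rho>" by (simp add: dist_norm)
    then show "\<exists>p\<in>P. dist x p < \<rho>" using bp(3) by blast
  next
    assume "\<exists>p\<in>P. dist x p < \<rho>"
    then obtain p where p: "p \<in> P" "dist x p < \<rho>" by blast
    have "x = (x - p) + p" "x - p \<in> ball 0 \<rho>" using p(2) by (simp_all add: dist_norm norm_minus_commute)
    then show "x \<notin> K_rho P \<rho>" unfolding K_rho_def using p(1) by blast
  qed
  have "ereal \<xi> \<le> ereal (\<rho> ^ n) * X \<longleftrightarrow> ereal (\<xi> / \<rho> ^ n) \<le> X" for X
  proof (cases X)
    case (real r)
    then show ?thesis using c by (simp add: pos_divide_le_eq mult.commute)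
  qed (use \<rho> in auto)
  then have "ereal \<xi> \<le> ereal (\<rho> ^ n) * tau1 P q v \<rho> \<longleftrightarrow> ereal (\<xi> / \<rho> ^ n) \<le> tau1 P q v \<rho>" .
  also have "\<dots> \<longleftrightarrow> (\<forall>t>0. q + t *\<^sub>R v \<notin> K_rho P \<rho> \<longrightarrow> \<xi> / \<rho> ^ n \<le> t)"
    unfolding tau1_def le_Inf_iff by (auto simp del: ereal_less_eq(3)) (simp_all, metis ereal_less_eq(3))
  also have "\<dots> \<longleftrightarrow> tube_free P \<rho> (\<xi> / \<rho> ^ n) q v"
    unfolding tube_free_def K by (meson not_le)
  finally show ?thesis .
qed

lemma lborel_integral_scale:
  fixes f :: "'a::euclidean_space \<Rightarrow> real"
  assumes f: "f \<in> borel_measurable borel" and c: "0 < c"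
  shows "(\<integral>x. f x \<partial>lborel) = c ^ DIM('a) * (\<integral>x. f (c *\<^sub>R x) \<partial>lborel)"
proof -
  have "(\<integral>x. f x \<partial>lborel) = (\<integral>x. f x \<partial>density (distr lborel borel (\<lambda>x. 0 + c *\<^sub>R x)) (\<lambda>_. ennreal (\<bar>c\<bar> ^ DIM('a))))"
    using lborel_affine[of c "0::'a"] c by simp
  also have "\<dots> = (\<integral>x. c ^ DIM('a) *\<^sub>R f x \<partial>distr lborel borel (\<lambda>x. 0 + c *\<^sub>R x))"
    using f c by (subst integral_density) auto
  also have "\<dots> = (\<integral>x. c ^ DIM('a) *\<^sub>R f (0 + c *\<^sub>R x) \<partial>lborel)"
    using f by (intro integral_distr) auto
  finally show ?thesis by simp
qed

lemma null_sets_scale: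
  fixes X :: "'a::euclidean_space set"
  assumes X: "X \<in> null_sets lborel" and c: "0 < c"
  shows "{x. (1 / c) *\<^sub>R x \<in> X} \<in> null_sets lborel"
proof -
  have Xb: "X \<in> sets borel" using X by auto
  have m: "{x. (1 / c) *\<^sub>R x \<in> X} \<in> sets borel"
    using measurable_sets[of "\<lambda>x. (1 / c) *\<^sub>R x" borel borel X] Xb by (simp add: vimage_def)
  have "emeasure lborel {x. (1 / c) *\<^sub>R x \<in> X} = emeasure (density (distr lborel borel (\<lambda>x. 0 + c *\<^sub>R x)) (\<lambda>_. ennreal (\<bar>c\<bar> ^ DIM('a)))) {x. (1 / c) *\<^sub>R x \<in> X}"
    using lborel_affine[of c "0::'a"] c by simp
  also have "\<dots> = ennreal (\<bar>c\<bar> ^ DIM('a)) * emeasure (distr lborel borel (\<lambda>x. 0 + c *\<^sub>R x)) {x. (1 / c) *\<^sub>R x \<in> X}"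
    using m by (intro emeasure_density_const) simp
  also have "emeasure (distr lborel borel (\<lambda>x. 0 + c *\<^sub>R x)) {x. (1 / c) *\<^sub>R x \<in> X} = emeasure lborel X"
    using m c by (subst emeasure_distr) (auto simp: vimage_def)
  finally show ?thesis using X m by (auto simp: null_sets_def)
qed

section \<open>The cone measure on the sphere and the macroscopic mean\<close>

lemma sgn_borel_measurable [measurable]: "(sgn :: 'a::euclidean_space \<Rightarrow> 'a) \<in> borel_measurable borel"
  unfolding sgn_div_norm[abs_def] by measurable

lemma sets_sphere_measure: "sets (sphere_measure :: (real^'d) measure) = sets borel"
  by (simp add: sphere_measure_def)

lemma sphere_measure_eq:
  "(sphere_measure :: (real^'d) measure) =
     density (distr (restrict_space lborel {x. 0 < norm x \<and> norm x \<le> 1}) borel sgn) (\<lambda>_. ennreal (real CARD('d)))"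
  unfolding sphere_measure_def by (simp add: sgn_div_norm[abs_def])

lemma punctured_ball_borel: "{x :: 'a::euclidean_space. 0 < norm x \<and> norm x \<le> 1} \<in> sets borel"
proof -
  have "{x :: 'a. 0 < norm x \<and> norm x \<le> 1} = cball 0 1 - {0}" by auto
  then show ?thesis by simp
qed

lemma finite_measure_sphere_measure: "finite_measure (sphere_measure :: (real^'d) measure)"
proof
  let ?U = "{x :: real^'d. 0 < norm x \<and> norm x \<le> 1}"
  have U: "?U \<in> sets borel" by (rule punctured_ball_borel)
  have sg: "sgn \<in> restrict_space lborel ?U \<rightarrow>\<^sub>M (borel :: (real^'d) measure)"
    by (rule measurable_restrict_space1) simp
  have "emeasure (sphere_measure :: (real^'d) measure) UNIV = ennreal (real CARD('d)) * emeasure (distr (restrict_space lborel ?U) borel sgn) UNIV"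
    unfolding sphere_measure_eq by (intro emeasure_density_const) simp
  also have "emeasure (distr (restrict_space lborel ?U) borel sgn) UNIV = emeasure lborel ?U"
    using U sg by (subst emeasure_distr) (auto simp: emeasure_restrict_space space_restrict_space)
  also have "ennreal (real CARD('d)) * emeasure lborel ?U < \<infinity>"
  proof -
    have "emeasure lborel ?U \<le> emeasure lborel (cball 0 1 :: (real^'d) set)" by (intro emeasure_mono) auto
    also have "\<dots> < \<infinity>" by (rule emeasure_lborel_cball_finite)
    finally show ?thesis by (simp add: ennreal_mult_less_top)
  qed
  finally show "emeasure (sphere_measure :: (real^'d) measure) (space sphere_measure) \<noteq> \<infinity>"
    by (simp add: sphere_measure_eq)
qed

text \<open>Inside the punctured unit ball the cone over \<open>E\<close> has volume 0 by the
  definition of the cone measure; dilations by \<open>n + 1\<close> reach the rest of it.\<close>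

lemma sphere_null_imp_cone_null:
  fixes E :: "(real^'d) set"
  assumes E: "E \<in> null_sets sphere_measure"
  shows "AE x in lborel. sgn x \<notin> E"
proof -
  let ?U = "{x :: real^'d. 0 < norm x \<and> norm x \<le> 1}"
  have U: "?U \<in> sets borel" by (rule punctured_ball_borel)
  have Eb: "E \<in> sets borel" using E sets_sphere_measure by auto
  have sg: "sgn \<in> restrict_space lborel ?U \<rightarrow>\<^sub>M (borel :: (real^'d) measure)"
    by (rule measurable_restrict_space1) simp
  have sE: "sgn -` E \<in> sets borel" using measurable_sets[OF sgn_borel_measurable Eb] by simp
  have "0 = emeasure sphere_measure E" using E by auto
  also have "\<dots> = ennreal (real CARD('d)) * emeasure (distr (restrict_space lborel ?U) borel sgn) E"
    unfolding sphere_measure_eq using Eb by (intro emeasure_density_const) simp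
  also have "emeasure (distr (restrict_space lborel ?U) borel sgn) E = emeasure lborel (sgn -` E \<inter> ?U)"
    using U sg Eb by (subst emeasure_distr) (auto simp: emeasure_restrict_space space_restrict_space)
  finally have N: "sgn -` E \<inter> ?U \<in> null_sets lborel"
    using sE U by (auto simp: null_sets_def)
  have "(\<Union>n. {x. (1 / real (Suc n)) *\<^sub>R x \<in> sgn -` E \<inter> ?U}) \<in> null_sets lborel"
    by (intro null_sets_UN null_sets_scale[OF N]) simp
  then have "AE x in lborel. x \<notin> (\<Union>n. {x. (1 / real (Suc n)) *\<^sub>R x \<in> sgn -` E \<inter> ?U})" by (rule AE_not_in)
  moreover have "AE x in lborel. x \<noteq> (0 :: real^'d)" by (rule AE_lborel_singleton)
  ultimately show ?thesis
  proof eventually_elim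
    case (elim x)
    show ?case
    proof
      assume xE: "sgn x \<in> E"
      obtain n where n: "norm x \<le> real (Suc n)" by (meson le_SucI of_nat_le_iff order_trans real_arch_simple lessI less_imp_le)
      have "sgn ((1 / real (Suc n)) *\<^sub>R x) = sgn x" by (simp add: sgn_scaleR)
      moreover have "norm ((1 / real (Suc n)) *\<^sub>R x) \<le> 1" "0 < norm ((1 / real (Suc n)) *\<^sub>R x)"
        using n elim(2) by (simp_all add: divide_le_eq)
      ultimately have "(1 / real (Suc n)) *\<^sub>R x \<in> sgn -` E \<inter> ?U" using xE elim(2) by (simp del: of_nat_Suc)
      then show False using elim(1) by blast
    qed
  qed
qed

text \<open>The event in \<open>free_path_limit\<close> also asks for a starting point in
  \<open>K_rho\<close>. A free tube of positive length implies this: from a point strictly inside a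
  scatterer, small \<open>t\<close> stays inside.\<close>

lemma tube_free_imp_K_rho:
  assumes l: "0 < l" and tf: "tube_free P \<rho> l q v" and v: "norm v = 1"
  shows "q \<in> K_rho P \<rho>"
proof (rule ccontr)
  assume "q \<notin> K_rho P \<rho>"
  then obtain b p where bp: "q = b + p" "norm b < \<rho>" "p \<in> P" by (auto simp: K_rho_def)
  define t where "t = min (l / 2) ((\<rho> - norm b) / 2)"
  have t: "0 < t" "t < l" "t \<le> (\<rho> - norm b) / 2" using l bp(2) by (auto simp: t_def min_def)
  have "dist (q + t *\<^sub>R v) p = norm (b + t *\<^sub>R v)" by (simp add: bp(1) dist_norm)
  also have "\<dots> \<le> norm b + t" using norm_triangle_ineq[of b "t *\<^sub>R v"] t v by simp
  also have "\<dots> < \<rho>" using t bp(2) by (simp add: field_simps)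
  finally show False using tf t bp(3) unfolding tube_free_def by (meson not_le)
qed

text \<open>The hypothesis on \<open>F\<close> is applied to the product of the uniform measure on
  the unit ball and the law of \<open>sgn x\<close> for \<open>x\<close> of density
  \<open>b / I\<close>. Scaling the first factor by \<open>S = 1 / \<rho> ^ (d - 1)\<close> turns
  the probability into the mean of \<open>Gs\<close> over the ball of radius \<open>S\<close>,
  divided by \<open>I\<close>.\<close>

lemma macro_mean_tendsto:
  fixes P :: "(real^'d) set"
  assumes wp: "weighted_points P C0 b K M" and lim: "free_path_limit P F" and xi: "0 < \<xi>"
  shows "(\<lambda>k. weighted_points.ball_int P b \<xi> k (1 / rho k ^ (DIM(real^'d) - 1)) 0 / measure lborel (ball (0::real^'d) (1 / rho k ^ (DIM(real^'d) - 1))))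
    \<longlonglongrightarrow> F \<xi> * (\<integral>x. b x \<partial>lborel)"
proof -
  interpret weighted_points P C0 b K M by (rule wp)
  let ?d = "CARD('d)"
  define I where "I = (\<integral>x. b x \<partial>lborel)"
  define B where "B = measure lborel (ball (0::real^'d) 1)"
  have B: "0 < B" unfolding B_def by (rule content_ball_pos) simp
  have I0: "0 \<le> I" unfolding I_def by (intro Bochner_Integration.integral_nonneg b_nonneg)
  show ?thesis
  proof (cases "I = 0")
    \<comment> \<open>A weight of integral 0 cannot be normalised; both sides are then 0.\<close>
    case True
    have "G \<rho> l q = 0" for \<rho> l q
    proof -
      have "G \<rho> l q \<le> I" unfolding G_def I_def
        by (intro integral_mono integrable_b_free_ind integrable_b mult_left_le free_ind_bounds b_nonneg)
      then show ?thesis using True G_nonneg[of \<rho> l q] by simp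
    qed
    then show ?thesis using True by (simp add: ball_int_def Gs_def I_def)
  next
    case False
    then have I: "0 < I" using I0 by simp
    define M1 where "M1 = density lborel (\<lambda>q::real^'d. ennreal (indicator (ball 0 1) q / B))"
    define M0 where "M0 = density lborel (\<lambda>x. ennreal (b x / I))"
    define M2 where "M2 = distr M0 borel sgn"
    have b1: "(\<lambda>q::real^'d. ennreal (indicator (ball 0 1) q / B)) \<in> borel_measurable lborel"
      by (intro measurable_compose[OF _ measurable_ennreal] borel_measurable_divide borel_measurable_indicator) simp_all
    have b2: "(\<lambda>x. ennreal (b x / I)) \<in> borel_measurable lborel" by simp
    have sM: "sets M1 = sets borel" "sets M0 = sets borel" "sets M2 = sets borel" by (simp_all add: M1_def M0_def M2_def)
    have sp: "space M1 = UNIV" "space M0 = UNIV" "space M2 = UNIV" by (simp_all add: M1_def M0_def M2_def)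
    have P1: "prob_space M1"
    proof
      have "emeasure M1 (space M1) = (\<integral>\<^sup>+q. ennreal (indicator (ball 0 1) q / B) \<partial>(lborel :: (real^'d) measure))"
        using b1 unfolding sp unfolding M1_def by (simp add: emeasure_density)
      also have "\<dots> = ennreal (\<integral>q. indicator (ball 0 1) q / B \<partial>(lborel :: (real^'d) measure))"
        using B by (intro nn_integral_eq_integral integrable_divide integrable_indicator_ball) simp
      also have "\<dots> = 1" using B by (simp add: B_def)
      finally show "emeasure M1 (space M1) = 1" .
    qed
    have P0: "prob_space M0"
    proof
      have "emeasure M0 (space M0) = (\<integral>\<^sup>+x. ennreal (b x / I) \<partial>lborel)"
        using b2 unfolding sp unfolding M0_def by (simp add: emeasure_density)
      also have "\<dots> = ennreal (\<integral>x. b x / I \<partial>lborel)"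
        using I b_nonneg by (intro nn_integral_eq_integral integrable_divide integrable_b) simp
      also have "\<dots> = 1" using I by (simp add: I_def)
      finally show "emeasure M0 (space M0) = 1" .
    qed
    have sg0: "sgn \<in> M0 \<rightarrow>\<^sub>M borel" using sgn_borel_measurable by (simp add: M0_def)
    have P2: "prob_space M2" unfolding M2_def by (rule prob_space.prob_space_distr[OF P0 sg0])
    interpret P1: prob_space M1 by (rule P1)
    interpret P2: prob_space M2 by (rule P2)
    interpret \<sigma>: finite_measure "sphere_measure :: (real^'d) measure" by (rule finite_measure_sphere_measure)
    have ac2: "absolutely_continuous sphere_measure M2"
      unfolding absolutely_continuous_def
    proof
      fix E :: "(real^'d) set" assume E: "E \<in> null_sets sphere_measure"
      have Eb: "E \<in> sets borel" using E sets_sphere_measure by auto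
      have "AE x in M0. sgn x \<notin> E"
        unfolding M0_def using sphere_null_imp_cone_null[OF E] by (subst AE_density[OF b2]) (auto elim: AE_mp)
      then have "AE v in M2. v \<notin> E" unfolding M2_def using Eb by (subst AE_distr_iff[OF sg0]) auto
      then show "E \<in> null_sets M2" using Eb sM sp by (subst AE_iff_null_sets) auto
    qed
    have ac1: "absolutely_continuous lborel M1"
      unfolding M1_def by (rule absolutely_continuousI_density) (rule b1)
    define \<Lambda> where "\<Lambda> = M1 \<Otimes>\<^sub>M M2"
    have sL: "sets \<Lambda> = sets (lborel \<Otimes>\<^sub>M (sphere_measure :: (real^'d) measure))"
      unfolding \<Lambda>_def by (intro sets_pair_measure_cong) (simp_all add: sM sets_sphere_measure)
    have sLb: "sets \<Lambda> = sets borel"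
      unfolding borel_prod[symmetric] \<Lambda>_def by (intro sets_pair_measure_cong) (simp_all add: sM)
    have pair12: "pair_sigma_finite M1 M2" ..
    have pairls: "pair_sigma_finite (lborel :: (real^'d) measure) (sphere_measure :: (real^'d) measure)" ..
    have acL: "absolutely_continuous (lborel \<Otimes>\<^sub>M (sphere_measure :: (real^'d) measure)) \<Lambda>"
      unfolding absolutely_continuous_def
    proof
      fix N :: "((real^'d) \<times> (real^'d)) set" assume N: "N \<in> null_sets (lborel \<Otimes>\<^sub>M (sphere_measure :: (real^'d) measure))"
      then have "AE z in lborel \<Otimes>\<^sub>M sphere_measure. z \<notin> N" by (rule AE_not_in)
      then have "AE q in lborel. AE v in sphere_measure. (q, v) \<notin> N"
        by (rule pair_sigma_finite.AE_pair[OF pairls])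
      then have "AE q in lborel. AE v in M2. (q, v) \<notin> N"
      proof eventually_elim
        case (elim q)
        then show ?case
          by (intro absolutely_continuous_AE[OF _ ac2]) (simp_all add: sM sets_sphere_measure)
      qed
      then have "AE q in M1. AE v in M2. (q, v) \<notin> N"
        by (intro absolutely_continuous_AE[OF _ ac1]) (simp_all add: sM)
      moreover have NL: "N \<in> sets \<Lambda>" unfolding sL using N by (rule null_setsD2)
      ultimately have "AE z in \<Lambda>. z \<notin> N"
        unfolding \<Lambda>_def
      proof (intro pair_sigma_finite.AE_pair_measure[OF pair12])
        have "{z \<in> space \<Lambda>. z \<notin> N} = space \<Lambda> - N" by blast
        then show "{z \<in> space (M1 \<Otimes>\<^sub>M M2). z \<notin> N} \<in> sets (M1 \<Otimes>\<^sub>M M2)"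
          using NL unfolding \<Lambda>_def by (simp only: sets.compl_sets)
      qed
      then show "N \<in> null_sets \<Lambda>" using NL by (simp only: AE_iff_null_sets[symmetric])
    qed
    have sph: "emeasure M2 (sphere 0 1) = 1"
    proof -
      have "AE x in lborel. x \<noteq> (0 :: real^'d)" by (rule AE_lborel_singleton)
      then have "AE x in lborel. 0 < ennreal (b x / I) \<longrightarrow> sgn x \<in> sphere 0 1"
        by eventually_elim (simp add: norm_sgn)
      then have "AE x in M0. sgn x \<in> sphere 0 1" unfolding M0_def AE_density[OF b2] .
      then have "AE v in M2. v \<in> sphere 0 1" unfolding M2_def by (subst AE_distr_iff[OF sg0]) auto
      then show ?thesis using P2.emeasure_eq_1_AE[of "sphere 0 1"] by (simp add: sM)
    qed
    have ac: "ac_T1_prob \<Lambda>"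
      unfolding ac_T1_prob_def
    proof (intro conjI sL acL)
      show "prob_space \<Lambda>" unfolding \<Lambda>_def by (rule prob_space_pair[OF P1 P2])
      have "emeasure \<Lambda> (UNIV \<times> sphere 0 1) = emeasure M1 UNIV * emeasure M2 (sphere 0 1)"
        unfolding \<Lambda>_def by (rule P2.emeasure_pair_measure_Times) (simp_all add: sM)
      then show "emeasure \<Lambda> (UNIV \<times> sphere 0 1) = 1" using sph P1.emeasure_space_1 sp by simp
    qed
    have val: "measure \<Lambda> {(q, v). v \<in> sphere 0 1 \<and> (1 / rho k ^ (?d - 1)) *\<^sub>R q \<in> K_rho P (rho k) \<and>
        ereal (rho k ^ (?d - 1)) * tau1 P ((1 / rho k ^ (?d - 1)) *\<^sub>R q) v (rho k) \<ge> ereal \<xi>}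
      = ball_int \<xi> k (1 / rho k ^ (?d - 1)) 0 / measure lborel (ball (0::real^'d) (1 / rho k ^ (?d - 1))) / I" for k
    proof -
      define S where "S = 1 / rho k ^ (?d - 1)"
      define l where "l = \<xi> / rho k ^ (?d - 1)"
      have S: "0 < S" and l: "0 < l" using rho_pos[of k] xi by (simp_all add: S_def l_def)
      define A where "A = {(q, v :: real^'d). v \<in> sphere 0 1 \<and> tube_free P (rho k) l (S *\<^sub>R q) v}"
      have Aeq: "{(q, v). v \<in> sphere 0 1 \<and> S *\<^sub>R q \<in> K_rho P (rho k) \<and>
        ereal (rho k ^ (?d - 1)) * tau1 P (S *\<^sub>R q) v (rho k) \<ge> ereal \<xi>} = A"
        unfolding A_def l_def tau1_ge_iff[OF rho_pos]
        using tube_free_imp_K_rho[OF l] by (auto simp: l_def)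
      have Aclosed: "closed A"
      proof -
        have "A = {z. snd z \<in> sphere 0 1} \<inter> (\<lambda>z. (S *\<^sub>R fst z, snd z)) -` {z. tube_free P (rho k) l (fst z) (snd z)}"
          by (auto simp: A_def)
        moreover have "closed {z :: (real^'d) \<times> (real^'d). snd z \<in> sphere 0 1}"
          using closed_vimage_snd[of "sphere (0::real^'d) 1"] by (simp add: vimage_def)
        moreover have "closed ((\<lambda>z. (S *\<^sub>R fst z, snd z)) -` {z. tube_free P (rho k) l (fst z) (snd z)})"
          by (intro closed_vimage closed_tube_free continuous_intros)
        ultimately show ?thesis by (simp add: closed_Int)
      qed
      have AL: "A \<in> sets \<Lambda>" unfolding sLb using Aclosed by (rule borel_closed)
      have inner: "emeasure M2 (Pair q -` A) = ennreal (G (rho k) l (S *\<^sub>R q) / I)" for q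
      proof -
        have As: "Pair q -` A \<in> sets borel"
          using sets_Pair1[OF AL[unfolded \<Lambda>_def]] by (simp add: sM)
        have sA: "sgn -` (Pair q -` A) \<in> sets borel" using measurable_sets[OF sgn_borel_measurable As] by simp
        have "emeasure M2 (Pair q -` A) = emeasure M0 (sgn -` (Pair q -` A))"
          unfolding M2_def using As by (subst emeasure_distr[OF sg0]) (simp_all add: sp)
        also have "\<dots> = (\<integral>\<^sup>+x. ennreal (b x / I) * indicator (sgn -` (Pair q -` A)) x \<partial>lborel)"
          unfolding M0_def using sA b2 by (intro emeasure_density) simp_all
        also have "\<dots> = (\<integral>\<^sup>+x. ennreal (b x * free_ind P (rho k) l (S *\<^sub>R q) x / I) \<partial>lborel)"
        proof (rule nn_integral_cong_AE)
          have "AE x in lborel. x \<noteq> (0 :: real^'d)" by (rule AE_lborel_singleton)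
          then show "AE x in lborel. ennreal (b x / I) * indicator (sgn -` (Pair q -` A)) x = ennreal (b x * free_ind P (rho k) l (S *\<^sub>R q) x / I)"
            by (rule AE_mp, intro AE_I2) (auto simp: A_def free_ind_def norm_sgn indicator_def)
        qed
        also have "\<dots> = ennreal (\<integral>x. b x * free_ind P (rho k) l (S *\<^sub>R q) x / I \<partial>lborel)"
          using I b_free_ind_bounds by (intro nn_integral_eq_integral integrable_divide integrable_b_free_ind) simp
        finally show ?thesis by (simp add: G_def)
      qed
      have Gm: "(\<lambda>q. G (rho k) l (S *\<^sub>R q)) \<in> borel_measurable borel"
        by (rule measurable_compose[OF _ G_measurable]) simp
      have gi: "integrable lborel (\<lambda>q. indicator (ball 0 1) q * G (rho k) l (S *\<^sub>R q))"
      proof (rule integrable_bounded_support(1)[of _ "measure lborel (cball (0::real^'d) (M + 1))" 0 1])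
        show "\<bar>indicator (ball 0 1) q * G (rho k) l (S *\<^sub>R q)\<bar> \<le> measure lborel (cball (0::real^'d) (M + 1))" for q
          using G_nonneg[of "rho k" l "S *\<^sub>R q"] G_le[of "rho k" l "S *\<^sub>R q"] by (auto simp: indicator_def)
      qed (auto intro!: borel_measurable_times borel_measurable_indicator Gm)
      have "emeasure \<Lambda> A = (\<integral>\<^sup>+q. emeasure M2 (Pair q -` A) \<partial>M1)"
        unfolding \<Lambda>_def using AL by (intro P2.emeasure_pair_measure_alt) (simp add: \<Lambda>_def)
      also have "\<dots> = (\<integral>\<^sup>+q. ennreal (indicator (ball 0 1) q / B) * ennreal (G (rho k) l (S *\<^sub>R q) / I) \<partial>lborel)"
        unfolding inner M1_def using Gm by (intro nn_integral_density b1) simp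
      also have "\<dots> = (\<integral>\<^sup>+q. ennreal (indicator (ball 0 1) q * G (rho k) l (S *\<^sub>R q) / (B * I)) \<partial>lborel)"
        using B I G_nonneg by (intro nn_integral_cong) (simp add: ennreal_mult'[symmetric])
      also have "\<dots> = ennreal (\<integral>q. indicator (ball 0 1) q * G (rho k) l (S *\<^sub>R q) / (B * I) \<partial>lborel)"
        using B I G_nonneg by (intro nn_integral_eq_integral integrable_divide gi) simp
      finally have "measure \<Lambda> A = (\<integral>q. indicator (ball 0 1) q * G (rho k) l (S *\<^sub>R q) \<partial>lborel) / (B * I)"
        using B I G_nonneg by (simp add: measure_def Bochner_Integration.integral_nonneg)
      moreover have "ball_int \<xi> k S 0 = S ^ ?d * (\<integral>q. indicator (ball 0 1) q * G (rho k) l (S *\<^sub>R q) \<partial>lborel)"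
      proof -
        have "ball_int \<xi> k S 0 = S ^ DIM(real^'d) * (\<integral>x. indicator (ball 0 S) (S *\<^sub>R x) * Gs \<xi> k (S *\<^sub>R x) \<partial>lborel)"
          unfolding ball_int_eq using S by (intro lborel_integral_scale borel_measurable_times borel_measurable_indicator Gs_measurable) simp_all
        also have "(\<integral>x. indicator (ball 0 S) (S *\<^sub>R x) * Gs \<xi> k (S *\<^sub>R x) \<partial>lborel) = (\<integral>q. indicator (ball 0 1) q * G (rho k) l (S *\<^sub>R q) \<partial>lborel)"
          using S by (intro Bochner_Integration.integral_cong) (auto simp: indicator_def Gs_def l_def)
        finally show ?thesis by simp
      qed
      moreover have "measure lborel (ball (0::real^'d) S) = B * S ^ ?d"
        using S by (simp add: B_def content_ball)
      ultimately show ?thesis unfolding S_def[symmetric] Aeq using S B I by simp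
    qed
    have r0: "filterlim rho (at_right 0) sequentially"
      unfolding filterlim_at using rho_tendsto_0 rho_pos by (auto intro!: always_eventually simp: less_imp_neq[symmetric])
    have "((\<lambda>k. ball_int \<xi> k (1 / rho k ^ (?d - 1)) 0 / measure lborel (ball (0::real^'d) (1 / rho k ^ (?d - 1))) / I) \<longlonglongrightarrow> F \<xi>)"
      using filterlim_compose[OF lim[unfolded free_path_limit_def, rule_format, OF conjI[OF ac xi]] r0] unfolding val .
    from tendsto_mult[OF this tendsto_const[of I]] show ?thesis using I by (simp add: I_def)
  qed
qed

section \<open>Dependence of the limit on the length of the tube\<close>

lemma tube_free_mono:
  "tube_free P \<rho> l q v \<Longrightarrow> \<rho>' \<le> \<rho> \<Longrightarrow> l' \<le> l \<Longrightarrow> tube_free P \<rho>' l' q v"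
  unfolding tube_free_def by (meson less_le_trans order_trans)

lemma integrable_ball_free_ind:
  "integrable lborel (\<lambda>z. indicator (ball (0::'a::euclidean_space) R) z * free_ind P r l z x)"
proof (rule integrable_bounded_support(1)[of _ 1 0 R])
  show "\<bar>indicator (ball 0 R) z * free_ind P r l z x\<bar> \<le> 1" for z
    using free_ind_bounds[of P r l z x] by (auto simp: indicator_def)
qed (auto intro!: borel_measurable_times borel_measurable_indicator free_ind_measurable')

context weighted_points
begin

lemma ball_int_alt:
  "ball_int \<xi> k S 0 = (\<integral>x. b x * (\<integral>z. indicator (ball 0 S) z * free_ind P (rho k) (\<xi> / rho k ^ (DIM('a) - 1)) z x \<partial>lborel) \<partial>lborel)"
proof -
  let ?f = "free_ind P (rho k) (\<xi> / rho k ^ (DIM('a) - 1))"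
  have "ball_int \<xi> k S 0 = (\<integral>z. (\<integral>x. indicator (ball 0 S) z * (b x * ?f z x) \<partial>lborel) \<partial>lborel)"
    by (simp add: ball_int_eq Gs_def G_def)
  also have "\<dots> = (\<integral>x. (\<integral>z. indicator (ball 0 S) z * (b x * ?f z x) \<partial>lborel) \<partial>lborel)"
  proof (rule lborel_Fubini_bounded_support[of _ 1 0 S 0 "M + 1"])
    show "(\<lambda>(z, x). indicator (ball 0 S) z * (b x * ?f z x)) \<in> borel_measurable (borel \<Otimes>\<^sub>M borel)"
      unfolding case_prod_beta
      by (intro borel_measurable_times measurable_compose[OF measurable_snd b_measurable] free_ind_measurable'
        measurable_compose[OF measurable_fst borel_measurable_indicator] measurable_fst measurable_snd) simp
    show "\<bar>indicator (ball 0 S) z * (b x * ?f z x)\<bar> \<le> 1" for z x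
      using b_free_ind_bounds[of x "rho k" "\<xi> / rho k ^ (DIM('a) - 1)" z] by (auto simp: indicator_def)
  qed (use b_zero in \<open>auto simp: indicator_def\<close>)
  also have "\<dots> = (\<integral>x. b x * (\<integral>z. indicator (ball 0 S) z * ?f z x \<partial>lborel) \<partial>lborel)"
  proof (rule Bochner_Integration.integral_cong)
    fix x
    have "(\<integral>z. indicator (ball 0 S) z * (b x * ?f z x) \<partial>lborel) = (\<integral>z. b x * (indicator (ball 0 S) z * ?f z x) \<partial>lborel)"
      by (intro Bochner_Integration.integral_cong) simp_all
    then show "(\<integral>z. indicator (ball 0 S) z * (b x * ?f z x) \<partial>lborel) = b x * (\<integral>z. indicator (ball 0 S) z * ?f z x \<partial>lborel)" by simp
  qed simp
  finally show ?thesis .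
qed

text \<open>The indicators differ only at starting points with a hit for \<open>t\<close> between
  the two lengths. Relative to the ball of radius \<open>S k\<close> and up to constants,
  \<open>measure_tube_le\<close> bounds their volume by
  \<open>(\<Delta> * S k / rho k + 1) * rho k ^ d\<close>, which is
  \<open>\<Delta> + rho k ^ d\<close> because \<open>S k * rho k ^ (d - 1) = 1\<close>.\<close>

lemma free_ind_length_diff:
  assumes xi: "0 < \<xi>'" "\<xi>' \<le> \<xi>"
  defines "S \<equiv> \<lambda>k. 1 / rho k ^ (DIM('a) - 1)"
  shows "(\<integral>z. indicator (ball 0 (S k)) z * free_ind P (rho k) (\<xi>' / rho k ^ (DIM('a) - 1)) z x \<partial>lborel)
     - (\<integral>z. indicator (ball 0 (S k)) z * free_ind P (rho k) (\<xi> / rho k ^ (DIM('a) - 1)) z x \<partial>lborel)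
    \<le> C0 * (2 + (\<xi> - \<xi>')) ^ DIM('a) * 2 ^ DIM('a) * (\<xi> - \<xi>' + rho k) * measure lborel (ball (0::'a) (S k))"
proof -
  let ?d = "DIM('a)"
  let ?\<omega> = "unit_ball_vol (real DIM('a))"
  define \<Delta> where "\<Delta> = \<xi> - \<xi>'"
  define l where "l = \<xi> * S k" define l' where "l' = \<xi>' * S k"
  have leq: "\<xi> / rho k ^ (?d - 1) = l" "\<xi>' / rho k ^ (?d - 1) = l'" by (simp_all add: l_def l'_def S_def)
  have rho: "0 < rho k" "rho k \<le> 1" using rho_pos rho_le_1 by auto
  have Sr: "S k * rho k ^ (?d - 1) = 1" using rho by (simp add: S_def)
  have S1: "1 \<le> S k" using rho power_le_one[of "rho k" "?d - 1"] by (simp add: S_def le_divide_eq)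
  have D: "0 \<le> \<Delta>" using xi by (simp add: \<Delta>_def)
  have l: "0 < l'" "l - l' = \<Delta> * S k" "l' \<le> l"
    using xi S1 by (auto simp: l_def l'_def \<Delta>_def algebra_simps intro!: mult_right_mono)
  define v where "v = sgn x"
  have v: "norm v \<le> 1" by (simp add: v_def norm_sgn)
  define T where "T = {z \<in> ball 0 (S k). \<exists>p\<in>P. \<exists>t\<in>{l'..l' + \<Delta> * S k}. dist (z + t *\<^sub>R v) p < rho k}"
  have Tm: "T \<in> sets borel"
  proof -
    have "T = ball 0 (S k) \<inter> (\<Union>p\<in>P. \<Union>t\<in>{l'..l' + \<Delta> * S k}. {q. dist (q + t *\<^sub>R v) p < rho k})" by (auto simp: T_def)
    moreover have "open \<dots>" by (intro open_Int open_ball open_UN ballI open_Collect_less continuous_intros)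
    ultimately show ?thesis by simp
  qed
  have Tfm: "T \<in> fmeasurable lborel"
    by (rule fmeasurableI2[of "ball 0 (S k)"]) (use Tm in \<open>auto simp: T_def fmeasurable_def emeasure_lborel_ball_finite[simplified]\<close>)
  note fi = integrable_ball_free_ind
  have "(\<integral>z. indicator (ball 0 (S k)) z * free_ind P (rho k) l' z x \<partial>lborel) - (\<integral>z. indicator (ball 0 (S k)) z * free_ind P (rho k) l z x \<partial>lborel)
    = (\<integral>z. indicator (ball 0 (S k)) z * free_ind P (rho k) l' z x - indicator (ball 0 (S k)) z * free_ind P (rho k) l z x \<partial>lborel)"
    by (rule Bochner_Integration.integral_diff[symmetric, OF fi fi])
  also have "\<dots> \<le> (\<integral>z. indicator T z \<partial>lborel)"
  proof (rule integral_mono)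
    show "integrable lborel (indicator T :: 'a \<Rightarrow> real)" using Tfm by (intro integrable_real_indicator) (auto simp: fmeasurable_def)
    show "indicator (ball 0 (S k)) z * free_ind P (rho k) l' z x - indicator (ball 0 (S k)) z * free_ind P (rho k) l z x \<le> indicator T z" for z
    proof (cases "z \<in> ball 0 (S k) \<and> tube_free P (rho k) l' z v \<and> \<not> tube_free P (rho k) l z v")
      case True
      then obtain t p where t: "0 < t" "t < l" "p \<in> P" "dist (z + t *\<^sub>R v) p < rho k" by (auto simp: tube_free_def not_le)
      have "l' \<le> t"
      proof (rule ccontr)
        assume "\<not> l' \<le> t"
        then have "rho k \<le> dist (z + t *\<^sub>R v) p" using True t unfolding tube_free_def by auto
        then show False using t(4) by simp
      qed
      then have "t \<in> {l'..l' + \<Delta> * S k}" using t(2) l(2) by simp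
      then have "z \<in> T" using True t(3,4) unfolding T_def by blast
      then show ?thesis by (auto simp: free_ind_def indicator_def)
    next
      case False
      then show ?thesis using tube_free_mono[of P "rho k" l z v "rho k" l'] l(3) by (auto simp: free_ind_def indicator_def v_def)
    qed
  qed (intro Bochner_Integration.integrable_diff fi)
  also have "\<dots> = measure lborel T" by simp
  also have "\<dots> \<le> real (card (P \<inter> ball (0 + l' *\<^sub>R v) (S k + \<Delta> * S k + rho k))) * (\<Delta> * S k / rho k + 1) * (?\<omega> * (2 * rho k) ^ ?d)"
    unfolding T_def using v rho D S1 by (intro measure_tube_le finite_P_ball) auto
  also have "\<dots> \<le> (C0 * ((2 + \<Delta>) * S k) ^ ?d) * (\<Delta> * S k / rho k + 1) * (?\<omega> * (2 * rho k) ^ ?d)"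
  proof (intro mult_right_mono)
    have "S k + \<Delta> * S k + rho k \<le> (2 + \<Delta>) * S k" using rho S1 by (simp add: algebra_simps)
    moreover have "1 \<le> S k + \<Delta> * S k + rho k" using rho S1 D mult_nonneg_nonneg[of \<Delta> "S k"] by linarith
    ultimately show "real (card (P \<inter> ball (0 + l' *\<^sub>R v) (S k + \<Delta> * S k + rho k))) \<le> C0 * ((2 + \<Delta>) * S k) ^ ?d"
      using C0_nonneg by (intro order_trans[OF count] mult_left_mono power_mono) auto
  qed (use rho D S1 in auto)
  also have "\<dots> = C0 * (2 + \<Delta>) ^ ?d * 2 ^ ?d * ((\<Delta> * S k / rho k + 1) * rho k ^ ?d) * (?\<omega> * S k ^ ?d)"
    by (simp only: power_mult_distrib mult_ac)
  also have "(\<Delta> * S k / rho k + 1) * rho k ^ ?d = \<Delta> + rho k ^ ?d"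
  proof -
    obtain m where m: "?d = Suc m" by (metis DIM_positive gr0_conv_Suc)
    have "(\<Delta> * S k / rho k + 1) * rho k ^ ?d = \<Delta> * (S k * rho k ^ m) + rho k ^ ?d" using rho by (simp add: m field_simps)
    then show ?thesis using Sr by (simp add: m)
  qed
  also have "C0 * (2 + \<Delta>) ^ ?d * 2 ^ ?d * (\<Delta> + rho k ^ ?d) * (?\<omega> * S k ^ ?d) \<le> C0 * (2 + \<Delta>) ^ ?d * 2 ^ ?d * (\<Delta> + rho k) * (?\<omega> * S k ^ ?d)"
  proof (intro mult_right_mono mult_left_mono add_left_mono)
    show "rho k ^ ?d \<le> rho k" using rho power_decreasing[of 1 ?d "rho k"] dim by simp
  qed (use S1 D C0_nonneg in auto)
  finally show ?thesis using S1 unfolding leq by (simp add: content_ball \<Delta>_def)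
qed

text \<open>Monotonicity and the estimate of \<open>free_ind_length_diff\<close> survive the limit;
  together they make the limit function, later a positive multiple of \<open>F\<close>, locally
  Lipschitz.\<close>

lemma limit_function_bounds:
  assumes xi: "0 < \<xi>'" "\<xi>' \<le> \<xi>"
    and lim: "\<And>\<xi>. 0 < \<xi> \<Longrightarrow> (\<lambda>k. ball_int \<xi> k (1 / rho k ^ (DIM('a) - 1)) 0 / measure lborel (ball (0::'a) (1 / rho k ^ (DIM('a) - 1)))) \<longlonglongrightarrow> m \<xi>"
  shows "m \<xi> \<le> m \<xi>'"
    and "m \<xi>' - m \<xi> \<le> measure lborel (cball (0::'a) (M + 1)) * (C0 * (2 + (\<xi> - \<xi>')) ^ DIM('a) * 2 ^ DIM('a) * (\<xi> - \<xi>'))"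
proof -
  let ?\<kappa> = "measure lborel (cball (0::'a) (M + 1))"
  define S where "S k = 1 / rho k ^ (DIM('a) - 1)" for k
  have S: "0 < S k" for k using rho_pos by (simp add: S_def)
  define J where "J k \<xi> x = (\<integral>z. indicator (ball 0 (S k)) z * free_ind P (rho k) (\<xi> / rho k ^ (DIM('a) - 1)) z x \<partial>lborel)" for k \<xi> x
  note fi = integrable_ball_free_ind
  have Jm: "J k \<xi> \<in> borel_measurable borel" for k \<xi>
  proof -
    have "(\<lambda>(x, z). indicator (ball 0 (S k)) z * free_ind P (rho k) (\<xi> / rho k ^ (DIM('a) - 1)) z x) \<in> borel_measurable (borel \<Otimes>\<^sub>M lborel)"
      unfolding case_prod_beta
      by (intro borel_measurable_times measurable_compose[OF measurable_snd borel_measurable_indicator] free_ind_measurable'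
        measurable_fst measurable_compose[OF measurable_snd measurable_ident_sets]) simp_all
    then show ?thesis unfolding J_def[abs_def] by (intro lborel.borel_measurable_lebesgue_integral) simp
  qed
  have J0: "0 \<le> J k \<xi> x" for k \<xi> x unfolding J_def
    by (intro Bochner_Integration.integral_nonneg mult_nonneg_nonneg free_ind_bounds) simp
  have JB: "J k \<xi> x \<le> measure lborel (ball (0::'a) (S k))" for k \<xi> x
  proof -
    have "J k \<xi> x \<le> (\<integral>z. indicator (ball (0::'a) (S k)) z \<partial>lborel)" unfolding J_def
      by (intro integral_mono fi integrable_indicator_ball) (intro mult_left_le free_ind_bounds, simp)
    then show ?thesis by simp
  qed
  have bJ: "integrable lborel (\<lambda>x. b x * J k \<xi> x)" for k \<xi>
  proof (rule integrable_bounded_support(1)[of _ "1 * measure lborel (ball (0::'a) (S k))" 0 "M + 1"])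
    show "\<bar>b x * J k \<xi> x\<bar> \<le> 1 * measure lborel (ball (0::'a) (S k))" for x
      unfolding abs_mult using b_nonneg[of x] b_le_1[of x] J0[of k \<xi> x] JB[of k \<xi> x] by (intro mult_mono) auto
  qed (use b_zero Jm in \<open>auto intro!: borel_measurable_times\<close>)
  have bi: "ball_int \<xi> k (S k) 0 = (\<integral>x. b x * J k \<xi> x \<partial>lborel)" for k \<xi> unfolding ball_int_alt J_def ..
  have mono: "ball_int \<xi> k (S k) 0 \<le> ball_int \<xi>' k (S k) 0" for k
    unfolding bi
  proof (intro integral_mono bJ mult_left_mono b_nonneg)
    fix x
    have "\<xi>' / rho k ^ (DIM('a) - 1) \<le> \<xi> / rho k ^ (DIM('a) - 1)" using xi rho_pos[of k] by (intro divide_right_mono) auto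
    then have "free_ind P (rho k) (\<xi> / rho k ^ (DIM('a) - 1)) z x \<le> free_ind P (rho k) (\<xi>' / rho k ^ (DIM('a) - 1)) z x" for z
      using tube_free_mono[of P "rho k" _ z "sgn x" "rho k"] by (auto simp: free_ind_def)
    then show "J k \<xi> x \<le> J k \<xi>' x" unfolding J_def by (intro integral_mono fi mult_left_mono) auto
  qed
  let ?E = "\<lambda>k. C0 * (2 + (\<xi> - \<xi>')) ^ DIM('a) * 2 ^ DIM('a) * (\<xi> - \<xi>' + rho k)"
  have E0: "0 \<le> ?E k" for k using C0_nonneg xi rho_pos[of k] by (intro mult_nonneg_nonneg) auto
  have diff: "ball_int \<xi>' k (S k) 0 - ball_int \<xi> k (S k) 0 \<le> ?\<kappa> * ?E k * measure lborel (ball (0::'a) (S k))" for k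
  proof -
    have "ball_int \<xi>' k (S k) 0 - ball_int \<xi> k (S k) 0 = (\<integral>x. b x * J k \<xi>' x - b x * J k \<xi> x \<partial>lborel)"
      unfolding bi using bJ by simp
    also have "\<dots> \<le> (\<integral>x. (?E k * measure lborel (ball (0::'a) (S k))) * b x \<partial>lborel)"
    proof (intro integral_mono Bochner_Integration.integrable_diff bJ integrable_mult_right integrable_b)
      fix x
      have "J k \<xi>' x - J k \<xi> x \<le> ?E k * measure lborel (ball (0::'a) (S k))"
        unfolding J_def S_def using xi by (rule free_ind_length_diff)
      from mult_left_mono[OF this b_nonneg[of x]]
      show "b x * J k \<xi>' x - b x * J k \<xi> x \<le> (?E k * measure lborel (ball (0::'a) (S k))) * b x"
        by (simp only: right_diff_distrib mult.commute[of "b x" "?E k * measure lborel (ball (0::'a) (S k))"])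
    qed
    also have "\<dots> = (?E k * measure lborel (ball (0::'a) (S k))) * (\<integral>x. b x \<partial>lborel)" by simp
    also have "\<dots> \<le> (?E k * measure lborel (ball (0::'a) (S k))) * ?\<kappa>"
    proof (rule mult_left_mono)
      show "(\<integral>x. b x \<partial>lborel) \<le> ?\<kappa>"
        using integrable_bounded_support(2)[of b 1 0 "M + 1"] b_nonneg b_le_1 b_zero by (auto simp: abs_le_iff)
    qed (intro mult_nonneg_nonneg E0, simp)
    finally show ?thesis by (simp only: mult_ac)
  qed
  have Bp: "0 < measure lborel (ball (0::'a) (S k))" for k using S by (rule content_ball_pos)
  have lim1: "(\<lambda>k. ball_int \<xi> k (S k) 0 / measure lborel (ball (0::'a) (S k))) \<longlonglongrightarrow> m \<xi>"
    and lim2: "(\<lambda>k. ball_int \<xi>' k (S k) 0 / measure lborel (ball (0::'a) (S k))) \<longlonglongrightarrow> m \<xi>'"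
    unfolding S_def using lim xi by auto
  show "m \<xi> \<le> m \<xi>'"
    by (rule LIMSEQ_le[OF lim1 lim2], intro exI[of _ 0] allI impI divide_right_mono mono measure_nonneg)
  have lim3: "(\<lambda>k. ?\<kappa> * ?E k) \<longlonglongrightarrow> ?\<kappa> * (C0 * (2 + (\<xi> - \<xi>')) ^ DIM('a) * 2 ^ DIM('a) * (\<xi> - \<xi>' + 0))"
    by (intro tendsto_intros rho_tendsto_0)
  have "m \<xi>' - m \<xi> \<le> ?\<kappa> * (C0 * (2 + (\<xi> - \<xi>')) ^ DIM('a) * 2 ^ DIM('a) * (\<xi> - \<xi>' + 0))"
  proof (rule LIMSEQ_le[OF tendsto_diff[OF lim2 lim1] lim3], intro exI[of _ 0] allI impI)
    fix k
    show "ball_int \<xi>' k (S k) 0 / measure lborel (ball (0::'a) (S k)) - ball_int \<xi> k (S k) 0 / measure lborel (ball (0::'a) (S k)) \<le> ?\<kappa> * ?E k"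
      using diff[of k] Bp[of k] by (simp only: diff_divide_distrib[symmetric] pos_divide_le_eq)
  qed
  then show "m \<xi>' - m \<xi> \<le> ?\<kappa> * (C0 * (2 + (\<xi> - \<xi>')) ^ DIM('a) * 2 ^ DIM('a) * (\<xi> - \<xi>'))" by simp
qed

end

text \<open>A cutoff with Lipschitz constant \<open>j + 1\<close> that is 1 on \<open>A\<close>; for
  closed nonempty \<open>A\<close> it tends to the indicator of \<open>A\<close>. For empty
  \<open>A\<close> it is constantly 1, since \<open>infdist x {} = 0\<close>.\<close>

definition bump :: "'a::euclidean_space set \<Rightarrow> nat \<Rightarrow> 'a \<Rightarrow> real" where
  "bump A j x = max 0 (1 - real (Suc j) * infdist x A)"

lemma bump_weighted_points:
  assumes P: "almost_periodic_points P C0" and dim: "2 \<le> DIM('a::euclidean_space)"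
    and A: "A \<noteq> ({} :: 'a set)" "A \<subseteq> cball 0 R" and R: "0 \<le> R"
  shows "weighted_points P C0 (bump A j) (real (Suc j)) (R + 1)"
proof -
  interpret almost_periodic_points P C0 by (rule P)
  show ?thesis
  proof
    show "bump A j \<in> borel_measurable borel"
      unfolding bump_def[abs_def] by (intro borel_measurable_continuous_onI continuous_intros)
    fix x y :: 'a
    show "0 \<le> bump A j x" "bump A j x \<le> 1" using infdist_nonneg[of x A] by (auto simp: bump_def)
    have "\<bar>infdist x A - infdist y A\<bar> \<le> norm (x - y)"
      using infdist_triangle[of x A y] infdist_triangle[of y A x] by (simp add: dist_norm norm_minus_commute abs_le_iff)
    then have "real (Suc j) * \<bar>infdist x A - infdist y A\<bar> \<le> real (Suc j) * norm (x - y)" by (intro mult_left_mono) auto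
    moreover have "\<bar>bump A j x - bump A j y\<bar> \<le> \<bar>real (Suc j) * infdist x A - real (Suc j) * infdist y A\<bar>"
      unfolding bump_def by linarith
    moreover have "\<bar>real (Suc j) * infdist x A - real (Suc j) * infdist y A\<bar> = real (Suc j) * \<bar>infdist x A - infdist y A\<bar>"
      by (simp add: abs_mult del: of_nat_Suc flip: right_diff_distrib)
    ultimately show "\<bar>bump A j x - bump A j y\<bar> \<le> real (Suc j) * norm (x - y)" by linarith
    show "bump A j x = 0" if x: "R + 1 < norm x"
    proof -
      have "1 \<le> infdist x A" unfolding infdist_notempty[OF A(1)]
      proof (rule cINF_greatest[OF A(1)])
        fix a assume "a \<in> A"
        then have "norm a \<le> R" using A(2) by auto
        then show "1 \<le> dist x a" using x norm_triangle_ineq2[of x a] by (simp add: dist_norm)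
      qed
      then have "1 * 1 \<le> real (Suc j) * infdist x A" by (intro mult_mono) auto
      then show ?thesis by (simp add: bump_def del: of_nat_Suc)
    qed
  qed (use dim R in auto)
qed

section \<open>Convergence for almost every starting point\<close>

text \<open>Exceptional null sets are collected over countably many triples of a rational
  \<open>\<xi>\<close>, a set in \<open>\<G>\<close> and an index \<open>j\<close>. Outside their
  union the bumps yield the indicators of the sets in \<open>\<G>\<close>, and
  \<open>L1_limit_if_generator\<close> yields all integrable \<open>\<Phi>\<close> at once.\<close>

lemma AE_L1_limit_free_ind:
  fixes P :: "(real^'d) set"
  assumes P: "almost_periodic_points P C0" and dim: "2 \<le> CARD('d)" and lim: "free_path_limit P F"
  shows "AE q in lborel. \<forall>\<xi>\<in>\<rat> \<inter> {0<..}. \<forall>\<Phi>. integrable lborel \<Phi> \<longrightarrow>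
    L1_limit (\<lambda>k. free_ind P (rho k) (\<xi> / rho k ^ (CARD('d) - 1)) q) (F \<xi>) \<Phi>"
proof -
  obtain \<B> :: "(real^'d) set set" where \<B>: "countable \<B>" "\<And>n::nat. cball 0 (real n) \<in> \<B>"
    "\<And>B. B \<in> \<B> \<Longrightarrow> \<exists>c r. B = cball c r" "sets (borel :: (real^'d) measure) = sigma_sets UNIV \<B>"
    using borel_generator_cballs by blast
  \<comment> \<open>Finite nonempty intersections of the generating balls: still countable, stable
    under intersection, and made of bounded closed sets, as the bumps require.\<close>
  define \<G> where "\<G> = Inter ` {\<F>. finite \<F> \<and> \<F> \<subseteq> \<B> \<and> \<F> \<noteq> {}}"
  have cG: "countable \<G>" unfolding \<G>_def
    by (intro countable_image countable_subset[OF _ countable_Collect_finite_subset[OF \<B>(1)]]) auto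
  have stable: "Int_stable \<G>"
    unfolding Int_stable_def
  proof (intro ballI)
    fix A B assume "A \<in> \<G>" "B \<in> \<G>"
    then obtain \<F> \<F>' where "A = \<Inter>\<F>" "finite \<F>" "\<F> \<subseteq> \<B>" "\<F> \<noteq> {}" "B = \<Inter>\<F>'" "finite \<F>'" "\<F>' \<subseteq> \<B>" "\<F>' \<noteq> {}"
      unfolding \<G>_def by blast
    then show "A \<inter> B \<in> \<G>" unfolding \<G>_def by (intro image_eqI[of _ _ "\<F> \<union> \<F>'"]) auto
  qed
  have sub: "\<B> \<subseteq> \<G>"
  proof
    fix B assume "B \<in> \<B>"
    then show "B \<in> \<G>" unfolding \<G>_def by (intro image_eqI[of _ _ "{B}"]) auto
  qed
  have closedG: "closed A" and boundedG: "\<exists>R\<ge>0. A \<subseteq> cball 0 R" if "A \<in> \<G>" for A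
  proof -
    obtain \<F> where F: "A = \<Inter>\<F>" "\<F> \<subseteq> \<B>" "\<F> \<noteq> {}" using \<open>A \<in> \<G>\<close> unfolding \<G>_def by blast
    show "closed A" unfolding F(1)
    proof (rule closed_Inter, rule ballI)
      fix B assume "B \<in> \<F>"
      then obtain c r where "B = cball c r" using \<B>(3) F(2) by blast
      then show "closed B" by simp
    qed
    obtain B where B: "B \<in> \<F>" using F(3) by blast
    then obtain c r where cr: "B = cball c r" using \<B>(3) F(2) by blast
    have "A \<subseteq> cball 0 (norm c + \<bar>r\<bar>)"
    proof
      fix x assume "x \<in> A"
      then have "norm (c - x) \<le> r" using B cr F(1) by (auto simp: dist_norm)
      then show "x \<in> cball 0 (norm c + \<bar>r\<bar>)" using norm_triangle_ineq3[of c x] by simp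
    qed
    then show "\<exists>R\<ge>0. A \<subseteq> cball 0 R" by (intro exI[of _ "norm c + \<bar>r\<bar>"]) auto
  qed
  have gen: "sets (borel :: (real^'d) measure) = sigma_sets UNIV \<G>"
  proof
    show "sets (borel :: (real^'d) measure) \<subseteq> sigma_sets UNIV \<G>"
      unfolding \<B>(4) using sub by (intro sigma_sets_mono')
    have "\<G> \<subseteq> sets borel" using closedG by (auto intro: borel_closed)
    then show "sigma_sets UNIV \<G> \<subseteq> sets (borel :: (real^'d) measure)" using sets.sigma_sets_subset[of \<G> borel] by simp
  qed
  let ?f = "\<lambda>\<xi> q k. free_ind P (rho k) (\<xi> / rho k ^ (CARD('d) - 1)) q"
  have one: "AE q in lborel. A \<noteq> {} \<longrightarrow> L1_limit (?f \<xi> q) (F \<xi>) (bump A j)" if A: "A \<in> \<G>" and xi: "0 < \<xi>" for A j \<xi>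
  proof (cases "A = {}")
    case False
    obtain R where R: "0 \<le> R" "A \<subseteq> cball 0 R" using boundedG[OF A] by blast
    have wp: "weighted_points P C0 (bump A j) (real (Suc j)) (R + 1)"
      using bump_weighted_points[OF P _ False R(2,1)] dim by simp
    have "AE q in lborel. (\<lambda>k. weighted_points.Gs P (bump A j) \<xi> k q) \<longlonglongrightarrow> F \<xi> * (\<integral>x. bump A j x \<partial>lborel)"
      by (rule weighted_points.Gs_tendsto[OF wp xi macro_mean_tendsto[OF wp lim xi]])
    then show ?thesis
      by eventually_elim (simp add: L1_limit_def weighted_points.Gs_def[OF wp] weighted_points.G_def[OF wp])
  qed simp
  have "AE q in lborel. \<forall>\<xi>\<in>\<rat> \<inter> {0<..}. \<forall>A\<in>\<G>. \<forall>j. A \<noteq> {} \<longrightarrow> L1_limit (?f \<xi> q) (F \<xi>) (bump A j)"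
  proof (subst AE_ball_countable)
    show "\<forall>\<xi>\<in>\<rat> \<inter> {0<..}. AE q in lborel. \<forall>A\<in>\<G>. \<forall>j. A \<noteq> {} \<longrightarrow> L1_limit (?f \<xi> q) (F \<xi>) (bump A j)"
      using one by (auto simp: AE_ball_countable[OF cG] AE_all_countable)
  qed (use countable_rat in auto)
  then show ?thesis
  proof eventually_elim
    case (elim q)
    show ?case
    proof (intro ballI allI impI)
      fix \<xi> :: real and \<Phi> :: "real^'d \<Rightarrow> real" assume xi: "\<xi> \<in> \<rat> \<inter> {0<..}" and \<Phi>: "integrable lborel \<Phi>"
      have fm: "?f \<xi> q k \<in> borel_measurable borel" for k by (intro free_ind_measurable') auto
      show "L1_limit (?f \<xi> q) (F \<xi>) \<Phi>"
      proof (rule L1_limit_if_generator[OF fm free_ind_bounds stable gen _ _ \<Phi>])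
        show "cball 0 (real n) \<in> \<G>" for n using \<B>(2) sub by blast
        fix A assume A: "A \<in> \<G>"
        show "L1_limit (?f \<xi> q) (F \<xi>) (indicator A)"
        proof (cases "A = {}")
          case True then show ?thesis by (simp add: L1_limit_def)
        next
          case False
          obtain R where R: "0 \<le> R" "A \<subseteq> cball 0 R" using boundedG[OF A] by blast
          have wp: "weighted_points P C0 (bump A j) (real (Suc j)) (R + 1)" for j
            using bump_weighted_points[OF P _ False R(2,1)] dim by simp
          show ?thesis
          proof (rule L1_limit_dominated[OF fm free_ind_bounds, where s = "bump A" and w = "indicator (cball 0 (R + 1))"])
            show "integrable lborel (bump A j)" for j by (rule weighted_points.integrable_b[OF wp])
            show "L1_limit (?f \<xi> q) (F \<xi>) (bump A j)" for j using elim xi A False by blast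
            show "(\<lambda>j. bump A j x) \<longlonglongrightarrow> indicator A x" for x
            proof (cases "x \<in> A")
              case True then show ?thesis by (simp add: bump_def)
            next
              case xA: False
              have pos: "0 < infdist x A" using infdist_pos_not_in_closed[OF closedG[OF A] False xA] .
              obtain n where n: "inverse (real (Suc n)) < infdist x A" using reals_Archimedean[OF pos] by blast
              have "\<forall>\<^sub>F j in sequentially. bump A j x = 0"
                using eventually_ge_at_top[of n]
              proof eventually_elim
                case (elim j)
                have "1 = real (Suc n) * inverse (real (Suc n))" by simp
                also have "\<dots> \<le> real (Suc j) * infdist x A" using n elim by (intro mult_mono) auto
                finally show ?case by (simp add: bump_def del: of_nat_Suc)
              qed
              then show ?thesis using xA by (simp add: tendsto_eventually)
            qed
            show "integrable lborel (indicator (cball 0 (R + 1)) :: real^'d \<Rightarrow> real)" by (rule integrable_indicator_cball)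
            show "\<bar>bump A j x\<bar> \<le> indicator (cball 0 (R + 1)) x" for j x
              using weighted_points.b_nonneg[OF wp, of j x] weighted_points.b_le_1[OF wp, of j x] weighted_points.b_support[OF wp, of x j]
              by (auto simp: indicator_def)
            show "integrable lborel (indicator A :: real^'d \<Rightarrow> real)"
            proof (rule integrable_bounded_support(1)[of _ 1 0 R])
              show "indicator A \<in> borel_measurable borel" using closedG[OF A] by (intro borel_measurable_indicator borel_closed)
            qed (use R in \<open>auto simp: indicator_def\<close>)
          qed
        qed
      qed
    qed
  qed
qed

text \<open>\<open>\<Phi>\<close> is the Radon--Nikodym density of \<open>lam\<close>, pulled back
  by \<open>sgn\<close> to the punctured unit ball; its factor \<open>CARD('d)\<close> is the one in
  \<open>sphere_measure\<close>. Convergence against integrable weights thereby covers every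
  admissible \<open>lam\<close>.\<close>

lemma sphere_prob_density:
  fixes lam :: "(real^'d) measure"
  assumes "ac_sphere_prob lam"
  obtains \<Phi> where "integrable lborel \<Phi>" "(\<integral>x. \<Phi> x \<partial>lborel) = 1"
    "\<And>P r l q. measure lam {v \<in> sphere 0 1. tube_free P r l q v} = (\<integral>x. \<Phi> x * free_ind P r l q x \<partial>lborel)"
proof -
  have sl: "sets lam = sets borel" and pl: "prob_space lam" and ac: "absolutely_continuous sphere_measure lam"
    using assms by (simp_all add: ac_sphere_prob_def)
  interpret lam: prob_space lam by (rule pl)
  interpret \<sigma>: finite_measure "sphere_measure :: (real^'d) measure" by (rule finite_measure_sphere_measure)
  have ssl: "sets lam = sets (sphere_measure :: (real^'d) measure)" by (simp add: sl sets_sphere_measure)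
  obtain D where D: "D \<in> borel_measurable sphere_measure" "AE v in sphere_measure. RN_deriv sphere_measure lam v = ennreal (D v)" "\<And>v. 0 \<le> D v"
    using \<sigma>.real_RN_deriv[OF lam.finite_measure_axioms ac ssl] by metis
  have Db [measurable]: "D \<in> borel_measurable borel" using D(1) by (simp add: measurable_cong_sets[OF sets_sphere_measure refl])
  let ?U = "{x :: real^'d. 0 < norm x \<and> norm x \<le> 1}"
  have U: "?U \<in> sets borel" by (rule punctured_ball_borel)
  have sg: "sgn \<in> restrict_space lborel ?U \<rightarrow>\<^sub>M (borel :: (real^'d) measure)"
    by (rule measurable_restrict_space1) simp
  have lam: "lam = density sphere_measure (\<lambda>v. ennreal (D v))"
  proof -
    have "lam = density sphere_measure (RN_deriv sphere_measure lam)"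
      using \<sigma>.density_RN_deriv[OF ac ssl] by simp
    also have "\<dots> = density sphere_measure (\<lambda>v. ennreal (D v))"
      using D(1,2) by (intro density_cong) auto
    finally show ?thesis .
  qed
  define \<Phi> where "\<Phi> x = indicator ?U x * (real CARD('d) * D (sgn x))" for x
  have Pm: "\<Phi> \<in> borel_measurable borel"
    unfolding \<Phi>_def[abs_def] using U
    by (intro borel_measurable_times borel_measurable_indicator measurable_compose[OF sgn_borel_measurable Db]) simp_all
  have P0: "0 \<le> \<Phi> x" for x using D(3) by (simp add: \<Phi>_def)
  have em: "emeasure lam E = (\<integral>\<^sup>+x. ennreal (\<Phi> x * indicator E (sgn x)) \<partial>lborel)" if E: "E \<in> sets borel" for E
  proof -
    have gm: "(\<lambda>v. ennreal (D v) * indicator E v) \<in> borel_measurable borel" using E by measurable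
    have "emeasure lam E = (\<integral>\<^sup>+v. ennreal (D v) * indicator E v \<partial>sphere_measure)"
      unfolding lam using E D(1) by (intro emeasure_density) (simp_all add: sets_sphere_measure)
    also have "\<dots> = (\<integral>\<^sup>+v. ennreal (real CARD('d)) * (ennreal (D v) * indicator E v) \<partial>distr (restrict_space lborel ?U) borel sgn)"
      unfolding sphere_measure_eq using gm by (intro nn_integral_density) simp_all
    also have "\<dots> = (\<integral>\<^sup>+x. ennreal (real CARD('d)) * (ennreal (D (sgn x)) * indicator E (sgn x)) \<partial>restrict_space lborel ?U)"
      using gm by (intro nn_integral_distr[OF sg]) simp
    also have "\<dots> = (\<integral>\<^sup>+x. ennreal (real CARD('d)) * (ennreal (D (sgn x)) * indicator E (sgn x)) * indicator ?U x \<partial>lborel)"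
      using U by (intro nn_integral_restrict_space) simp
    also have "\<dots> = (\<integral>\<^sup>+x. ennreal (\<Phi> x * indicator E (sgn x)) \<partial>lborel)"
      using D(3) by (intro nn_integral_cong) (simp add: \<Phi>_def indicator_def ennreal_mult)
    finally show ?thesis .
  qed
  have "(\<integral>\<^sup>+x. ennreal (\<Phi> x) \<partial>lborel) = 1"
    using em[of UNIV] lam.emeasure_space_1 sets_eq_imp_space_eq[OF sl] by simp
  then have Pi: "integrable lborel \<Phi>" using Pm P0 by (intro integrableI_nonneg) auto
  have P1: "(\<integral>x. \<Phi> x \<partial>lborel) = 1"
    using \<open>(\<integral>\<^sup>+x. ennreal (\<Phi> x) \<partial>lborel) = 1\<close> Pm P0 by (subst integral_eq_nn_integral) auto
  have "measure lam {v \<in> sphere 0 1. tube_free P r l q v} = (\<integral>x. \<Phi> x * free_ind P r l q x \<partial>lborel)" for P r l q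
  proof -
    let ?E = "{v \<in> sphere 0 1. tube_free P r l q v}"
    have "closed (sphere 0 1 \<inter> (\<lambda>v. (q, v)) -` {z. tube_free P r l (fst z) (snd z)})"
      by (intro closed_Int closed_sphere closed_vimage closed_tube_free continuous_intros)
    moreover have "?E = sphere 0 1 \<inter> (\<lambda>v. (q, v)) -` {z. tube_free P r l (fst z) (snd z)}" by auto
    ultimately have E: "?E \<in> sets borel" by simp
    \<comment> \<open>\<open>\<Phi>\<close> vanishes at 0, the only point where \<open>sgn x\<close>
      is off the sphere, so the equality holds everywhere.\<close>
    have eq: "\<Phi> x * indicator ?E (sgn x) = \<Phi> x * free_ind P r l q x" for x
      by (auto simp: \<Phi>_def free_ind_def indicator_def norm_sgn)
    have "emeasure lam ?E = (\<integral>\<^sup>+x. ennreal (\<Phi> x * free_ind P r l q x) \<partial>lborel)"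
      unfolding em[OF E] eq ..
    then show ?thesis
      using Pm P0 free_ind_bounds(1)
      by (subst integral_eq_nn_integral) (auto simp: measure_def intro!: borel_measurable_times free_ind_measurable' AE_I2 mult_nonneg_nonneg)
  qed
  with Pi P1 show ?thesis by (rule that)
qed

section \<open>From the sequence of radii to all radii\<close>

lemma rho_antimono: "i \<le> j \<Longrightarrow> rho j \<le> rho i"
  unfolding rho_def by (intro divide_left_mono power_mono mult_pos_pos) auto

lemma rho_ratio_tendsto: "(\<lambda>k. (rho k / rho (Suc k)) ^ n) \<longlonglongrightarrow> 1"
proof -
  have "(\<lambda>k. ((1 + inverse (real (Suc k))) ^ 10) ^ n) \<longlonglongrightarrow> ((1 + 0) ^ 10) ^ n"
    by (intro tendsto_intros LIMSEQ_inverse_real_of_nat)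
  moreover have "rho k / rho (Suc k) = (1 + inverse (real (Suc k))) ^ 10" for k
  proof -
    have "1 + inverse (real (Suc k)) = real (Suc (Suc k)) / real (Suc k)" by (simp add: field_simps)
    then show ?thesis by (simp only: rho_def power_divide) simp
  qed
  ultimately show ?thesis by simp
qed

text \<open>A radius \<open>r\<close> lies between some \<open>rho (Suc k)\<close> and
  \<open>rho k\<close>. Smaller radii and shorter tubes increase \<open>h\<close>, so rationals
  \<open>a < \<xi> < c\<close> enclose \<open>h r (\<xi> / r ^ n)\<close> between values along the
  sequence as soon as \<open>(rho k / rho (Suc k)) ^ n\<close> is below \<open>\<xi> / a\<close> and
  \<open>c / \<xi>\<close>; that ratio tends to 1. Continuity of \<open>F\<close> closes the gap
  between \<open>F a\<close>, \<open>F c\<close> and \<open>F \<xi>\<close>.\<close>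

lemma sandwich_limit:
  fixes h :: "real \<Rightarrow> real \<Rightarrow> real" and F :: "real \<Rightarrow> real"
  assumes mono: "\<And>r r' l l'. 0 < r' \<Longrightarrow> r' \<le> r \<Longrightarrow> l' \<le> l \<Longrightarrow> h r l \<le> h r' l'"
    and lim: "\<And>\<xi>. \<xi> \<in> \<rat> \<Longrightarrow> 0 < \<xi> \<Longrightarrow> (\<lambda>k. h (rho k) (\<xi> / rho k ^ n)) \<longlonglongrightarrow> F \<xi>"
    and cont: "isCont F \<xi>" and xi: "0 < \<xi>"
  shows "((\<lambda>r. h r (\<xi> / r ^ n)) \<longlongrightarrow> F \<xi>) (at_right 0)"
proof (rule tendstoI)
  fix e :: real assume e: "0 < e"
  obtain \<delta> where d: "0 < \<delta>" "\<And>x. \<bar>x - \<xi>\<bar> < \<delta> \<Longrightarrow> \<bar>F x - F \<xi>\<bar> < e / 2"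
    using cont e unfolding continuous_at_eps_delta dist_real_def by (metis half_gt_zero)
  obtain a where a: "a \<in> \<rat>" "max (\<xi> - \<delta>) 0 < a" "a < \<xi>"
    using Rats_dense_in_real[of "max (\<xi> - \<delta>) 0" \<xi>] d(1) xi by auto
  obtain c where c: "c \<in> \<rat>" "\<xi> < c" "c < \<xi> + \<delta>" using Rats_dense_in_real[of \<xi> "\<xi> + \<delta>"] d(1) by auto
  have a0: "0 < a" and c0: "0 < c" using a c xi by auto
  have Fa: "\<bar>F a - F \<xi>\<bar> < e / 2" and Fc: "\<bar>F c - F \<xi>\<bar> < e / 2" using d(2) a c by auto
  have "\<forall>\<^sub>F k in sequentially. dist (h (rho k) (a / rho k ^ n)) (F a) < e / 2"
    by (rule tendstoD[OF lim[OF a(1) a0]]) (use e in simp)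
  moreover have "\<forall>\<^sub>F k in sequentially. dist (h (rho k) (c / rho k ^ n)) (F c) < e / 2"
    by (rule tendstoD[OF lim[OF c(1) c0]]) (use e in simp)
  moreover have "\<forall>\<^sub>F k in sequentially. (rho k / rho (Suc k)) ^ n < min (\<xi> / a) (c / \<xi>)"
    by (rule order_tendstoD(2)[OF rho_ratio_tendsto]) (use a c a0 xi in simp)
  ultimately have "\<forall>\<^sub>F k in sequentially. dist (h (rho k) (a / rho k ^ n)) (F a) < e / 2 \<and>
    dist (h (rho k) (c / rho k ^ n)) (F c) < e / 2 \<and> (rho k / rho (Suc k)) ^ n < min (\<xi> / a) (c / \<xi>)"
    by (intro eventually_conj)
  then obtain k0 where k0: "\<And>k. k0 \<le> k \<Longrightarrow> dist (h (rho k) (a / rho k ^ n)) (F a) < e / 2 \<and>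
    dist (h (rho k) (c / rho k ^ n)) (F c) < e / 2 \<and> (rho k / rho (Suc k)) ^ n < min (\<xi> / a) (c / \<xi>)"
    unfolding eventually_sequentially by blast
  have "dist (h r (\<xi> / r ^ n)) (F \<xi>) < e" if r: "0 < r" "r < rho k0" for r
  proof -
    have "\<forall>\<^sub>F m in sequentially. rho m < r" by (rule order_tendstoD(2)[OF rho_tendsto_0 r(1)])
    then obtain m0 where m0: "rho m0 \<le> r" by (meson eventually_sequentially order_refl less_imp_le)
    \<comment> \<open>The least such index exceeds \<open>k0\<close>, so it has a predecessor, whose
      radius is above \<open>r\<close>.\<close>
    define m where "m = (LEAST m. rho m \<le> r)"
    have m: "rho m \<le> r" unfolding m_def using m0 by (rule LeastI)
    have "k0 < m"
    proof (rule ccontr)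
      assume "\<not> k0 < m"
      then show False using rho_antimono[of m k0] m r(2) by simp
    qed
    then obtain k where k: "m = Suc k" "k0 \<le> k" by (cases m) auto
    have "\<not> rho k \<le> r" using not_less_Least[of k "\<lambda>m. rho m \<le> r"] k(1) unfolding m_def by simp
    then have rk: "r \<le> rho k" "rho (Suc k) \<le> r" using m k(1) by auto
    have p: "0 < rho k" "0 < rho (Suc k)" using rho_pos by auto
    have ratio: "(rho k / rho (Suc k)) ^ n < \<xi> / a" "(rho k / rho (Suc k)) ^ n < c / \<xi>" using k0[OF k(2)] by auto
    have up: "h r (\<xi> / r ^ n) \<le> h (rho (Suc k)) (a / rho (Suc k) ^ n)"
    proof (rule mono[OF p(2) rk(2)])
      have "(r / rho (Suc k)) ^ n \<le> (rho k / rho (Suc k)) ^ n" using rk p r by (intro power_mono divide_right_mono) auto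
      then have "(r / rho (Suc k)) ^ n \<le> \<xi> / a" using ratio(1) by linarith
      then have "(r / rho (Suc k)) ^ n * a \<le> \<xi>" by (simp only: pos_le_divide_eq[OF a0])
      then show "a / rho (Suc k) ^ n \<le> \<xi> / r ^ n" using r(1) p by (simp add: power_divide divide_simps mult.commute)
    qed
    have lo: "h (rho k) (c / rho k ^ n) \<le> h r (\<xi> / r ^ n)"
    proof (rule mono[OF r(1) rk(1)])
      have "(rho k / r) ^ n \<le> (rho k / rho (Suc k)) ^ n" using rk p r by (intro power_mono divide_left_mono mult_pos_pos) auto
      then have "(rho k / r) ^ n \<le> c / \<xi>" using ratio(2) by linarith
      then have "(rho k / r) ^ n * \<xi> \<le> c" by (simp only: pos_le_divide_eq[OF xi])
      then show "\<xi> / r ^ n \<le> c / rho k ^ n" using r(1) p by (simp add: power_divide divide_simps mult.commute)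
    qed
    have "dist (h (rho (Suc k)) (a / rho (Suc k) ^ n)) (F a) < e / 2" "dist (h (rho k) (c / rho k ^ n)) (F c) < e / 2"
      using k0[of "Suc k"] k0[of k] k(2) by auto
    then show ?thesis using up lo Fa Fc unfolding dist_real_def abs_less_iff by linarith
  qed
  then show "\<forall>\<^sub>F r in at_right 0. dist (h r (\<xi> / r ^ n)) (F \<xi>) < e"
    using rho_pos[of k0] unfolding eventually_at_right_field by blast
qed

text \<open>Continuity is not part of \<open>free_path_limit\<close>. It follows from
  \<open>limit_function_bounds\<close>, applied to a weight whose integral \<open>I\<close> is
  positive so that it can be divided out.\<close>

lemma free_path_limit_isCont:
  fixes P :: "(real^'d) set"
  assumes P: "almost_periodic_points P C0" and dim: "2 \<le> CARD('d)" and lim: "free_path_limit P F" and xi: "0 < \<xi>"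
  shows "isCont F \<xi>"
proof -
  let ?b = "bump (cball (0::real^'d) 1) 0"
  have wp: "weighted_points P C0 ?b (real (Suc 0)) (1 + 1)"
    by (rule bump_weighted_points[OF P]) (use dim in auto)
  define I where "I = (\<integral>x. ?b x \<partial>lborel)"
  have "measure lborel (cball (0::real^'d) 1) = (\<integral>x. indicator (cball (0::real^'d) 1) x \<partial>lborel)" by simp
  also have "\<dots> \<le> I" unfolding I_def
    by (intro integral_mono integrable_indicator_cball weighted_points.integrable_b[OF wp])
      (auto simp: indicator_def bump_def)
  finally have I: "0 < I" using content_cball_pos[of 1 "0::real^'d"] by linarith
  define \<kappa> where "\<kappa> = measure lborel (cball (0::real^'d) (1 + 1 + 1))"
  define g where "g t = \<kappa> * (C0 * (2 + t) ^ CARD('d) * 2 ^ CARD('d) * t) / I" for t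
  have close: "\<bar>F x - F y\<bar> \<le> g (y - x)" if xy: "0 < x" "x \<le> y" for x y
  proof -
    note bd = weighted_points.limit_function_bounds[OF wp xy macro_mean_tendsto[OF wp lim]]
    have "F y * I \<le> F x * I" "F x * I - F y * I \<le> g (y - x) * I"
      using bd I unfolding I_def[symmetric] g_def \<kappa>_def by simp_all
    then have "F y \<le> F x" "(F x - F y) * I \<le> g (y - x) * I" using I by (simp_all add: left_diff_distrib)
    then show ?thesis using I by simp
  qed
  have g0: "((\<lambda>y. g \<bar>y - \<xi>\<bar>) \<longlongrightarrow> 0) (at \<xi>)"
  proof -
    have "((\<lambda>y. g \<bar>y - \<xi>\<bar>) \<longlongrightarrow> g \<bar>\<xi> - \<xi>\<bar>) (at \<xi>)"
      unfolding g_def by (intro tendsto_intros) (use I in auto)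
    then show ?thesis by (simp add: g_def)
  qed
  have "((\<lambda>y. F y - F \<xi>) \<longlongrightarrow> 0) (at \<xi>)"
  proof (rule Lim_null_comparison[OF _ g0])
    have "\<forall>\<^sub>F y in at \<xi>. 0 < y" using xi by (intro order_tendstoD(1)[OF tendsto_ident_at])
    then show "\<forall>\<^sub>F y in at \<xi>. norm (F y - F \<xi>) \<le> g \<bar>y - \<xi>\<bar>"
    proof eventually_elim
      case (elim y)
      then show ?case using close[of y \<xi>] close[of \<xi> y] xi by (cases "y \<le> \<xi>") (auto simp: abs_minus_commute)
    qed
  qed
  then show ?thesis unfolding isCont_def by (simp add: LIM_zero_iff)
qed

theorem theorem1p2:
  fixes W :: "(real^'m) set" and L :: "((real^'d) \<times> (real^'m)) set"
    and F :: "real \<Rightarrow> real"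
  assumes "CARD('d) \<ge> 2"
    and "regular_cps W L"
    and "free_path_limit (cps W L) F"
  shows "\<exists>S :: (real^'d) set. S \<in> null_sets lebesgue \<and>
           (\<forall>q. q \<notin> S \<longrightarrow>
              (\<forall>\<xi> > 0. \<forall>lam. ac_sphere_prob lam \<longrightarrow>
                 ((\<lambda>\<rho>. measure lam {v \<in> sphere 0 1.
                      ereal (\<rho> ^ (CARD('d) - 1)) * tau1 (cps W L) q v \<rho> \<ge> ereal \<xi>})
                  \<longlongrightarrow> F \<xi>) (at_right 0)))"
proof -
  let ?P = "cps W L" and ?n = "CARD('d) - 1"
  obtain C0 where P: "almost_periodic_points ?P C0" using regular_cps_almost_periodic[OF assms(2)] by blast
  \<comment> \<open>The null set is fixed here, before \<open>\<xi>\<close> and \<open>lam\<close>: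
    outside it all rational lengths and all integrable densities are covered simultaneously.\<close>
  obtain S where good': "\<And>q. q \<in> space lborel - S \<Longrightarrow> \<forall>\<xi>\<in>\<rat> \<inter> {0<..}. \<forall>\<Phi>. integrable lborel \<Phi> \<longrightarrow>
      L1_limit (\<lambda>k. free_ind ?P (rho k) (\<xi> / rho k ^ ?n) q) (F \<xi>) \<Phi>"
    and S: "S \<in> null_sets lborel"
    by (rule AE_E3[OF AE_L1_limit_free_ind[OF P assms(1,3)]]) blast
  have good: "\<forall>\<xi>\<in>\<rat> \<inter> {0<..}. \<forall>\<Phi>. integrable lborel \<Phi> \<longrightarrow>
    L1_limit (\<lambda>k. free_ind ?P (rho k) (\<xi> / rho k ^ ?n) q) (F \<xi>) \<Phi>" if "q \<notin> S" for q
    by (rule good') (use that in simp)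
  have "((\<lambda>\<rho>. measure lam {v \<in> sphere 0 1. ereal (\<rho> ^ ?n) * tau1 ?P q v \<rho> \<ge> ereal \<xi>}) \<longlongrightarrow> F \<xi>) (at_right 0)"
    if q: "q \<notin> S" and xi: "0 < \<xi>" and lam: "ac_sphere_prob lam" for q \<xi> and lam :: "(real^'d) measure"
  proof -
    obtain \<Phi> where \<Phi>: "integrable lborel \<Phi>" "(\<integral>x. \<Phi> x \<partial>lborel) = 1"
      "\<And>P r l q. measure lam {v \<in> sphere 0 1. tube_free P r l q v} = (\<integral>x. \<Phi> x * free_ind P r l q x \<partial>lborel)"
      using sphere_prob_density[OF lam] by blast
    interpret lam: prob_space lam using lam by (simp add: ac_sphere_prob_def)
    have sl: "sets lam = sets borel" using lam by (simp add: ac_sphere_prob_def)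
    define h where "h r l = measure lam {v \<in> sphere 0 1. tube_free ?P r l q v}" for r l
    have "((\<lambda>r. h r (\<xi> / r ^ ?n)) \<longlongrightarrow> F \<xi>) (at_right 0)"
    proof (rule sandwich_limit[OF _ _ free_path_limit_isCont[OF P assms(1,3) xi] xi])
      fix r r' l l' :: real assume r: "0 < r'" "r' \<le> r" "l' \<le> l"
      have E: "{v \<in> sphere 0 1. tube_free ?P r l q v} \<in> sets lam" for r l
      proof -
        have "closed (sphere 0 1 \<inter> (\<lambda>v. (q, v)) -` {z. tube_free ?P r l (fst z) (snd z)})"
          by (intro closed_Int closed_sphere closed_vimage closed_tube_free continuous_intros)
        moreover have "{v \<in> sphere 0 1. tube_free ?P r l q v} = sphere 0 1 \<inter> (\<lambda>v. (q, v)) -` {z. tube_free ?P r l (fst z) (snd z)}" by auto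
        ultimately show ?thesis by (simp add: sl)
      qed
      show "h r l \<le> h r' l'" unfolding h_def
        using r by (intro lam.finite_measure_mono E) (auto intro: tube_free_mono)
    next
      fix \<xi> :: real assume "\<xi> \<in> \<rat>" "0 < \<xi>"
      then have "L1_limit (\<lambda>k. free_ind ?P (rho k) (\<xi> / rho k ^ ?n) q) (F \<xi>) \<Phi>" using good[OF q] \<Phi>(1) by blast
      then show "(\<lambda>k. h (rho k) (\<xi> / rho k ^ ?n)) \<longlonglongrightarrow> F \<xi>"
        unfolding L1_limit_def h_def \<Phi>(3) by (simp add: \<Phi>(2))
    qed
    then show ?thesis
    proof (rule Lim_transform_eventually)
      show "\<forall>\<^sub>F \<rho> in at_right 0. h \<rho> (\<xi> / \<rho> ^ ?n) = measure lam {v \<in> sphere 0 1. ereal (\<rho> ^ ?n) * tau1 ?P q v \<rho> \<ge> ereal \<xi>}"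
        using eventually_at_right_less[of 0]
        by eventually_elim (simp add: h_def tau1_ge_iff)
    qed
  qed
  moreover have "S \<in> null_sets lebesgue" using S by (rule null_sets_completionI)
  ultimately show ?thesis by blast
qed

end
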